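(* Let $X$ be a tight $t$-design in $\mathbb F\mathbb P^n$. Then the angle set $A(X)$ is rational (i.e. $A(X)\subset\mathbb Q$), except for two cases: (1) $\mathbb F=\mathbb C$, $n=1$ (i.e. $X\subset\mathbb C\mathbb P^1$) and $t=5$; (2) $\mathbb F=\mathbb R$, $n=1$ (i.e. $X\subset\mathbb R\mathbb P^1$) and $t\notin\{1,2,3,5\}$.
   Context: Let $\mathbb F\in\{\mathbb R,\mathbb C,\mathbb H\}$ ($\mathbb H$ = quaternions), $m=\tfrac12\dim_{\mathbb R}\mathbb F$ (so $m=1/2,1,2$ respectively), $n\ge 1$, $N=m(n+1)$. $\mathbb F^{n+1}$ is the space of columns over $\mathbb F$ with scalars acting on the right; the inner product of $a,b$ is $a^*b$. $S^{2N-1}=\{a\in\mathbb F^{n+1}: a^*a=1\}$. The projective space $\mathbb F\mathbb P^n$ is the quotient of $S^{2N-1}$ by $a\sim a\lambda$ ($\lambda\in\mathbb F$, $|\lambda|=1$), with quotient map $a\mapsto \hat a$; for $x=\hat a$, $y=\hat b$ put $(x,y)=|a^*b|^2\in[0,1]$. For finite nonempty $X\subset\mathbb F\mathbb P^n$, the angle set is $A(X)=\{(x,y):x,y\in X,\ x\ne y\}$; put $s=|A(X)|$, $e=|A(X)\setminus\{0\}|$. Let $(\gamma)_i=\gamma(\gamma+1)\cdots(\gamma+i-1)$, $(\gamma)_0=1$. $P_i^{(\alpha,\beta)}$ denotes the classical Jacobi polynomial of degree $i$, orthogonal on $[-1,1]$ with respect to $(1-\tau)^\alpha(1+\tau)^\beta$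 and normalized by $P_i^{(\alpha,\beta)}(1)=(\alpha+1)_i/i!$. Fix $\alpha=N-m-1$, $\beta=m-1$ and set $P_i(\xi)=P_i^{(\alpha,\beta)}(2\xi-1)$. A finite nonempty $X\subset\mathbb F\mathbb P^n$ is a $t$-design ($t\ge1$ an integer) if $\sum_{x\in X}P_i((x,y))=0$ for all $y\in X$ and $1\le i\le t$. A $t$-design is tight if $t=s+e$ (equivalently, as is known, $|X|=\frac{(N)_s(N-m+1)_e}{(m)_s\,e!}$). *)

theory Defs
  imports "HOL-Analysis.Analysis" "HOL-Computational_Algebra.Polynomial"
begin

section \<open>Quaternions\<close>

datatype quat = Quat (qRe: real) (qIm1: real) (qIm2: real) (qIm3: real)

lemma quat_eq_iff:
  "x = y \<longleftrightarrow> qRe x = qRe y \<and> qIm1 x = qIm1 y \<and> qIm2 x = qIm2 y \<and> qIm3 x = qIm3 y"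
  by (cases x; cases y) simp

instantiation quat :: real_algebra_1
begin

definition "0 = Quat 0 0 0 0"
definition "1 = Quat 1 0 0 0"
definition "x + y = Quat (qRe x + qRe y) (qIm1 x + qIm1 y) (qIm2 x + qIm2 y) (qIm3 x + qIm3 y)"
definition "- x = Quat (- qRe x) (- qIm1 x) (- qIm2 x) (- qIm3 x)"
definition "x - y = Quat (qRe x - qRe y) (qIm1 x - qIm1 y) (qIm2 x - qIm2 y) (qIm3 x - qIm3 y)"
definition "r *\<^sub>R x = Quat (r * qRe x) (r * qIm1 x) (r * qIm2 x) (r * qIm3 x)"
definition "x * y = Quat
  (qRe x * qRe y - qIm1 x * qIm1 y - qIm2 x * qIm2 y - qIm3 x * qIm3 y)
  (qRe x * qIm1 y + qIm1 x * qRe y + qIm2 x * qIm3 y - qIm3 x * qIm2 y)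
  (qRe x * qIm2 y - qIm1 x * qIm3 y + qIm2 x * qRe y + qIm3 x * qIm1 y)
  (qRe x * qIm3 y + qIm1 x * qIm2 y - qIm2 x * qIm1 y + qIm3 x * qRe y)"

lemmas quat_ops_defs = zero_quat_def one_quat_def plus_quat_def uminus_quat_def minus_quat_def
  scaleR_quat_def times_quat_def

instance
  by standard (simp_all add: quat_ops_defs algebra_simps)

end

instantiation quat :: euclidean_space
begin

definition "inner x y = qRe x * qRe y + qIm1 x * qIm1 y + qIm2 x * qIm2 y + qIm3 x * qIm3 y"
definition "norm (x :: quat) = sqrt (inner x x)"
definition "sgn (x :: quat) = x /\<^sub>R norm x"
definition "dist (x :: quat) y = norm (x - y)"
definition "(uniformity :: (quat \<times> quat) filter) = (INF e\<in>{0 <..}. principal {(x, y). dist x y < e})"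
definition "open (U :: quat set) \<longleftrightarrow> (\<forall>x\<in>U. eventually (\<lambda>(x', y). x' = x \<longrightarrow> y \<in> U) uniformity)"
definition "Basis = {Quat 1 0 0 0, Quat 0 1 0 0, Quat 0 0 1 0, Quat 0 0 0 1}"

instance
proof
  fix x :: quat
  show "(\<forall>u\<in>Basis. inner x u = 0) \<longleftrightarrow> x = 0"
    by (cases x) (simp add: inner_quat_def Basis_quat_def zero_quat_def)
  show "inner x x = 0 \<longleftrightarrow> x = 0"
    by (auto simp: inner_quat_def zero_quat_def quat_eq_iff add_nonneg_eq_0_iff)
qed (rule sgn_quat_def dist_quat_def uniformity_quat_def open_quat_def norm_quat_def
    | force simp: inner_quat_def Basis_quat_def quat_ops_defs quat_eq_iff algebra_simps)+

end

lemma DIM_quat [simp]: "DIM(quat) = 4"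
  by (simp add: Basis_quat_def)

lemma norm_quat_power2:
  "(norm x)\<^sup>2 = (qRe x)\<^sup>2 + (qIm1 x)\<^sup>2 + (qIm2 x)\<^sup>2 + (qIm3 x)\<^sup>2" for x :: quat
  by (simp add: norm_quat_def inner_quat_def power2_eq_square)

definition quat_cnj :: "quat \<Rightarrow> quat" where
  "quat_cnj x = Quat (qRe x) (- qIm1 x) (- qIm2 x) (- qIm3 x)"

lemma quat_cnj_mult_self: "quat_cnj x * x = of_real ((norm x)\<^sup>2)"
  by (simp add: norm_quat_power2 of_real_def quat_cnj_def quat_ops_defs del: of_real_power)
    (simp add: power2_eq_square)

lemma quat_mult_cnj_self: "x * quat_cnj x = of_real ((norm x)\<^sup>2)"
  by (simp add: norm_quat_power2 of_real_def quat_cnj_def quat_ops_defs del: of_real_power)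
    (simp add: power2_eq_square)

lemma quat_cnj_mult: "quat_cnj (x * y) = quat_cnj y * quat_cnj x"
  by (simp add: quat_cnj_def quat_ops_defs algebra_simps)

instantiation quat :: real_normed_div_algebra
begin

definition "inverse x = quat_cnj x /\<^sub>R (norm x)\<^sup>2"
definition "x div y = x * inverse (y :: quat)"

instance
proof
  fix x y :: quat
  show "norm (x * y) = norm x * norm y"
  proof (rule power2_eq_imp_eq)
    show "(norm (x * y))\<^sup>2 = (norm x * norm y)\<^sup>2"
      unfolding power_mult_distrib norm_quat_power2
      by (simp add: times_quat_def) algebra
  qed auto
  show "x \<noteq> 0 \<Longrightarrow> inverse x * x = 1" "x \<noteq> 0 \<Longrightarrow> x * inverse x = 1"
    using quat_cnj_mult_self[of x] quat_mult_cnj_self[of x]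
    by (simp_all add: inverse_quat_def of_real_def)
  show "x div y = x * inverse y"
    by (rule divide_quat_def)
  show "inverse (0 :: quat) = 0"
    by (simp add: inverse_quat_def)
qed

end


section \<open>The scalars\<close>

text \<open>
  A class providing the operations common to the reals, the complex numbers and the quaternions.
  It serves to define all notions once for the three types and is instantiated for these only.
\<close>

class conj_div_algebra = real_normed_div_algebra + euclidean_space +
  fixes conj :: "'a \<Rightarrow> 'a"
  assumes conj_add: "conj (x + y) = conj x + conj y"
    and conj_mult: "conj (x * y) = conj y * conj x"
    and conj_mult_self: "conj x * x = (norm x)\<^sup>2 *\<^sub>R 1"

instantiation real :: conj_div_algebra
begin
definition conj_real :: "real \<Rightarrow> real" where "conj_real x = x"
instance by standard (auto simp: conj_real_def power2_eq_square)
end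

instantiation complex :: conj_div_algebra
begin
definition conj_complex :: "complex \<Rightarrow> complex" where "conj_complex = cnj"
instance
  by standard (auto simp: conj_complex_def complex_norm_square mult.commute scaleR_conv_of_real
      simp del: of_real_power)
end

instantiation quat :: conj_div_algebra
begin
definition conj_quat :: "quat \<Rightarrow> quat" where "conj_quat = quat_cnj"
instance
  by standard (simp_all add: conj_quat_def quat_cnj_mult quat_cnj_mult_self of_real_def,
      simp add: quat_cnj_def plus_quat_def)
end

lemma conj_0 [simp]: "conj (0 :: 'a :: conj_div_algebra) = 0"
  using conj_add[of 0 0] by simp

lemma norm_conj [simp]: "norm (conj x) = norm (x :: 'a :: conj_div_algebra)"
proof (cases "x = 0")
  case False
  have "norm (conj x) * norm x = norm x * norm x"
    by (simp add: conj_mult_self power2_eq_square flip: norm_mult)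
  with False show ?thesis by simp
qed simp

lemma conj_sum: "conj (sum f A) = (\<Sum>i\<in>A. conj (f i :: 'a :: conj_div_algebra))"
  by (induction A rule: infinite_finite_induct) (auto simp: conj_add)


section \<open>Projective space\<close>

definition herm :: "'a :: conj_div_algebra ^ 'n \<Rightarrow> 'a ^ 'n \<Rightarrow> 'a" where
  "herm a b = (\<Sum>i\<in>UNIV. conj (a $ i) * b $ i)"

definition rscale :: "'a :: conj_div_algebra ^ 'n \<Rightarrow> 'a \<Rightarrow> 'a ^ 'n" where
  "rscale a c = (\<chi> i. a $ i * c)"

definition unit_vec :: "'a :: conj_div_algebra ^ 'n \<Rightarrow> bool" where
  "unit_vec a \<longleftrightarrow> herm a a = 1"

definition proj_rel :: "'a :: conj_div_algebra ^ 'n \<Rightarrow> 'a ^ 'n \<Rightarrow> bool" where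
  "proj_rel a b \<longleftrightarrow> unit_vec a \<and> unit_vec b \<and> (\<exists>c. norm c = 1 \<and> b = rscale a c)"

lemma herm_rscale: "herm (rscale a c) (rscale b d) = conj c * herm a b * d"
  by (simp add: herm_def rscale_def conj_mult sum_distrib_left sum_distrib_right mult.assoc)

lemma part_equivp_proj_rel: "part_equivp (proj_rel :: 'a :: conj_div_algebra ^ 'n \<Rightarrow> _)"
proof (rule part_equivpI)
  have "conj (1 :: 'a) = 1"
    using conj_mult_self[of "1 :: 'a"] by simp
  then have "unit_vec (axis k 1 :: 'a ^ 'n)" for k
    unfolding unit_vec_def herm_def
    by (subst sum.mono_neutral_right[where S = "{k}"]) (auto simp: axis_def)
  moreover have "a = rscale a 1" for a :: "'a ^ 'n"
    by (simp add: rscale_def)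
  ultimately show "\<exists>a :: 'a ^ 'n. proj_rel a a"
    unfolding proj_rel_def by (metis norm_one)
  show "symp (proj_rel :: 'a ^ 'n \<Rightarrow> _)"
  proof (rule sympI)
    fix a b :: "'a ^ 'n"
    assume "proj_rel a b"
    then obtain c where c: "unit_vec a" "unit_vec b" "norm c = 1" "b = rscale a c"
      unfolding proj_rel_def by blast
    then have "c \<noteq> 0" by auto
    then have "a = rscale b (inverse c)"
      using c by (simp add: rscale_def vec_eq_iff mult.assoc)
    with c show "proj_rel b a"
      unfolding proj_rel_def by (metis norm_inverse inverse_1)
  qed
  show "transp (proj_rel :: 'a ^ 'n \<Rightarrow> _)"
  proof (rule transpI)
    fix a b c :: "'a ^ 'n"
    assume "proj_rel a b" "proj_rel b c"
    then obtain d e where *: "unit_vec a" "unit_vec c" "norm d = 1" "norm e = 1"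
      "b = rscale a d" "c = rscale b e"
      unfolding proj_rel_def by blast
    then have "c = rscale a (d * e)" "norm (d * e) = 1"
      by (auto simp: rscale_def vec_eq_iff mult.assoc norm_mult)
    with * show "proj_rel a c"
      unfolding proj_rel_def by blast
  qed
qed

text \<open>The quotient of the unit sphere in the space of columns indexed by \<open>'n\<close>; its dimension as
  a projective space is \<open>CARD('n) - 1\<close>.\<close>

quotient_type (overloaded) ('a, 'n) proj_space = "'a :: conj_div_algebra ^ 'n" / partial: proj_rel
  by (rule part_equivp_proj_rel)

lift_definition angle :: "('a :: conj_div_algebra, 'n :: finite) proj_space \<Rightarrow> ('a, 'n) proj_space \<Rightarrow> real"
  is "\<lambda>a b. (norm (herm a b))\<^sup>2"
  by (auto simp: proj_rel_def herm_rscale norm_mult)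

definition angle_set :: "('a :: conj_div_algebra, 'n :: finite) proj_space set \<Rightarrow> real set" where
  "angle_set X = {angle x y | x y. x \<in> X \<and> y \<in> X \<and> x \<noteq> y}"


section \<open>Jacobi polynomials\<close>

definition is_jacobi_poly :: "real \<Rightarrow> real \<Rightarrow> nat \<Rightarrow> real poly \<Rightarrow> bool" where
  "is_jacobi_poly \<alpha> \<beta> i p \<longleftrightarrow>
     degree p = i \<and>
     (\<forall>q. degree q < i \<longrightarrow>
       ((\<lambda>\<tau>. poly p \<tau> * poly q \<tau> * ((1 - \<tau>) powr \<alpha> * (1 + \<tau>) powr \<beta>)) has_integral 0) {-1..1}) \<and>
     poly p 1 = pochhammer (\<alpha> + 1) i / fact i"

definition jacobi_poly :: "real \<Rightarrow> real \<Rightarrow> nat \<Rightarrow> real poly" where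
  "jacobi_poly \<alpha> \<beta> i = (THE p. is_jacobi_poly \<alpha> \<beta> i p)"

text \<open>The defining conditions determine \<open>jacobi_poly \<alpha> \<beta> i\<close> whenever \<open>\<alpha>, \<beta> > -1\<close>.\<close>

context
  fixes \<alpha> \<beta> :: real
  assumes \<alpha>: "\<alpha> > -1" and \<beta>: "\<beta> > -1"
begin

private definition w :: "real \<Rightarrow> real" where
  "w \<tau> = (1 - \<tau>) powr \<alpha> * (1 + \<tau>) powr \<beta>"

private definition L :: "real poly \<Rightarrow> real" where
  "L p = integral {-1..1} (\<lambda>\<tau>. poly p \<tau> * w \<tau>)"

private definition low :: "nat \<Rightarrow> real poly \<Rightarrow> bool" where
  "low i q \<longleftrightarrow> (\<forall>k\<ge>i. coeff q k = 0)"

private lemma w_integrable: "w absolutely_integrable_on {-1..1}"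
proof (rule nonnegative_absolutely_integrable_1)
  have "((\<lambda>t. t powr \<beta> * (1 - t) powr \<alpha>) has_integral Beta (\<beta> + 1) (\<alpha> + 1)) (cbox 0 1)"
    using has_integral_Beta_real[of "\<beta> + 1" "\<alpha> + 1"] \<alpha> \<beta> by simp
  from has_integral_affinity[OF this, of "1/2" "1/2"]
  have "(\<lambda>x. ((x + 1) / 2) powr \<beta> * (1 - (x + 1) / 2) powr \<alpha>) integrable_on
      ((\<lambda>x. 2 * x - 1) ` {0..1})"
    by (auto simp: integrable_on_def add_divide_distrib)
  also have "(\<lambda>x. 2 * x - 1) ` {0..1} = {-1..1 :: real}"
    using image_affinity_atLeastAtMost_diff[of 2 1 0 1] by simp
  finally have "(\<lambda>x. 2 powr (\<alpha> + \<beta>) * (((x + 1) / 2) powr \<beta> * (1 - (x + 1) / 2) powr \<alpha>))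
      integrable_on {-1..1}"
    by (intro integrable_on_mult_right)
  moreover have "2 powr (\<alpha> + \<beta>) * (((x + 1) / 2) powr \<beta> * (1 - (x + 1) / 2) powr \<alpha>) = w x"
    if "x \<in> {-1..1}" for x
  proof -
    have "((x + 1) / 2) powr \<beta> = (1 + x) powr \<beta> / 2 powr \<beta>"
      using that by (simp add: powr_divide add.commute)
    moreover have "(1 - (x + 1) / 2) powr \<alpha> = ((1 - x) / 2) powr \<alpha>"
      by (simp add: field_simps)
    moreover have "((1 - x) / 2) powr \<alpha> = (1 - x) powr \<alpha> / 2 powr \<alpha>"
      using that by (simp add: powr_divide)
    ultimately show ?thesis
      by (simp add: w_def powr_add)
  qed
  ultimately show "w integrable_on {-1..1}"
    using integrable_eq by blast
qed (simp add: w_def)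

private lemma poly_w_integrable: "(\<lambda>\<tau>. poly p \<tau> * w \<tau>) integrable_on {-1..1}"
proof -
  have c: "continuous_on {-1..1} (poly p)"
    by (intro continuous_intros)
  have "(\<lambda>\<tau>. poly p \<tau> * w \<tau>) absolutely_integrable_on {-1..1}"
  proof (rule absolutely_integrable_bounded_measurable_product_real)
    show "poly p \<in> borel_measurable (lebesgue_on {-1..1})"
      using c by (intro continuous_imp_measurable_on_sets_lebesgue) auto
    show "bounded (poly p ` {-1..1})"
      using c by (intro compact_imp_bounded compact_continuous_image) auto
  qed (use w_integrable in auto)
  then show ?thesis
    using set_lebesgue_integral_eq_integral(1) by blast
qed

private lemma L_add: "L (p + q) = L p + L q"
  unfolding L_def by (simp add: distrib_right integral_add poly_w_integrable)

private lemma L_smult: "L (smult c p) = c * L p"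
  unfolding L_def by (simp add: mult.assoc)

private lemma L_diff: "L (p - q) = L p - L q"
  using L_add[of "p - q" q] by simp

private lemma L_pos:
  assumes "p \<noteq> 0" and nonneg: "\<And>x. x \<in> {-1..1} \<Longrightarrow> poly p x \<ge> 0"
  shows "L p > 0"
proof -
  let ?f = "\<lambda>\<tau>. poly p \<tau> * w \<tau>"
  have nn: "?f x \<ge> 0" if "x \<in> {-1..1}" for x
    using nonneg[OF that] by (simp add: w_def)
  have c: "continuous_on {-1/2..1/2} ?f"
    unfolding w_def by (intro continuous_intros) auto
  have sub: "integral {-1/2..1/2} ?f \<le> L p"
    unfolding L_def
    by (rule integral_subset_le) (use nn poly_w_integrable c in \<open>auto intro: integrable_continuous_real\<close>)
  have "integral {-1/2..1/2} ?f \<noteq> 0"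
  proof
    assume "integral {-1/2..1/2} ?f = 0"
    then have "?f x = 0" if "x \<in> {-1/2..1/2}" for x
      using integral_eq_0_iff[OF c _ _] nn that by auto
    then have "poly p x = 0" if "x \<in> {-1/2..1/2}" for x
      using that by (force simp: w_def)
    then have "{-1/2..1/2} \<subseteq> {x. poly p x = 0}"
      by blast
    then have "finite {-1/2..1/2 :: real}"
      using poly_roots_finite[OF \<open>p \<noteq> 0\<close>] finite_subset by blast
    then show False
      using infinite_Icc[of "-1/2" "1/2 :: real"] by simp
  qed
  moreover have "integral {-1/2..1/2} ?f \<ge> 0"
    using c nn by (intro integral_nonneg integrable_continuous_real) auto
  ultimately show ?thesis
    using sub by linarith
qed

private lemma L_sq_pos: "p \<noteq> 0 \<Longrightarrow> L (p * p) > 0"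
  by (rule L_pos) auto

private lemma projection: "\<exists>g. low i g \<and> (\<forall>q. low i q \<longrightarrow> L ((f - g) * q) = 0)"
proof (induction i arbitrary: f)
  case 0
  have "L (f * q) = 0" if "low 0 q" for q
  proof -
    have "q = 0"
      using that by (simp add: low_def poly_eq_iff)
    then show ?thesis
      by (simp add: L_def)
  qed
  then show ?case
    by (intro exI[of _ 0]) (auto simp: low_def)
next
  case (Suc i)
  obtain h where h: "low i h" "\<And>q. low i q \<Longrightarrow> L ((monom 1 i - h) * q) = 0"
    using Suc.IH by blast
  obtain g where g: "low i g" "\<And>q. low i q \<Longrightarrow> L ((f - g) * q) = 0"
    using Suc.IH by blast
  define e where "e = monom 1 i - h"
  have ei: "coeff e i = 1" and e: "low (Suc i) e"
    using h(1) by (auto simp: e_def low_def)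
  then have "e \<noteq> 0" by auto
  then have pos: "L (e * e) > 0"
    by (rule L_sq_pos)
  define c where "c = L ((f - g) * e) / L (e * e)"
  show ?case
  proof (intro exI conjI allI impI)
    show "low (Suc i) (g + smult c e)"
      using g(1) e by (auto simp: low_def)
    fix q assume q: "low (Suc i) q"
    define r where "r = q - smult (coeff q i) e"
    have r: "low i r"
      unfolding low_def
    proof (intro allI impI)
      fix k assume "i \<le> k"
      then show "coeff r k = 0"
        using q e ei by (cases "k = i") (auto simp: low_def r_def)
    qed
    have "(f - (g + smult c e)) * q = smult (coeff q i) ((f - g) * e) - smult (c * coeff q i) (e * e)
        + (f - g) * r - smult c (e * r)"
      by (simp add: r_def algebra_simps smult_diff_right smult_add_right)
    then have "L ((f - (g + smult c e)) * q) =
        coeff q i * L ((f - g) * e) - c * coeff q i * L (e * e) + L ((f - g) * r) - c * L (e * r)"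
      by (simp add: L_add L_diff L_smult)
    also have "\<dots> = 0"
      using g(2)[OF r] h(2)[OF r] pos by (simp add: c_def e_def)
    finally show "L ((f - (g + smult c e)) * q) = 0" .
  qed
qed

private lemma is_jacobi_poly_iff:
  "is_jacobi_poly \<alpha> \<beta> i p \<longleftrightarrow>
     degree p = i \<and> (\<forall>q. low i q \<longrightarrow> L (p * q) = 0) \<and> poly p 1 = pochhammer (\<alpha> + 1) i / fact i"
proof -
  have 1: "((\<lambda>\<tau>. poly p \<tau> * poly q \<tau> * ((1 - \<tau>) powr \<alpha> * (1 + \<tau>) powr \<beta>)) has_integral 0) {-1..1}
      \<longleftrightarrow> L (p * q) = 0" for q
    using poly_w_integrable[of "p * q"] by (simp add: L_def has_integral_iff w_def)
  have 2: "low i q" if "degree q < i" for q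
    using that by (auto simp: low_def coeff_eq_0)
  have 3: "q = 0 \<or> degree q < i" if "low i q" for q
    using that leading_coeff_0_iff[of q] unfolding low_def by (meson not_le)
  have 4: "L (p * 0) = 0"
    by (simp add: L_def)
  have "(\<forall>q. degree q < i \<longrightarrow> L (p * q) = 0) \<longleftrightarrow> (\<forall>q. low i q \<longrightarrow> L (p * q) = 0)"
    using 2 3 4 by blast
  then show ?thesis
    unfolding is_jacobi_poly_def 1 by simp
qed

lemma ex1_is_jacobi_poly: "\<exists>!p. is_jacobi_poly \<alpha> \<beta> i p"
proof -
  define v where "v = pochhammer (\<alpha> + 1) i / fact i"
  have v: "v \<noteq> 0"
    using \<alpha> pochhammer_pos[of "\<alpha> + 1" i] by (simp add: v_def)
  obtain g where g: "low i g" "\<And>q. low i q \<Longrightarrow> L ((monom 1 i - g) * q) = 0"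
    using projection by blast
  define p where "p = monom 1 i - g"
  have pi: "coeff p i = 1" and plow: "low (Suc i) p"
    using g(1) by (auto simp: p_def low_def)
  then have p0: "p \<noteq> 0" by auto
  have deg: "degree p = i"
    using pi plow unfolding low_def
    by (metis le_antisym le_degree leading_coeff_0_iff not_less_eq_eq p0 zero_neq_one)
  have "poly p 1 \<noteq> 0"
  proof
    assume "poly p 1 = 0"
    then obtain r where r: "p = [:-1, 1:] * r"
      by (auto simp: poly_eq_0_iff_dvd)
    with p0 have r0: "r \<noteq> 0" by auto
    then have "degree r < i"
      using deg degree_mult_eq[of "[:-1, 1:]" r] by (simp add: r del: mult_pCons_left)
    then have "low i (- r)"
      by (auto simp: low_def coeff_eq_0)
    then have "L (p * (- r)) = 0"
      unfolding p_def by (rule g(2))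
    moreover have "L (p * (- r)) > 0"
    proof (rule L_pos)
      fix x :: real assume "x \<in> {-1..1}"
      then have "(1 - x) * (poly r x * poly r x) \<ge> 0"
        by (intro mult_nonneg_nonneg zero_le_square) auto
      then show "poly (p * (- r)) x \<ge> 0"
        by (simp add: r algebra_simps)
    qed (use p0 r0 in simp)
    ultimately show False by simp
  qed
  moreover define P where "P = smult (v / poly p 1) p"
  ultimately have P: "is_jacobi_poly \<alpha> \<beta> i P"
    using deg g(2) v by (auto simp: is_jacobi_poly_iff L_smult v_def p_def)
  have "p' = P" if p': "is_jacobi_poly \<alpha> \<beta> i p'" for p'
  proof -
    have *: "degree P = i" "degree p' = i" "poly P 1 = v" "poly p' 1 = v"
      "\<And>q. low i q \<Longrightarrow> L (P * q) = 0" "\<And>q. low i q \<Longrightarrow> L (p' * q) = 0"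
      using P p' by (auto simp: is_jacobi_poly_iff v_def)
    have "P \<noteq> 0" using * v by auto
    define c where "c = coeff p' i / coeff P i"
    define r where "r = p' - smult c P"
    have "coeff P i \<noteq> 0"
      using * \<open>P \<noteq> 0\<close> leading_coeff_0_iff by blast
    then have "coeff r k = 0" if "k \<ge> i" for k
      using that * by (cases "k = i") (auto simp: r_def c_def coeff_eq_0)
    then have r: "low i r"
      by (simp add: low_def)
    have "r * r = p' * r - smult c (P * r)"
      by (subst (1) r_def) (simp add: left_diff_distrib)
    then have "L (r * r) = 0"
      using *(5)[OF r] *(6)[OF r] by (simp add: L_diff L_smult)
    then have "r = 0"
      using L_sq_pos[of r] by force
    then have eq: "p' = smult c P"
      by (simp add: r_def)
    then have "v = c * v"
      using * by (metis poly_smult)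
    with v eq show ?thesis by simp
  qed
  with P show ?thesis by blast
qed

lemma is_jacobi_poly_jacobi_poly: "is_jacobi_poly \<alpha> \<beta> i (jacobi_poly \<alpha> \<beta> i)"
  unfolding jacobi_poly_def by (rule theI'[OF ex1_is_jacobi_poly])

end

section \<open>Designs\<close>

text \<open>The constant \<open>m\<close>: 1/2, 1, 2 for the reals, the complex numbers, the quaternions.\<close>

definition half_dim :: "'a :: conj_div_algebra itself \<Rightarrow> real" where
  "half_dim _ = real DIM('a) / 2"

text \<open>The polynomial \<open>P\<^sub>i\<close> attached to the projective space \<open>('a, 'n) proj_space\<close>.\<close>

definition proj_jacobi :: "('a :: conj_div_algebra, 'n :: finite) proj_space itself \<Rightarrow> nat \<Rightarrow> real \<Rightarrow> real" where
  "proj_jacobi _ i \<xi> =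
     (let m = half_dim TYPE('a); N = m * real CARD('n)
      in poly (jacobi_poly (N - m - 1) (m - 1) i) (2 * \<xi> - 1))"

definition projective_design :: "nat \<Rightarrow> ('a :: conj_div_algebra, 'n :: finite) proj_space set \<Rightarrow> bool" where
  "projective_design t X \<longleftrightarrow>
     t \<ge> 1 \<and> finite X \<and> X \<noteq> {} \<and>
     (\<forall>y\<in>X. \<forall>i\<in>{1..t}. (\<Sum>x\<in>X. proj_jacobi TYPE(('a, 'n) proj_space) i (angle x y)) = 0)"

definition tight_design :: "nat \<Rightarrow> ('a :: conj_div_algebra, 'n :: finite) proj_space set \<Rightarrow> bool" where
  "tight_design t X \<longleftrightarrow>
     projective_design t X \<and> t = card (angle_set X) + card (angle_set X - {0})"

end

theory Submission
  imports Defs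
begin

text \<open>
  Since the kernels \<open>\<bar>x\<^sup>* y\<bar>\<^sup>2\<^sup>k\<close> are positive semidefinite and constants are finite combinations of the
  functions \<open>x \<mapsto> \<bar>x\<^sup>* y\<bar>\<^sup>2\<^sup>k\<close> (Hilbert's identity), a \<open>t\<close>-design has equality in the Welch inequality, hence
  integrates every zonal function of degree at most \<open>t\<close> around every point. Polarization gives the
  convolution rule for zonal functions, and tightness then makes the matrices \<open>E\<^sub>i = Q\<^sub>i((x,y)) / \<bar>X\<bar>\<close>, for
  \<open>i < s\<close>, together with their complement \<open>E\<^sub>s\<close>, the primitive idempotents of an algebra spanned by the
  adjacency matrices \<open>D\<^sub>\<alpha>\<close> of the angles. With \<open>k\<^sub>\<alpha>\<close> the valency of \<open>D\<^sub>\<alpha>\<close> and \<open>m\<^sub>i\<close> the rank of \<open>E\<^sub>i\<close>, the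
  rational matrix \<open>\<Sum> D\<^sub>\<alpha>\<^sup>2 / (\<bar>X\<bar> k\<^sub>\<alpha>)\<close> equals \<open>\<Sum> E\<^sub>i / m\<^sub>i\<close>. So if \<open>m\<^sub>1\<close> differs from all other ranks, then
  \<open>E\<^sub>1\<close> is a rational polynomial in it, and \<open>E\<^sub>1\<close> is affine in the angle. Apart from the real projective
  line, the only coincidence is \<open>m\<^sub>1 = m\<^sub>s\<close> for 5-designs on the complex projective line. The
  exceptional cases are read off from the polynomial \<open>P\<^sub>e\<close> with parameters \<open>(\<alpha> + 1, \<beta> + s - e)\<close>, whose
  roots are the nonzero angles; for the real line it becomes a monic integer polynomial in \<open>4 \<xi>\<close>.
\<close>

section \<open>Powers of linear forms\<close>

text \<open>Throughout, \<open>a\<close> stands for N and \<open>b\<close> for m. Finite signed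
  measures replace integration over the projective space: the weights in Hilbert's identity may be
  negative, because the Welch argument takes its positivity from the kernel and never uses the sign
  of a weight. The decomposition into harmonics is replaced by one weak fact: convolving zonal
  polynomials of degrees i and j yields a polynomial of degree at most min(i, j). This bound and the
  values on the diagonal, which are moments, already force the Jacobi kernels to be orthogonal
  multiples of idempotents. Tightness gives 2 s <= t + 1, so the first s kernels can be multiplied,
  while the last idempotent is known only as a complement. Two obstacles result. Its nonvanishing is
  obtained by counting a trace. Its rank must be computed separately: for t = 2 s it is the next
  harmonic dimension, and for t = 2 s - 1 its scale is fixed by a pair of points with angle
  0.\<close>

definition power_form :: "nat \<Rightarrow> ('e :: euclidean_space \<Rightarrow> real) \<Rightarrow> bool" where
  "power_form k f \<longleftrightarrow> (\<exists>S w. finite S \<and> (\<forall>v. f v = (\<Sum>b\<in>S. w b * (v \<bullet> b) ^ k)))"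

lemma power_form_inner: "power_form k (\<lambda>v. (v \<bullet> b) ^ k)"
  unfolding power_form_def by (intro exI[of _ "{b}"] exI[of _ "\<lambda>_. 1"]) simp

lemma power_form_scale: "power_form k f \<Longrightarrow> power_form k (\<lambda>v. c * f v)"
  unfolding power_form_def
proof (elim exE conjE, intro exI conjI allI)
  fix S w v assume *: "\<forall>v. f v = (\<Sum>b\<in>S. w b * (v \<bullet> b) ^ k)"
  show "c * f v = (\<Sum>b\<in>S. (c * w b) * (v \<bullet> b) ^ k)"
    by (simp add: * sum_distrib_left mult.assoc)
qed

lemma power_form_0: "power_form k (\<lambda>_. 0)"
  using power_form_scale[OF power_form_inner, of k 0 undefined] by simp

lemma power_form_add:
  assumes "power_form k f" "power_form k g"
  shows "power_form k (\<lambda>v. f v + g v)"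
proof -
  obtain S w where S: "finite S" "\<And>v. f v = (\<Sum>b\<in>S. w b * (v \<bullet> b) ^ k)"
    using assms(1) unfolding power_form_def by blast
  obtain T u where T: "finite T" "\<And>v. g v = (\<Sum>b\<in>T. u b * (v \<bullet> b) ^ k)"
    using assms(2) unfolding power_form_def by blast
  let ?w = "\<lambda>b. (if b \<in> S then w b else 0) + (if b \<in> T then u b else 0)"
  have "f v + g v = (\<Sum>b\<in>S \<union> T. ?w b * (v \<bullet> b) ^ k)" for v
  proof -
    have "f v = (\<Sum>b\<in>S \<union> T. (if b \<in> S then w b else 0) * (v \<bullet> b) ^ k)"
      unfolding S(2) using S(1) T(1) by (intro sum.mono_neutral_cong_left) auto
    moreover have "g v = (\<Sum>b\<in>S \<union> T. (if b \<in> T then u b else 0) * (v \<bullet> b) ^ k)"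
      unfolding T(2) using S(1) T(1) by (intro sum.mono_neutral_cong_left) auto
    ultimately show ?thesis by (simp only: distrib_right sum.distrib)
  qed
  then show ?thesis
    unfolding power_form_def using S(1) T(1) by (intro exI[of _ "S \<union> T"] exI[of _ ?w]) simp
qed

lemma power_form_sum:
  "(\<And>i. i \<in> I \<Longrightarrow> power_form k (f i)) \<Longrightarrow> power_form k (\<lambda>v. \<Sum>i\<in>I. f i v)"
  by (induction I rule: infinite_finite_induct) (auto intro: power_form_0 power_form_add)

text \<open>The combination \<open>f (2 t) - 2 ^ D * f t\<close> eliminates the leading term.\<close>

lemma power_form_coefficient:
  assumes "\<And>t :: real. power_form k (\<lambda>v. \<Sum>i\<le>D. t ^ i * c i v)" and "i \<le> D"
  shows "power_form k (c i)"
  using assms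
proof (induction D arbitrary: c i)
  case 0
  then show ?case using "0.prems"(1)[of 1] by simp
next
  case (Suc D)
  have lower: "power_form k (c i)" if "i \<le> D" for i
  proof -
    have "power_form k (\<lambda>v. \<Sum>i\<le>D. t ^ i * ((2 ^ i - 2 ^ Suc D) * c i v))" for t :: real
    proof -
      have "power_form k (\<lambda>v. (\<Sum>i\<le>Suc D. (2 * t) ^ i * c i v) + (- (2 ^ Suc D)) * (\<Sum>i\<le>Suc D. t ^ i * c i v))"
        by (intro power_form_add power_form_scale Suc.prems)
      also have "(\<lambda>v. (\<Sum>i\<le>Suc D. (2 * t) ^ i * c i v) + (- (2 ^ Suc D)) * (\<Sum>i\<le>Suc D. t ^ i * c i v)) =
          (\<lambda>v. \<Sum>i\<le>D. t ^ i * ((2 ^ i - 2 ^ Suc D) * c i v))"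
        by (simp add: sum_distrib_left power_mult_distrib algebra_simps sum_subtractf sum_negf)
      finally show ?thesis .
    qed
    then have "power_form k (\<lambda>v. (2 ^ i - 2 ^ Suc D) * c i v)"
      by (rule Suc.IH) (rule that)
    then have "power_form k (\<lambda>v. 1 / (2 ^ i - 2 ^ Suc D) * ((2 ^ i - 2 ^ Suc D) * c i v))"
      by (rule power_form_scale)
    moreover have "(2 :: real) ^ i \<noteq> 2 ^ Suc D"
      using that by (subst power_inject_exp) auto
    ultimately show ?thesis by simp
  qed
  have "power_form k (\<lambda>v. (\<Sum>i\<le>Suc D. 1 ^ i * c i v) + (-1) * (\<Sum>i\<le>D. c i v))"
    by (intro power_form_add power_form_scale power_form_sum Suc.prems(1) lower) auto
  then have "power_form k (c (Suc D))" by simp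
  with lower Suc.prems(2) show ?case
    by (cases "i = Suc D") auto
qed

text \<open>Polarization: up to a binomial factor, (v . b)^k (v . e)^l is the coefficient of t^l in
  the pure power (v . (t e + b))^(k + l), and coefficients in t stay in the span of pure
  powers.\<close>

lemma power_form_mult:
  assumes "power_form k f"
  shows "power_form (k + l) (\<lambda>v. f v * (v \<bullet> e) ^ l)"
proof -
  have *: "power_form (k + l) (\<lambda>v. (v \<bullet> b) ^ k * (v \<bullet> e) ^ l)" for b
  proof -
    have "power_form (k + l) (\<lambda>v. \<Sum>i\<le>k + l. t ^ i * (real ((k + l) choose i) * ((v \<bullet> b) ^ (k + l - i) * (v \<bullet> e) ^ i)))" for t
    proof -
      have "power_form (k + l) (\<lambda>v. (v \<bullet> (t *\<^sub>R e + b)) ^ (k + l))"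
        by (rule power_form_inner)
      also have "(\<lambda>v. (v \<bullet> (t *\<^sub>R e + b)) ^ (k + l)) =
          (\<lambda>v. \<Sum>i\<le>k + l. t ^ i * (real ((k + l) choose i) * ((v \<bullet> b) ^ (k + l - i) * (v \<bullet> e) ^ i)))"
        by (simp add: inner_add_right binomial_ring power_mult_distrib mult_ac)
      finally show ?thesis .
    qed
    then have "power_form (k + l) (\<lambda>v. real ((k + l) choose l) * ((v \<bullet> b) ^ (k + l - l) * (v \<bullet> e) ^ l))"
      by (rule power_form_coefficient[where D = "k + l" and i = l]) simp
    from power_form_scale[OF this, of "1 / real ((k + l) choose l)"] show ?thesis by simp
  qed
  obtain S w where S: "finite S" "\<And>v. f v = (\<Sum>b\<in>S. w b * (v \<bullet> b) ^ k)"
    using assms unfolding power_form_def by blast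
  have "power_form (k + l) (\<lambda>v. \<Sum>b\<in>S. w b * ((v \<bullet> b) ^ k * (v \<bullet> e) ^ l))"
    by (intro power_form_sum power_form_scale *)
  then show ?thesis by (simp add: S(2) sum_distrib_right mult.assoc)
qed

text \<open>The binomial theorem splits off one square, and \<open>power_form_mult\<close> absorbs
  its powers. The exponent is generalized because the expansion involves all smaller
  exponents.\<close>

lemma power_form_sum_squares:
  "finite B \<Longrightarrow> power_form (2 * k) (\<lambda>v. (\<Sum>e\<in>B. (v \<bullet> e)\<^sup>2) ^ k)"
proof (induction B arbitrary: k rule: finite_induct)
  case empty
  show ?case
  proof (cases k)
    case 0
    then show ?thesis using power_form_inner[of 0 undefined] by simp
  qed (simp add: power_form_0)
next
  case (insert e B)
  have "power_form (2 * k) (\<lambda>v. \<Sum>i\<le>k. real (k choose i) * ((\<Sum>e\<in>B. (v \<bullet> e)\<^sup>2) ^ (k - i) * (v \<bullet> e) ^ (2 * i)))"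
  proof (intro power_form_sum power_form_scale)
    fix i assume "i \<in> {..k}"
    then show "power_form (2 * k) (\<lambda>v. (\<Sum>e\<in>B. (v \<bullet> e)\<^sup>2) ^ (k - i) * (v \<bullet> e) ^ (2 * i))"
      using power_form_mult[OF insert.IH[of "k - i"], of "2 * i" e] by (simp flip: add_mult_distrib2)
  qed
  moreover have "(\<Sum>e\<in>insert e B. (v \<bullet> e)\<^sup>2) ^ k =
      (\<Sum>i\<le>k. real (k choose i) * ((\<Sum>e\<in>B. (v \<bullet> e)\<^sup>2) ^ (k - i) * (v \<bullet> e) ^ (2 * i)))" for v
    using insert.hyps
    by (simp add: binomial_ring power_mult power2_eq_square power_mult_distrib mult_ac)
  ultimately show ?case by simp
qed

lemma Hilbert_identity:
  "\<exists>S w. finite S \<and> (\<forall>v :: 'e :: euclidean_space. (\<Sum>b\<in>S. w b * (v \<bullet> b) ^ (2 * k)) = (v \<bullet> v) ^ k)"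
proof -
  have "power_form (2 * k) (\<lambda>v :: 'e. (\<Sum>e\<in>Basis. (v \<bullet> e)\<^sup>2) ^ k)"
    by (rule power_form_sum_squares) simp
  moreover have "(\<Sum>e\<in>Basis. (v \<bullet> e)\<^sup>2) = v \<bullet> v" for v :: 'e
    by (simp add: euclidean_inner[of v v] power2_eq_square)
  ultimately show ?thesis unfolding power_form_def by metis
qed

lemma pderiv_sum: "pderiv (sum f S) = (\<Sum>i\<in>S. pderiv (f i))"
  by (induction S rule: infinite_finite_induct) (auto simp: pderiv_add)

lemma second_pderiv_power_at_0:
  "poly (pderiv (pderiv (p ^ Suc (Suc n)))) (0::real) =
     real (Suc (Suc n)) * (real (Suc n) * poly p 0 ^ n * (poly (pderiv p) 0)\<^sup>2 + poly p 0 ^ Suc n * poly (pderiv (pderiv p)) 0)"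
  by (simp add: pderiv_power_Suc pderiv_smult pderiv_mult power2_eq_square algebra_simps
      del: power_Suc of_nat_Suc)

text \<open>One application of the Laplacian, computed as the sum of the second directional derivatives.\<close>

lemma quadrature_lower_step:
  fixes S :: "'e :: euclidean_space set"
  assumes "finite S" and quad: "\<And>v. (\<Sum>b\<in>S. w b * (v \<bullet> b) ^ (2 * Suc l)) = G * (v \<bullet> v) ^ Suc l"
  shows "(\<Sum>b\<in>S. w b * (b \<bullet> b) * (v \<bullet> b) ^ (2 * l)) = G * (real (2 * l + DIM('e)) / real (2 * l + 1)) * (v \<bullet> v) ^ l"
proof -
  have dir: "(\<Sum>b\<in>S. w b * (real (2 * l + 2) * real (2 * l + 1) * (v \<bullet> b) ^ (2 * l) * (e \<bullet> b)\<^sup>2)) =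
      G * (real (l + 1) * (real l * (v \<bullet> v) ^ (l - 1) * (2 * (v \<bullet> e))\<^sup>2 + (v \<bullet> v) ^ l * (2 * (e \<bullet> e))))" for e
  proof -
    \<comment> \<open>Restriction of the identity to the line v + s e. Both sides are polynomials in
      s, so their second derivatives at 0 can be compared formally.\<close>
    have "(\<Sum>b\<in>S. smult (w b) ([:v \<bullet> b, e \<bullet> b:] ^ (2 * Suc l))) = smult G ([:v \<bullet> v, 2 * (v \<bullet> e), e \<bullet> e:] ^ Suc l)"
      (is "?L = ?R")
    proof (rule iffD1[OF poly_eq_poly_eq_iff], rule ext)
      fix s
      have "poly ?L s = (\<Sum>b\<in>S. w b * ((v + s *\<^sub>R e) \<bullet> b) ^ (2 * Suc l))"
        by (simp add: poly_sum inner_add_left del: power_Suc mult_Suc_right)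
      also have "\<dots> = poly ?R s"
        unfolding quad by (simp add: inner_add_left inner_add_right inner_commute algebra_simps del: power_Suc)
      finally show "poly ?L s = poly ?R s" .
    qed
    then have "poly (pderiv (pderiv ?L)) 0 = poly (pderiv (pderiv ?R)) 0" by simp
    moreover have "poly (pderiv (pderiv ?L)) 0 =
        (\<Sum>b\<in>S. w b * (real (2 * l + 2) * real (2 * l + 1) * (v \<bullet> b) ^ (2 * l) * (e \<bullet> b)\<^sup>2))"
    proof -
      have "2 * Suc l = Suc (Suc (2 * l))" by simp
      then show ?thesis
        by (simp only: pderiv_sum pderiv_smult poly_sum poly_smult second_pderiv_power_at_0)
          (simp add: pderiv_pCons algebra_simps)
    qed
    moreover have "poly (pderiv (pderiv ?R)) 0 =
       G * (real (l + 1) * (real l * (v \<bullet> v) ^ (l - 1) * (2 * (v \<bullet> e))\<^sup>2 + (v \<bullet> v) ^ l * (2 * (e \<bullet> e))))"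
    proof (cases l)
      case 0
      then show ?thesis by (simp add: pderiv_smult pderiv_pCons)
    next
      case (Suc m)
      then show ?thesis
        by (simp only: pderiv_smult poly_smult second_pderiv_power_at_0) (simp add: pderiv_pCons)
    qed
    ultimately show ?thesis by simp
  qed
  have sq: "(\<Sum>e\<in>Basis. (e \<bullet> b)\<^sup>2) = b \<bullet> b" for b :: 'e
    by (simp add: euclidean_inner[of b b] power2_eq_square inner_commute)
  \<comment> \<open>For l = 0 the exponent l - 1 truncates to 0, and the factor
    \<open>real l\<close> makes both sides vanish.\<close>
  have vl: "real l * (v \<bullet> v) ^ (l - 1) * (v \<bullet> v) = real l * (v \<bullet> v) ^ l"
    by (cases l) auto
  have "(\<Sum>e\<in>Basis. \<Sum>b\<in>S. w b * (real (2 * l + 2) * real (2 * l + 1) * (v \<bullet> b) ^ (2 * l) * (e \<bullet> b)\<^sup>2)) =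
      (\<Sum>b\<in>S. \<Sum>e\<in>Basis. (real (2 * l + 2) * real (2 * l + 1)) * (w b * (v \<bullet> b) ^ (2 * l)) * (e \<bullet> b)\<^sup>2)"
    by (subst sum.swap) (simp add: mult_ac)
  also have "\<dots> = (real (2 * l + 2) * real (2 * l + 1)) * (\<Sum>b\<in>S. w b * (b \<bullet> b) * (v \<bullet> b) ^ (2 * l))"
    by (simp only: sum_distrib_left[symmetric] sq) (simp only: sum_distrib_left mult_ac)
  finally have "(real (2 * l + 2) * real (2 * l + 1)) * (\<Sum>b\<in>S. w b * (b \<bullet> b) * (v \<bullet> b) ^ (2 * l)) =
      (\<Sum>e\<in>Basis. G * (real (l + 1) * (real l * (v \<bullet> v) ^ (l - 1) * (2 * (v \<bullet> e))\<^sup>2 + (v \<bullet> v) ^ l * (2 * (e \<bullet> e)))))"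
    by (simp only: dir)
  also have "\<dots> = (\<Sum>e\<in>Basis. G * real (l + 1) * (real l * (v \<bullet> v) ^ (l - 1)) * 4 * (e \<bullet> v)\<^sup>2 + G * real (l + 1) * (v \<bullet> v) ^ l * 2)"
    by (rule sum.cong) (auto simp: inner_Basis inner_commute power_mult_distrib algebra_simps)
  also have "\<dots> = G * real (l + 1) * (real l * (v \<bullet> v) ^ (l - 1)) * 4 * (v \<bullet> v) + G * real (l + 1) * (v \<bullet> v) ^ l * 2 * real DIM('e)"
    by (simp only: sum.distrib sum_distrib_left[symmetric] sq sum_constant)
  also have "\<dots> = G * real (l + 1) * 4 * (real l * (v \<bullet> v) ^ (l - 1) * (v \<bullet> v)) + G * real (l + 1) * (v \<bullet> v) ^ l * 2 * real DIM('e)"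
    by simp
  also have "\<dots> = real (2 * l + 2) * (G * real (2 * l + DIM('e)) * (v \<bullet> v) ^ l)"
    unfolding vl by (simp add: algebra_simps)
  finally have "real (2 * l + 1) * (\<Sum>b\<in>S. w b * (b \<bullet> b) * (v \<bullet> b) ^ (2 * l)) = G * real (2 * l + DIM('e)) * (v \<bullet> v) ^ l"
    by simp
  then show ?thesis by (simp add: field_simps)
qed

text \<open>The factor collected while the Laplacian lowers a quadrature formula of degree 2k to
  degree 2l. For l = 0 it is the total mass, the reciprocal of the mean of x_1^(2k) over the unit
  sphere in dimension d.\<close>

definition lowering_const :: "nat \<Rightarrow> nat \<Rightarrow> nat \<Rightarrow> real" where
  "lowering_const d k l = (\<Prod>i\<in>{l..<k}. real (2 * i + d) / real (2 * i + 1))"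

lemma lowering_const_pos: "d > 0 \<Longrightarrow> lowering_const d k l > 0"
  unfolding lowering_const_def by (intro prod_pos) auto

lemma lowering_const_0: "lowering_const d k 0 = pochhammer (real d / 2) k / pochhammer (1/2) k"
proof -
  have "real (2 * i + d) / real (2 * i + 1) = (real d / 2 + real i) / (1/2 + real i)" for i
    by (simp add: field_simps)
  then show ?thesis
    unfolding lowering_const_def pochhammer_prod by (simp add: prod_dividef del: of_nat_add of_nat_mult)
qed

lemma quadrature_lower:
  fixes S :: "'e :: euclidean_space set"
  assumes "finite S" and quad: "\<And>v. (\<Sum>b\<in>S. w b * (v \<bullet> b) ^ (2 * k)) = (v \<bullet> v) ^ k" and "l \<le> k"
  shows "(\<Sum>b\<in>S. w b * (b \<bullet> b) ^ (k - l) * (v \<bullet> b) ^ (2 * l)) = lowering_const DIM('e) k l * (v \<bullet> v) ^ l"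
  using \<open>l \<le> k\<close>
proof (induction arbitrary: v rule: inc_induct)
  case base
  then show ?case by (simp add: quad lowering_const_def)
next
  case (step l)
  have "(\<Sum>b\<in>S. w b * (b \<bullet> b) ^ (k - Suc l) * (b \<bullet> b) * (v \<bullet> b) ^ (2 * l)) =
      lowering_const DIM('e) k (Suc l) * (real (2 * l + DIM('e)) / real (2 * l + 1)) * (v \<bullet> v) ^ l"
    using assms(1) step.IH by (rule quadrature_lower_step)
  moreover have "(b \<bullet> b) ^ (k - l) = (b \<bullet> b) ^ (k - Suc l) * (b \<bullet> b)" for b :: 'e
    using step.hyps by (simp add: Suc_diff_Suc flip: power_Suc2)
  moreover have "lowering_const DIM('e) k l = lowering_const DIM('e) k (Suc l) * (real (2 * l + DIM('e)) / real (2 * l + 1))"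
    using step.hyps unfolding lowering_const_def by (subst prod.atLeast_Suc_lessThan) (auto simp: mult.commute)
  ultimately show ?case by (simp add: mult.assoc)
qed

section \<open>Scalars, Hermitian forms and the Welch equality\<close>

lemma inner_mult_left_same:
  fixes a x y :: "'a :: conj_div_algebra"
  shows "inner (a * x) (a * y) = (norm a)\<^sup>2 * inner x y"
proof -
  have "norm (a * x + a * y) = norm a * norm (x + y)"
    by (simp add: norm_mult flip: distrib_left)
  then show ?thesis
    unfolding dot_norm by (simp add: norm_mult power_mult_distrib) (simp add: algebra_simps)
qed

lemma inner_mult_right_same:
  fixes a x y :: "'a :: conj_div_algebra"
  shows "inner (x * a) (y * a) = (norm a)\<^sup>2 * inner x y"
proof -
  have "norm (x * a + y * a) = norm (x + y) * norm a"
    by (simp add: norm_mult flip: distrib_right)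
  then show ?thesis
    unfolding dot_norm by (simp add: norm_mult power_mult_distrib) (simp add: algebra_simps)
qed

lemma conj_eq_inverse: "conj x = (norm x)\<^sup>2 *\<^sub>R inverse x" for x :: "'a :: conj_div_algebra"
proof (cases "x = 0")
  case False
  have "conj x = conj x * x * inverse x"
    using False by (simp add: mult.assoc)
  then show ?thesis by (simp add: conj_mult_self)
qed simp

lemma mult_conj_self: "x * conj x = (norm x)\<^sup>2 *\<^sub>R 1" for x :: "'a :: conj_div_algebra"
  by (cases "x = 0") (simp_all add: conj_eq_inverse)

lemma conj_conj [simp]: "conj (conj x) = x" for x :: "'a :: conj_div_algebra"
proof (cases "x = 0")
  case False
  have "conj (conj x) = (norm x)\<^sup>2 *\<^sub>R inverse (conj x)"
    by (simp add: conj_eq_inverse[of "conj x"])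
  also have "inverse (conj x) = inverse ((norm x)\<^sup>2) *\<^sub>R x"
    using False by (intro inverse_unique) (simp add: conj_eq_inverse[of x])
  finally show ?thesis using False by simp
qed simp

text \<open>The class ties \<open>conj\<close> to the norm, not to the inner product. Left
  multiplication of both arguments by \<open>conj a\<close> scales the inner product by the squared
  norm of a, and this exhibits the adjoint.\<close>

lemma inner_mult_conj_left: "inner (a * b) c = inner b (conj a * c)" for a b c :: "'a :: conj_div_algebra"
proof (cases "a = 0")
  case False
  have "(norm a)\<^sup>2 * inner (a * b) c = inner (conj a * (a * b)) (conj a * c)"
    by (simp add: inner_mult_left_same)
  also have "conj a * (a * b) = (norm a)\<^sup>2 *\<^sub>R b"
    by (simp add: conj_mult_self flip: mult.assoc)
  finally show ?thesis using False by simp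
qed simp

lemma inner_mult_conj_right: "inner (a * b) c = inner a (c * conj b)" for a b c :: "'a :: conj_div_algebra"
proof (cases "b = 0")
  case False
  have "(norm b)\<^sup>2 * inner (a * b) c = inner (a * b * conj b) (c * conj b)"
    by (simp add: inner_mult_right_same)
  also have "a * b * conj b = (norm b)\<^sup>2 *\<^sub>R a"
    by (simp add: mult_conj_self mult.assoc)
  finally show ?thesis using False by simp
qed simp

lemma herm_conj: "conj (herm a b) = herm b a"
  by (simp add: herm_def conj_sum conj_mult)

lemma norm_herm_commute: "norm (herm a b) = norm (herm b a)"
  by (metis herm_conj norm_conj)

lemma herm_self: "herm a a = (a \<bullet> a) *\<^sub>R 1"
  by (simp add: herm_def conj_mult_self inner_vec_def power2_norm_eq_inner scaleR_left.sum)

lemma unit_vec_iff: "unit_vec a \<longleftrightarrow> a \<bullet> a = 1"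
  by (metis herm_self scaleR_cancel_right scaleR_one unit_vec_def zero_neq_one)

lemma herm_add_right: "herm a (b + c) = herm a b + herm a c"
  by (simp add: herm_def distrib_left sum.distrib)

lemma herm_rscale_right: "herm a (rscale b c) = herm a b * c"
  by (simp add: herm_def rscale_def sum_distrib_right mult.assoc)

lemma herm_scaleR_right: "herm a (r *\<^sub>R b) = r *\<^sub>R herm a b"
  by (simp add: herm_def scaleR_right.sum)

lemma inner_rscale: "rscale x c \<bullet> w = c \<bullet> herm x w"
  by (simp add: inner_vec_def rscale_def herm_def inner_sum_right inner_mult_conj_left)

lemma inner_rscale_self: "rscale x c \<bullet> rscale x c = (c \<bullet> c) * (x \<bullet> x)"
  by (simp add: inner_vec_def rscale_def inner_mult_right_same sum_distrib_left power2_norm_eq_inner mult.commute)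

text \<open>The matrix x x^*, an embedding that turns |x^* y|^2 into a Euclidean inner product.
  Hence this kernel and its powers are positive semidefinite.\<close>

definition outer :: "'a :: conj_div_algebra ^ 'n \<Rightarrow> 'a ^ 'n ^ 'n" where
  "outer x = (\<chi> p q. x $ p * conj (x $ q))"

lemma inner_outer: "outer x \<bullet> outer y = (norm (herm x y))\<^sup>2"
proof -
  have "inner (x $ p * conj (x $ q)) (y $ p * conj (y $ q)) = inner (conj (x $ q) * y $ q) (conj (x $ p) * y $ p)" for p q
    by (simp add: inner_mult_conj_left[of "x $ p"] inner_mult_conj_right[of "conj (x $ q)"] mult.assoc)
  then show ?thesis
    unfolding power2_norm_eq_inner
    by (simp add: outer_def inner_vec_def herm_def inner_sum_left inner_sum_right)
qed

text \<open>These are coordinates in the k-th tensor power: a list of k basis vectors names an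
  element of the tensor basis.\<close>

lemma inner_power_feature_map:
  "\<exists>(J :: 'e :: euclidean_space list set) f. finite J \<and> (\<forall>a b :: 'e. (a \<bullet> b) ^ k = (\<Sum>j\<in>J. f j a * f j b))"
proof (induction k)
  case 0
  show ?case by (intro exI[of _ "{[]}"] exI[of _ "\<lambda>_ _. 1"]) simp
next
  case (Suc k)
  then obtain J :: "'e list set" and f where
    J: "finite J" "\<And>a b :: 'e. (a \<bullet> b) ^ k = (\<Sum>j\<in>J. f j a * f j b)"
    by blast
  let ?g = "\<lambda>j a. (a \<bullet> hd j) * f (tl j) a"
  have inj: "inj_on (\<lambda>(e, j). e # j) (Basis \<times> J)" by (auto simp: inj_on_def)
  have "(a \<bullet> b) ^ Suc k = (\<Sum>j\<in>(\<lambda>(e, j). e # j) ` (Basis \<times> J). ?g j a * ?g j b)" for a b :: 'e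
  proof -
    have "(a \<bullet> b) ^ Suc k = (\<Sum>e\<in>Basis. (a \<bullet> e) * (b \<bullet> e)) * (\<Sum>j\<in>J. f j a * f j b)"
      by (simp only: power_Suc J(2) euclidean_inner[of a b, symmetric])
    also have "\<dots> = (\<Sum>e\<in>Basis. \<Sum>j\<in>J. (a \<bullet> e) * (b \<bullet> e) * (f j a * f j b))"
      by (rule sum_product)
    also have "\<dots> = (\<Sum>(e, j)\<in>Basis \<times> J. (a \<bullet> e) * (b \<bullet> e) * (f j a * f j b))"
      by (rule sum.cartesian_product)
    also have "\<dots> = (\<Sum>j\<in>(\<lambda>(e, j). e # j) ` (Basis \<times> J). ?g j a * ?g j b)"
      unfolding sum.reindex[OF inj] by (rule sum.cong) (auto simp: mult_ac)
    finally show ?thesis .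
  qed
  with J(1) show ?case
    by (intro exI[of _ "(\<lambda>(e, j). e # j) ` (Basis \<times> J)"] exI[of _ ?g]) simp
qed

text \<open>Two Hilbert identities are combined. The one on the scalars writes |c|^(2k) as a sum of
  (c . b)^(2k), which turns |x^* z| into real inner products of the columns x b with z; the one on
  the columns then sums over z. After division by \<open>C\<close> the signed measure has total mass
  1 and the k-th moment (m)_k / (N)_k of the invariant probability measure.\<close>

lemma projective_quadrature:
  "\<exists>(S :: ('a :: conj_div_algebra ^ 'n) set) w. finite S \<and>
    (\<forall>x. (\<Sum>z\<in>S. w z * (norm (herm x z)) ^ (2 * k)) =
      pochhammer (real DIM('a) / 2) k / pochhammer (real DIM('a ^ 'n) / 2) k * (x \<bullet> x) ^ k) \<and>
    (\<Sum>z\<in>S. w z * (z \<bullet> z) ^ k) = 1"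
proof -
  obtain T u where T: "finite T" "\<And>v :: 'a. (\<Sum>b\<in>T. u b * (v \<bullet> b) ^ (2 * k)) = (v \<bullet> v) ^ k"
    using Hilbert_identity by blast
  obtain S w where S: "finite S" "\<And>v :: 'a ^ 'n. (\<Sum>z\<in>S. w z * (v \<bullet> z) ^ (2 * k)) = (v \<bullet> v) ^ k"
    using Hilbert_identity by blast
  have Tk: "(\<Sum>b\<in>T. u b * (b \<bullet> b) ^ k) = lowering_const DIM('a) k 0"
    using quadrature_lower[OF T, of 0] by simp
  define C where "C = lowering_const DIM('a ^ 'n) k 0"
  have C: "C > 0" unfolding C_def by (intro lowering_const_pos) simp
  have Sk: "(\<Sum>z\<in>S. w z * (z \<bullet> z) ^ k) = C"
    using quadrature_lower[OF S, of 0] by (simp add: C_def)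
  have "(\<Sum>z\<in>S. w z * (norm (herm x z)) ^ (2 * k)) = lowering_const DIM('a) k 0 * (x \<bullet> x) ^ k" for x
  proof -
    have "(\<Sum>z\<in>S. w z * (norm (herm x z)) ^ (2 * k)) = (\<Sum>z\<in>S. w z * (\<Sum>b\<in>T. u b * (rscale x b \<bullet> z) ^ (2 * k)))"
    proof (rule sum.cong[OF refl])
      fix z
      have "rscale x b \<bullet> z = herm x z \<bullet> b" for b
        unfolding inner_rscale by (rule inner_commute)
      then show "w z * (norm (herm x z)) ^ (2 * k) = w z * (\<Sum>b\<in>T. u b * (rscale x b \<bullet> z) ^ (2 * k))"
        by (simp only: T(2)) (simp only: power_mult power2_norm_eq_inner)
    qed
    also have "\<dots> = (\<Sum>b\<in>T. u b * (\<Sum>z\<in>S. w z * (rscale x b \<bullet> z) ^ (2 * k)))"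
      unfolding sum_distrib_left by (subst sum.swap) (simp add: mult_ac)
    also have "\<dots> = (\<Sum>b\<in>T. u b * (b \<bullet> b) ^ k) * (x \<bullet> x) ^ k"
      by (simp only: S(2) inner_rscale_self power_mult_distrib sum_distrib_right mult.assoc)
    finally show ?thesis by (simp add: Tk)
  qed
  moreover have "lowering_const DIM('a) k 0 / C = pochhammer (real DIM('a) / 2) k / pochhammer (real DIM('a ^ 'n) / 2) k"
    using pochhammer_pos[of "1/2::real" k] by (simp only: C_def lowering_const_0) simp
  moreover have "(\<Sum>z\<in>S. w z / C * f z) = (\<Sum>z\<in>S. w z * f z) / C" for f
    by (simp add: sum_divide_distrib)
  ultimately have "(\<Sum>z\<in>S. w z / C * (norm (herm x z)) ^ (2 * k)) =
      pochhammer (real DIM('a) / 2) k / pochhammer (real DIM('a ^ 'n) / 2) k * (x \<bullet> x) ^ k" for x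
    by (metis times_divide_eq_left)
  moreover have "(\<Sum>z\<in>S. w z / C * (z \<bullet> z) ^ k) = 1"
    using C Sk by (simp flip: sum_divide_distrib)
  ultimately show ?thesis
    using S(1) by (intro exI[of _ S] exI[of _ "\<lambda>z. w z / C"] conjI allI)
qed

text \<open>The equality case of the Welch (Sidelnikov) inequality: the kernel \<open>(norm (herm x y)) ^ (2 * k)\<close> is
  positive semidefinite, so a signed measure with vanishing energy has vanishing potential.\<close>

lemma welch_equality:
  fixes r :: "'p \<Rightarrow> 'a :: conj_div_algebra ^ 'n" and k :: nat
  defines "c \<equiv> pochhammer (real DIM('a) / 2) k / pochhammer (real DIM('a ^ 'n) / 2) k"
  assumes X: "finite X" and unit: "\<And>x. x \<in> X \<Longrightarrow> r x \<bullet> r x = 1"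
    and eq: "\<And>y. y \<in> X \<Longrightarrow> (\<Sum>x\<in>X. (norm (herm (r x) (r y))) ^ (2 * k)) = real (card X) * c"
  shows "(\<Sum>x\<in>X. (norm (herm (r x) v)) ^ (2 * k)) = real (card X) * c * (v \<bullet> v) ^ k"
proof -
  let ?K = "\<lambda>x y :: 'a ^ 'n. (norm (herm x y)) ^ (2 * k)"
  obtain S w where S: "finite S" "\<And>x :: 'a ^ 'n. (\<Sum>z\<in>S. w z * ?K x z) = c * (x \<bullet> x) ^ k"
    "(\<Sum>z\<in>S. w z * (z \<bullet> z) ^ k) = 1"
    using projective_quadrature[where 'a = 'a and 'n = 'n, of k] unfolding c_def[symmetric]
    by (elim exE conjE) (rule that, assumption, erule spec)
  obtain J :: "('a ^ 'n ^ 'n) list set" and f where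
    J: "finite J" "\<And>a b :: 'a ^ 'n ^ 'n. (a \<bullet> b) ^ k = (\<Sum>j\<in>J. f j a * f j b)"
    using inner_power_feature_map by blast
  have K: "?K x y = (\<Sum>j\<in>J. f j (outer x) * f j (outer y))" for x y
    by (simp add: power_mult J(2) flip: inner_outer)
  define n where "n = real (card X)"
  \<comment> \<open>\<open>P\<close> is the feature vector summed over the design, \<open>M\<close>
    that of the signed measure. Since <P,P> = n^2 c, <P,M> = n c and <M,M> = c, the vector P - n M
    has length 0.\<close>
  define P where "P j = (\<Sum>x\<in>X. f j (outer (r x)))" for j
  define M where "M j = (\<Sum>z\<in>S. w z * f j (outer z))" for j
  have PP': "(\<Sum>j\<in>J. P j * f j (outer v)) = (\<Sum>x\<in>X. ?K (r x) v)" for v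
    unfolding K P_def sum_distrib_right by (rule sum.swap)
  have "(\<Sum>j\<in>J. P j * P j) = (\<Sum>j\<in>J. \<Sum>y\<in>X. P j * f j (outer (r y)))"
    by (subst (2) P_def) (simp add: sum_distrib_left)
  also have "\<dots> = (\<Sum>y\<in>X. \<Sum>j\<in>J. P j * f j (outer (r y)))"
    by (rule sum.swap)
  also have "\<dots> = n * n * c" using eq by (simp add: PP' n_def)
  finally have PP: "(\<Sum>j\<in>J. P j * P j) = n * n * c" .
  have PM: "(\<Sum>j\<in>J. f j (outer x) * M j) = c * (x \<bullet> x) ^ k" for x
  proof -
    have "(\<Sum>j\<in>J. f j (outer x) * M j) = (\<Sum>z\<in>S. w z * ?K x z)"
      unfolding K M_def sum_distrib_left by (subst sum.swap) (simp add: mult_ac)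
    then show ?thesis by (simp add: S(2))
  qed
  have "(\<Sum>j\<in>J. P j * M j) = (\<Sum>x\<in>X. \<Sum>j\<in>J. f j (outer (r x)) * M j)"
    unfolding P_def sum_distrib_right by (rule sum.swap)
  also have "\<dots> = n * c" by (simp add: PM unit n_def)
  finally have PM': "(\<Sum>j\<in>J. P j * M j) = n * c" .
  have "(\<Sum>j\<in>J. M j * M j) = (\<Sum>j\<in>J. \<Sum>z\<in>S. w z * f j (outer z) * M j)"
    by (subst (1) M_def) (simp only: sum_distrib_right)
  also have "\<dots> = (\<Sum>z\<in>S. \<Sum>j\<in>J. w z * f j (outer z) * M j)"
    by (rule sum.swap)
  also have "\<dots> = (\<Sum>z\<in>S. w z * (\<Sum>j\<in>J. f j (outer z) * M j))"
    by (simp add: sum_distrib_left mult.assoc)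
  also have "\<dots> = c * (\<Sum>z\<in>S. w z * (z \<bullet> z) ^ k)"
    by (simp only: PM) (simp add: sum_distrib_left mult_ac)
  finally have MM: "(\<Sum>j\<in>J. M j * M j) = c" by (simp add: S(3))
  have "(\<Sum>j\<in>J. (P j - n * M j)\<^sup>2) =
      (\<Sum>j\<in>J. P j * P j) - 2 * n * (\<Sum>j\<in>J. P j * M j) + n * n * (\<Sum>j\<in>J. M j * M j)"
    by (simp add: power2_eq_square algebra_simps sum.distrib sum_subtractf sum_distrib_left)
  also have "\<dots> = 0" by (simp add: PP PM' MM)
  finally have "P j = n * M j" if "j \<in> J" for j
    using that J(1) by (subst (asm) sum_nonneg_eq_0_iff) auto
  then have "(\<Sum>j\<in>J. P j * f j (outer v)) = n * (\<Sum>j\<in>J. f j (outer v) * M j)"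
    by (simp add: sum_distrib_left mult_ac)
  then show ?thesis by (simp add: PP' PM n_def)
qed

section \<open>Convolution of zonal functions\<close>

lemma coeff_trinomial_power:
  fixes A B h :: real
  shows "coeff ([:B, h, A:] ^ k) n = (\<Sum>s\<le>k. \<Sum>p\<le>k - s. if 2 * p + s = n
    then real (k choose s) * real ((k - s) choose p) * h ^ s * A ^ p * B ^ (k - s - p) else 0)"
proof -
  have "[:B, h, A:] = monom h 1 + (monom A 2 + monom B 0)"
    by (simp add: monom_altdef power2_eq_square)
  then have "[:B, h, A:] ^ k = (\<Sum>s\<le>k. \<Sum>p\<le>k - s.
      monom (real (k choose s) * real ((k - s) choose p) * h ^ s * A ^ p * B ^ (k - s - p)) (2 * p + s))"
    by (simp only: binomial_ring sum_distrib_left monom_power of_nat_monom mult_monom)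
      (simp add: mult_ac add_ac)
  then show ?thesis by (simp only: coeff_sum coeff_monom)
qed

text \<open>The weight of the exponents s of the middle term and p of the r^2 term in the
  coefficient of r^(2i) of (u r^2 + 2 (\<eta> . b) r + v |b|^2)^(i + j), after summing b against a
  Hilbert formula of degree 2j. The condition makes s even, so \<open>s div 2\<close> is
  exact.\<close>

definition conv_coeff :: "nat \<Rightarrow> nat \<Rightarrow> nat \<Rightarrow> nat \<Rightarrow> nat \<Rightarrow> real" where
  "conv_coeff d i j s p = (if 2 * p + s = 2 * i then real ((i + j) choose s) * real ((i + j - s) choose p) *
     2 ^ s * lowering_const d j (s div 2) else 0)"

definition conv_poly :: "nat \<Rightarrow> nat \<Rightarrow> nat \<Rightarrow> real poly" where
  "conv_poly d i j = smult (1 / (\<Sum>s\<le>i + j. \<Sum>p\<le>i + j - s. conv_coeff d i j s p))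
     (\<Sum>s\<le>i + j. \<Sum>p\<le>i + j - s. monom (conv_coeff d i j s p) (s div 2))"

lemma conv_coeff_sum_pos:
  assumes "d > 0"
  shows "(\<Sum>s\<le>i + j. \<Sum>p\<le>i + j - s. conv_coeff d i j s p) > 0"
proof -
  have nn: "conv_coeff d i j s p \<ge> 0" for s p
    using lowering_const_pos[OF assms, of j "s div 2"] by (simp add: conv_coeff_def less_imp_le)
  have "0 < conv_coeff d i j 0 i"
    using lowering_const_pos[OF assms] by (simp add: conv_coeff_def)
  also have "\<dots> \<le> (\<Sum>p\<le>i + j - 0. conv_coeff d i j 0 p)"
    by (rule member_le_sum) (auto simp: nn)
  also have "\<dots> \<le> (\<Sum>s\<le>i + j. \<Sum>p\<le>i + j - s. conv_coeff d i j s p)"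
    by (rule member_le_sum[of 0 "{..i + j}" "\<lambda>s. \<Sum>p\<le>i + j - s. conv_coeff d i j s p"]) (auto simp: nn intro: sum_nonneg)
  finally show ?thesis .
qed

text \<open>With s = 2l the condition reads p = i - l, so l <= i; and s + p <= i + j then gives l <=
  j.\<close>

lemma degree_conv_poly: "degree (conv_poly d i j) \<le> min i j"
  unfolding conv_poly_def
proof (intro order_trans[OF degree_smult_le] degree_sum_le finite_atMost)
  fix s p assume "s \<in> {..i + j}" "p \<in> {..i + j - s}"
  then show "degree (monom (conv_coeff d i j s p) (s div 2)) \<le> min i j"
    by (cases "2 * p + s = 2 * i") (auto simp: conv_coeff_def intro!: order_trans[OF degree_monom_le])
qed

lemma quadrature_trinomial:
  fixes \<eta> :: "'f :: euclidean_space"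
  assumes "finite T" and quad: "\<And>v :: 'f. (\<Sum>b\<in>T. w b * (v \<bullet> b) ^ (2 * j)) = (v \<bullet> v) ^ j"
  shows "(\<Sum>b\<in>T. w b * coeff ([:v * (b \<bullet> b), 2 * (\<eta> \<bullet> b), u:] ^ (i + j)) (2 * i)) =
    (\<Sum>s\<le>i + j. \<Sum>p\<le>i + j - s. conv_coeff DIM('f) i j s p * (u ^ p * v ^ (i + j - s - p) * (\<eta> \<bullet> \<eta>) ^ (s div 2)))"
proof -
  have *: "(\<Sum>b\<in>T. w b * (if 2 * p + s = 2 * i then real ((i + j) choose s) * real ((i + j - s) choose p) *
        (2 * (\<eta> \<bullet> b)) ^ s * u ^ p * (v * (b \<bullet> b)) ^ (i + j - s - p) else 0)) =
      conv_coeff DIM('f) i j s p * (u ^ p * v ^ (i + j - s - p) * (\<eta> \<bullet> \<eta>) ^ (s div 2))"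
    if sp: "s \<le> i + j" "p \<le> i + j - s" for s p
  proof (cases "2 * p + s = 2 * i")
    case True
    define l where "l = s div 2"
    have s: "s = 2 * l" using True unfolding l_def by presburger
    have l: "l \<le> j" "i + j - s - p = j - l" using True sp unfolding s by auto
    define C where "C = real ((i + j) choose s) * real ((i + j - s) choose p) * 2 ^ s * (u ^ p * v ^ (j - l))"
    have "(\<Sum>b\<in>T. w b * (if 2 * p + s = 2 * i then real ((i + j) choose s) * real ((i + j - s) choose p) *
        (2 * (\<eta> \<bullet> b)) ^ s * u ^ p * (v * (b \<bullet> b)) ^ (i + j - s - p) else 0)) =
        C * (\<Sum>b\<in>T. w b * (b \<bullet> b) ^ (j - l) * (\<eta> \<bullet> b) ^ (2 * l))"
      unfolding l(2) sum_distrib_left using True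
      by (intro sum.cong) (simp_all add: C_def power_mult_distrib s mult_ac)
    also have "\<dots> = C * (lowering_const DIM('f) j l * (\<eta> \<bullet> \<eta>) ^ l)"
      using quadrature_lower[OF assms l(1)] by simp
    finally show ?thesis using True by (simp add: conv_coeff_def C_def l(2)[simplified] flip: l_def)
  qed (simp add: conv_coeff_def)
  have "(\<Sum>b\<in>T. w b * coeff ([:v * (b \<bullet> b), 2 * (\<eta> \<bullet> b), u:] ^ (i + j)) (2 * i)) =
    (\<Sum>s\<le>i + j. \<Sum>p\<le>i + j - s. \<Sum>b\<in>T. w b * (if 2 * p + s = 2 * i then real ((i + j) choose s) * real ((i + j - s) choose p) *
        (2 * (\<eta> \<bullet> b)) ^ s * u ^ p * (v * (b \<bullet> b)) ^ (i + j - s - p) else 0))"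
    unfolding coeff_trinomial_power sum_distrib_left
    by (subst sum.swap, rule sum.cong[OF refl], rule sum.swap)
  then show ?thesis using * by simp
qed

text \<open>The hypothesis is an identity of polynomials in r and b. Taking the coefficient of
  r^(2i) and summing b against Hilbert's formula eliminates both. On the left, |\<eta>|^2 = u v
  merges all terms into multiples of u^i v^j, with positive total weight; on the right, where u = v
  = 1, a polynomial in |\<eta>0|^2 remains.\<close>

lemma design_convolution:
  fixes u v :: "'z \<Rightarrow> real" and \<eta> :: "'z \<Rightarrow> 'f :: euclidean_space"
  assumes X: "finite X" and \<eta>: "\<And>z. z \<in> X \<Longrightarrow> \<eta> z \<bullet> \<eta> z = u z * v z"
    and eq: "\<And>r b. (\<Sum>z\<in>X. (u z * r\<^sup>2 + 2 * (\<eta> z \<bullet> b) * r + v z * (b \<bullet> b)) ^ (i + j)) =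
      \<kappa> * (r\<^sup>2 + 2 * (\<eta>0 \<bullet> b) * r + b \<bullet> b) ^ (i + j)"
  shows "(\<Sum>z\<in>X. u z ^ i * v z ^ j) = \<kappa> * poly (conv_poly DIM('f) i j) (\<eta>0 \<bullet> \<eta>0)"
proof -
  obtain T w where T: "finite T" "\<And>v :: 'f. (\<Sum>b\<in>T. w b * (v \<bullet> b) ^ (2 * j)) = (v \<bullet> v) ^ j"
    using Hilbert_identity by blast
  let ?D = "conv_coeff DIM('f) i j"
  let ?S = "\<lambda>f. \<Sum>s\<le>i + j. \<Sum>p\<le>i + j - s. ?D s p * f s p :: real"
  have peq: "(\<Sum>z\<in>X. [:v z * (b \<bullet> b), 2 * (\<eta> z \<bullet> b), u z:] ^ (i + j)) =
      smult \<kappa> ([:1 * (b \<bullet> b), 2 * (\<eta>0 \<bullet> b), 1:] ^ (i + j))" for b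
  proof (rule iffD1[OF poly_eq_poly_eq_iff], rule ext)
    fix r
    show "poly (\<Sum>z\<in>X. [:v z * (b \<bullet> b), 2 * (\<eta> z \<bullet> b), u z:] ^ (i + j)) r =
        poly (smult \<kappa> ([:1 * (b \<bullet> b), 2 * (\<eta>0 \<bullet> b), 1:] ^ (i + j))) r"
      using eq[of r b] by (simp add: poly_sum power2_eq_square algebra_simps)
  qed
  have "(\<Sum>z\<in>X. coeff ([:v z * (b \<bullet> b), 2 * (\<eta> z \<bullet> b), u z:] ^ (i + j)) (2 * i)) =
      \<kappa> * coeff ([:1 * (b \<bullet> b), 2 * (\<eta>0 \<bullet> b), 1:] ^ (i + j)) (2 * i)" for b
    using arg_cong[OF peq[of b], of "\<lambda>p. coeff p (2 * i)"] by (simp only: coeff_sum coeff_smult)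
  then have "(\<Sum>b\<in>T. w b * (\<Sum>z\<in>X. coeff ([:v z * (b \<bullet> b), 2 * (\<eta> z \<bullet> b), u z:] ^ (i + j)) (2 * i))) =
      \<kappa> * (\<Sum>b\<in>T. w b * coeff ([:1 * (b \<bullet> b), 2 * (\<eta>0 \<bullet> b), 1:] ^ (i + j)) (2 * i))"
    by (simp add: sum_distrib_left mult_ac)
  also have "(\<Sum>b\<in>T. w b * (\<Sum>z\<in>X. coeff ([:v z * (b \<bullet> b), 2 * (\<eta> z \<bullet> b), u z:] ^ (i + j)) (2 * i))) =
      (\<Sum>z\<in>X. \<Sum>b\<in>T. w b * coeff ([:v z * (b \<bullet> b), 2 * (\<eta> z \<bullet> b), u z:] ^ (i + j)) (2 * i))"
    unfolding sum_distrib_left by (rule sum.swap)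
  also have "\<dots> = (\<Sum>z\<in>X. ?S (\<lambda>s p. u z ^ p * v z ^ (i + j - s - p) * (\<eta> z \<bullet> \<eta> z) ^ (s div 2)))"
    by (simp only: quadrature_trinomial[OF T])
  also have "\<dots> = (\<Sum>z\<in>X. ?S (\<lambda>s p. u z ^ i * v z ^ j))"
  proof (intro sum.cong refl)
    fix z s p assume *: "z \<in> X" "s \<in> {..i + j}" "p \<in> {..i + j - s}"
    show "?D s p * (u z ^ p * v z ^ (i + j - s - p) * (\<eta> z \<bullet> \<eta> z) ^ (s div 2)) = ?D s p * (u z ^ i * v z ^ j)"
    proof (cases "2 * p + s = 2 * i")
      case True
      define l where "l = s div 2"
      have s: "s = 2 * l" using True unfolding l_def by presburger
      have "i = p + l" "j = i + j - s - p + l" using True * unfolding s by auto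
      then have "u z ^ i * v z ^ j = u z ^ (p + l) * v z ^ (i + j - s - p + l)"
        by (rule arg_cong2)
      also have "\<dots> = u z ^ p * v z ^ (i + j - s - p) * (u z * v z) ^ l"
        by (simp only: power_add power_mult_distrib mult_ac)
      finally have "u z ^ i * v z ^ j = u z ^ p * v z ^ (i + j - s - p) * (u z * v z) ^ l" .
      then show ?thesis using \<eta> * by (simp flip: l_def)
    qed (simp add: conv_coeff_def)
  qed
  also have "\<dots> = (\<Sum>z\<in>X. u z ^ i * v z ^ j) * (\<Sum>s\<le>i + j. \<Sum>p\<le>i + j - s. ?D s p)"
    by (subst sum_distrib_right) (simp add: sum_distrib_left mult_ac)
  also have "(\<Sum>b\<in>T. w b * coeff ([:1 * (b \<bullet> b), 2 * (\<eta>0 \<bullet> b), 1:] ^ (i + j)) (2 * i)) =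
      ?S (\<lambda>s p. 1 ^ p * 1 ^ (i + j - s - p) * (\<eta>0 \<bullet> \<eta>0) ^ (s div 2))"
    by (rule quadrature_trinomial[OF T])
  finally have "(\<Sum>z\<in>X. u z ^ i * v z ^ j) * (\<Sum>s\<le>i + j. \<Sum>p\<le>i + j - s. ?D s p) =
      \<kappa> * ?S (\<lambda>s p. (\<eta>0 \<bullet> \<eta>0) ^ (s div 2))"
    by simp
  moreover have "(\<Sum>s\<le>i + j. \<Sum>p\<le>i + j - s. ?D s p) > 0"
    by (rule conv_coeff_sum_pos) simp
  ultimately show ?thesis
    by (simp add: conv_poly_def poly_sum poly_monom field_simps)
qed

lemma projective_convolution:
  fixes r :: "'p \<Rightarrow> 'a :: conj_div_algebra ^ 'n"
  defines "c \<equiv> \<lambda>k. pochhammer (real DIM('a) / 2) k / pochhammer (real DIM('a ^ 'n) / 2) k"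
  assumes X: "finite X" and unit: "\<And>x. x \<in> X \<Longrightarrow> r x \<bullet> r x = 1"
    and eq: "\<And>y. y \<in> X \<Longrightarrow> (\<Sum>x\<in>X. (norm (herm (r x) (r y))) ^ (2 * (i + j))) = real (card X) * c (i + j)"
    and xy: "x \<in> X" "y \<in> X"
  shows "(\<Sum>z\<in>X. ((norm (herm (r z) (r x)))\<^sup>2) ^ i * ((norm (herm (r z) (r y)))\<^sup>2) ^ j) =
    real (card X) * c (i + j) * poly (conv_poly DIM('a) i j) ((norm (herm (r x) (r y)))\<^sup>2)"
proof -
  \<comment> \<open>Chosen so that for w = x s + y b the cross term of |z^* w|^2 is 2 s times the
    real inner product of \<eta> z and b: moving z^* y across the inner product conjugates
    it.\<close>
  let ?\<eta> = "\<lambda>z. conj (herm (r z) (r y)) * herm (r z) (r x)"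
  have w: "(\<Sum>z\<in>X. (norm (herm (r z) v)) ^ (2 * (i + j))) = real (card X) * c (i + j) * (v \<bullet> v) ^ (i + j)" for v
    unfolding c_def by (rule welch_equality[OF X unit eq[unfolded c_def]])
  have "(\<Sum>z\<in>X. ((norm (herm (r z) (r x)))\<^sup>2) ^ i * ((norm (herm (r z) (r y)))\<^sup>2) ^ j) =
      real (card X) * c (i + j) * poly (conv_poly DIM('a) i j) (herm (r y) (r x) \<bullet> herm (r y) (r x))"
  proof (rule design_convolution[OF X])
    fix z
    show "?\<eta> z \<bullet> ?\<eta> z = (norm (herm (r z) (r x)))\<^sup>2 * (norm (herm (r z) (r y)))\<^sup>2"
      by (simp add: norm_mult power_mult_distrib flip: power2_norm_eq_inner)
  next
    fix s b
    let ?w = "s *\<^sub>R r x + rscale (r y) b"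
    have "(norm (herm (r z) ?w))\<^sup>2 =
        (norm (herm (r z) (r x)))\<^sup>2 * s\<^sup>2 + 2 * (?\<eta> z \<bullet> b) * s + (norm (herm (r z) (r y)))\<^sup>2 * (b \<bullet> b)" for z
    proof -
      let ?h1 = "herm (r z) (r x)" and ?h2 = "herm (r z) (r y)"
      have "(norm (herm (r z) ?w))\<^sup>2 = (s *\<^sub>R ?h1 + ?h2 * b) \<bullet> (s *\<^sub>R ?h1 + ?h2 * b)"
        by (simp only: power2_norm_eq_inner herm_add_right herm_scaleR_right herm_rscale_right)
      also have "\<dots> = s\<^sup>2 * (?h1 \<bullet> ?h1) + 2 * s * ((?h2 * b) \<bullet> ?h1) + (?h2 * b) \<bullet> (?h2 * b)"
        by (simp add: inner_add_left inner_add_right inner_commute power2_eq_square algebra_simps)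
      also have "(?h2 * b) \<bullet> ?h1 = ?\<eta> z \<bullet> b"
        unfolding inner_mult_conj_left[of ?h2] by (rule inner_commute)
      also have "(?h2 * b) \<bullet> (?h2 * b) = (norm ?h2)\<^sup>2 * (b \<bullet> b)"
        by (rule inner_mult_left_same)
      finally show ?thesis by (simp add: power2_norm_eq_inner mult_ac)
    qed
    moreover have "?w \<bullet> ?w = s\<^sup>2 + 2 * (herm (r y) (r x) \<bullet> b) * s + b \<bullet> b"
    proof -
      have "?w \<bullet> ?w = s\<^sup>2 * (r x \<bullet> r x) + 2 * s * (rscale (r y) b \<bullet> r x) + rscale (r y) b \<bullet> rscale (r y) b"
        by (simp add: inner_add_left inner_add_right inner_commute power2_eq_square algebra_simps)
      then show ?thesis
        using unit xy
        by (simp only: inner_rscale_self) (simp add: inner_rscale inner_commute[of "herm (r y) (r x)" b])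
    qed
    ultimately show "(\<Sum>z\<in>X. ((norm (herm (r z) (r x)))\<^sup>2 * s\<^sup>2 + 2 * (?\<eta> z \<bullet> b) * s +
        (norm (herm (r z) (r y)))\<^sup>2 * (b \<bullet> b)) ^ (i + j)) =
        real (card X) * c (i + j) * (s\<^sup>2 + 2 * (herm (r y) (r x) \<bullet> b) * s + b \<bullet> b) ^ (i + j)"
      using w[of ?w] by (simp only: power_mult)
  qed
  then show ?thesis
    by (simp only: norm_herm_commute[of "r y" "r x"] power2_norm_eq_inner[symmetric])
qed

section \<open>Shifted Jacobi polynomials\<close>

lemma alternating_sum_Suc:
  fixes f :: "nat \<Rightarrow> 'a :: comm_ring_1"
  shows "(\<Sum>k\<le>Suc n. (-1)^k * of_nat (Suc n choose k) * f k) =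
    (\<Sum>k\<le>n. (-1)^k * of_nat (n choose k) * (f k - f (Suc k)))"
proof -
  have "(\<Sum>k\<le>Suc n. (-1)^k * of_nat (Suc n choose k) * f k) =
      f 0 + (\<Sum>k\<le>n. (-1)^Suc k * of_nat (Suc n choose Suc k) * f (Suc k))"
    by (subst sum.atMost_Suc_shift) simp
  also have "(\<Sum>k\<le>n. (-1)^Suc k * of_nat (Suc n choose Suc k) * f (Suc k)) =
      (\<Sum>k\<le>n. (-1)^Suc k * of_nat (n choose Suc k) * f (Suc k)) +
      (\<Sum>k\<le>n. (-1)^Suc k * of_nat (n choose k) * f (Suc k))"
    by (simp add: algebra_simps flip: sum.distrib)
  also have "f 0 + ((\<Sum>k\<le>n. (-1)^Suc k * of_nat (n choose Suc k) * f (Suc k)) +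
      (\<Sum>k\<le>n. (-1)^Suc k * of_nat (n choose k) * f (Suc k))) =
      (\<Sum>k\<le>Suc n. (-1)^k * of_nat (n choose k) * f k) -
      (\<Sum>k\<le>n. (-1)^k * of_nat (n choose k) * f (Suc k))"
    by (subst sum.atMost_Suc_shift) (simp add: sum_negf)
  also have "\<dots> = (\<Sum>k\<le>n. (-1)^k * of_nat (n choose k) * (f k - f (Suc k)))"
    by (simp add: binomial_eq_0 right_diff_distrib sum_subtractf)
  finally show ?thesis .
qed

lemma degree_diff_shift_less:
  fixes p :: "real poly"
  assumes "degree p \<le> Suc n"
  shows "degree (p - pcompose p [:1, 1:]) \<le> n"
proof (rule degree_le, intro allI impI)
  fix i assume "n < i"
  show "coeff (p - pcompose p [:1, 1:]) i = 0"
  proof (cases "i = Suc n \<and> degree p = Suc n")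
    case True
    have "coeff (pcompose p [:1, 1:]) (degree p * 1) = lead_coeff p * lead_coeff [:1, 1::real:] ^ degree p"
      using lead_coeff_comp[of "[:1, 1::real:]" p] by (simp add: degree_pcompose)
    with True show ?thesis by simp
  next
    case False
    then have "degree p < i" using assms \<open>n < i\<close> by linarith
    then show ?thesis by (simp add: coeff_eq_0 degree_pcompose)
  qed
qed

lemma alternating_sum_poly_eq_0:
  fixes p :: "real poly"
  assumes "degree p < n"
  shows "(\<Sum>k\<le>n. (-1)^k * of_nat (n choose k) * poly p (of_nat k)) = 0"
  using assms
proof (induction n arbitrary: p)
  case (Suc n)
  let ?q = "p - pcompose p [:1, 1:]"
  have eq: "(\<Sum>k\<le>Suc n. (-1)^k * of_nat (Suc n choose k) * poly p (of_nat k)) =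
      (\<Sum>k\<le>n. (-1)^k * of_nat (n choose k) * poly ?q (of_nat k))"
    unfolding alternating_sum_Suc by (simp add: poly_pcompose add.commute)
  show ?case
  proof (cases n)
    case 0
    with Suc.prems obtain c where "p = [:c:]" by (auto elim: degree_eq_zeroE)
    then show ?thesis using 0 by simp
  next
    case (Suc m)
    with Suc.prems have "degree ?q < n"
      using degree_diff_shift_less[of p m] by simp
    then show ?thesis unfolding eq by (rule Suc.IH)
  qed
qed simp

lemma alternating_sum_inverse:
  fixes x :: real
  assumes "x > 0"
  shows "(\<Sum>k\<le>n. (-1)^k * of_nat (n choose k) * (1 / (x + of_nat k))) = fact n / pochhammer x (Suc n)"
  using assms
proof (induction n arbitrary: x)
  case (Suc n)
  have "(\<Sum>k\<le>Suc n. (-1)^k * of_nat (Suc n choose k) * (1 / (x + of_nat k))) =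
      (\<Sum>k\<le>n. (-1)^k * of_nat (n choose k) * (1 / (x + of_nat k))) -
      (\<Sum>k\<le>n. (-1)^k * of_nat (n choose k) * (1 / ((x + 1) + of_nat k)))"
    unfolding alternating_sum_Suc by (simp add: right_diff_distrib sum_subtractf add_ac)
  also have "\<dots> = fact n / pochhammer x (Suc n) - fact n / pochhammer (x + 1) (Suc n)"
    using Suc.IH[of x] Suc.IH[of "x + 1"] Suc.prems by simp
  also have "pochhammer x (Suc n) = x * pochhammer (x + 1) n"
    by (rule pochhammer_rec)
  also have "pochhammer (x + 1) (Suc n) = pochhammer (x + 1) n * (x + 1 + n)"
    by (simp add: pochhammer_Suc)
  also have "fact n / (x * pochhammer (x + 1) n) - fact n / (pochhammer (x + 1) n * (x + 1 + n)) =
      fact (Suc n) / (x * (pochhammer (x + 1) n * (x + 1 + n)))"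
    using Suc.prems pochhammer_pos[of "x + 1" n] by (simp add: divide_simps) (simp add: algebra_simps)
  also have "x * (pochhammer (x + 1) n * (x + 1 + n)) = pochhammer x (Suc (Suc n))"
    by (subst pochhammer_rec) (simp add: pochhammer_Suc)
  finally show ?case .
qed (simp add: pochhammer_Suc)

text \<open>Division by x + y leaves the remainder p(-x); the quotient has degree below n and is
  annihilated by the n-th difference.\<close>

lemma alternating_sum_poly_over_linear:
  fixes x :: real
  assumes "x > 0" "degree p \<le> n"
  shows "(\<Sum>k\<le>n. (-1)^k * of_nat (n choose k) * (poly p (of_nat k) / (x + of_nat k))) =
    poly p (-x) * fact n / pochhammer x (Suc n)"
proof -
  have "[:x, 1:] dvd p - [:poly p (-x):]"
    using poly_eq_0_iff_dvd[of "p - [:poly p (-x):]" "-x"] by simp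
  then obtain q where q: "p - [:poly p (-x):] = [:x, 1:] * q" by (elim dvdE)
  have *: "poly p y / (x + y) = poly p (-x) * (1 / (x + y)) + poly q y" if "y \<ge> 0" for y
  proof -
    have "poly p y - poly p (-x) = (x + y) * poly q y"
      using arg_cong[OF q, of "\<lambda>r. poly r y"] by (simp add: algebra_simps)
    with that assms(1) show ?thesis by (simp add: field_simps)
  qed
  have "(\<Sum>k\<le>n. (-1)^k * of_nat (n choose k) * poly q (of_nat k)) = 0"
  proof (cases "q = 0")
    case False
    then have "degree (p - [:poly p (-x):]) = Suc (degree q)"
      by (simp add: q degree_mult_eq del: mult_pCons_left)
    moreover have "degree (p - [:poly p (-x):]) \<le> n"
      using assms(2) by (intro degree_diff_le) auto
    ultimately show ?thesis by (intro alternating_sum_poly_eq_0) simp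
  qed simp
  then have "(\<Sum>k\<le>n. (-1)^k * of_nat (n choose k) * (poly p (of_nat k) / (x + of_nat k))) =
     (\<Sum>k\<le>n. poly p (-x) * ((-1)^k * of_nat (n choose k) * (1 / (x + of_nat k))))"
    by (simp add: * distrib_left sum.distrib mult_ac)
  also have "\<dots> = poly p (-x) * fact n / pochhammer x (Suc n)"
    by (simp only: sum_distrib_left[symmetric] alternating_sum_inverse[OF assms(1)]) simp
  finally show ?thesis .
qed

text \<open>The difference of consecutive quotients (c)_k / (b)_k is (b - c) / b times the quotient
  with b + 1 in place of b, which drives the induction.\<close>

lemma Chu_Vandermonde_pochhammer:
  fixes b c :: real
  assumes "b > 0"
  shows "(\<Sum>k\<le>n. (-1)^k * of_nat (n choose k) * (pochhammer c k / pochhammer b k)) =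
    pochhammer (b - c) n / pochhammer b n"
  using assms
proof (induction n arbitrary: b)
  case (Suc n)
  have *: "pochhammer c k / pochhammer b k - pochhammer c (Suc k) / pochhammer b (Suc k) =
      (b - c) / b * (pochhammer c k / pochhammer (b + 1) k)" for k
  proof -
    have "b * pochhammer (b + 1) k = pochhammer b k * (b + k)"
      by (metis pochhammer_Suc pochhammer_rec)
    then have "pochhammer (b + 1) k = pochhammer b k * (b + k) / b"
      using Suc.prems by (simp add: field_simps)
    moreover have "pochhammer c k / P - pochhammer c k * (c + k) / (P * (b + k)) =
        (b - c) / b * (pochhammer c k / (P * (b + k) / b))" if "P > 0" for P
      using that Suc.prems by (simp add: divide_simps) (simp add: algebra_simps)
    ultimately show ?thesis
      using Suc.prems by (simp only: pochhammer_Suc pochhammer_pos)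
  qed
  have "(\<Sum>k\<le>Suc n. (-1)^k * of_nat (Suc n choose k) * (pochhammer c k / pochhammer b k)) =
     (b - c) / b * (pochhammer (b + 1 - c) n / pochhammer (b + 1) n)"
    unfolding alternating_sum_Suc * using Suc.IH[of "b + 1"] Suc.prems
    by (simp only: mult.left_commute[of _ "(b - c) / b"] sum_distrib_left[symmetric])
  also have "\<dots> = pochhammer (b - c) (Suc n) / pochhammer b (Suc n)"
    by (simp add: pochhammer_rec diff_add_eq)
  finally show ?case .
qed simp

text \<open>For \<open>a > b > 0\<close> this is integration against the probability density on the unit interval
  proportional to \<open>x powr (b - 1) * (1 - x) powr (a - b - 1)\<close>.\<close>

definition moment :: "real \<Rightarrow> real \<Rightarrow> real poly \<Rightarrow> real" where
  "moment a b p = (\<Sum>k\<le>degree p. coeff p k * (pochhammer b k / pochhammer a k))"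

lemma moment_eq_sum:
  assumes "degree p \<le> n"
  shows "moment a b p = (\<Sum>k\<le>n. coeff p k * (pochhammer b k / pochhammer a k))"
  unfolding moment_def by (rule sum.mono_neutral_left) (use assms in \<open>auto simp: coeff_eq_0\<close>)

lemma moment_add: "moment a b (p + q) = moment a b p + moment a b q"
proof -
  let ?n = "max (degree p) (degree q)"
  have "degree (p + q) \<le> ?n" by (rule degree_add_le_max)
  then show ?thesis
    by (simp only: moment_eq_sum[where n = ?n] max.cobounded1 max.cobounded2 coeff_add distrib_right sum.distrib)
qed

lemma moment_smult: "moment a b (smult c p) = c * moment a b p"
  by (simp add: moment_eq_sum[where n = "degree p"] sum_distrib_left mult.assoc)

lemma moment_0 [simp]: "moment a b 0 = 0"
  by (simp add: moment_def)

lemma moment_sum: "moment a b (sum f S) = (\<Sum>i\<in>S. moment a b (f i))"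
  by (induction S rule: infinite_finite_induct) (auto simp: moment_add)

lemma moment_monom: "moment a b (monom c k) = c * (pochhammer b k / pochhammer a k)"
proof -
  have "moment a b (monom c k) = (\<Sum>i\<le>k. coeff (monom c k) i * (pochhammer b i / pochhammer a i))"
    by (rule moment_eq_sum) (rule degree_monom_le)
  also have "\<dots> = (\<Sum>i\<le>k. if i = k then c * (pochhammer b k / pochhammer a k) else 0)"
    by (rule sum.cong) auto
  finally show ?thesis by simp
qed

lemma poly_as_sum_smult_monom: "(p :: real poly) = (\<Sum>i\<le>degree p. smult (coeff p i) (monom 1 i))"
  by (simp add: smult_monom poly_as_sum_of_monoms)

lemma moment_eqI:
  assumes "\<And>k. k \<le> degree p \<Longrightarrow> moment a b (q * monom 1 k) = moment c d (r * monom 1 k) * e"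
  shows "moment a b (q * p) = moment c d (r * p) * e"
proof -
  have "moment a b (q * p) = (\<Sum>k\<le>degree p. coeff p k * moment a b (q * monom 1 k))"
    by (subst poly_as_sum_smult_monom[of p]) (simp add: sum_distrib_left moment_sum moment_smult)
  also have "\<dots> = (\<Sum>k\<le>degree p. coeff p k * moment c d (r * monom 1 k)) * e"
    using assms by (simp add: sum_distrib_right mult.assoc)
  also have "(\<Sum>k\<le>degree p. coeff p k * moment c d (r * monom 1 k)) = moment c d (r * p)"
    by (subst (2) poly_as_sum_smult_monom[of p]) (simp add: sum_distrib_left moment_sum moment_smult)
  finally show ?thesis .
qed

text \<open>A factor x or 1 - x raises an exponent of the weight; \<open>angle_polynomial\<close>
  relies on both shifts.\<close>

lemma moment_mult_X:
  assumes "a > 0"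
  shows "moment a b ([:0, 1:] * p) = b / a * moment (a + 1) (b + 1) p"
proof -
  have "moment a b ([:0, 1:] * p) = moment (a + 1) (b + 1) (1 * p) * (b / a)"
  proof (rule moment_eqI)
    fix k
    have "[:0, 1:] * monom (1::real) k = monom 1 (Suc k)"
      by (simp add: monom_Suc)
    then show "moment a b ([:0, 1:] * monom 1 k) = moment (a + 1) (b + 1) (1 * monom 1 k) * (b / a)"
      by (simp add: moment_monom pochhammer_rec mult.commute)
  qed
  then show ?thesis by simp
qed

lemma moment_mult_one_minus_X:
  assumes "a > 0"
  shows "moment a b ([:1, -1:] * p) = (a - b) / a * moment (a + 1) b p"
proof -
  have "moment a b ([:1, -1:] * p) = moment (a + 1) b (1 * p) * ((a - b) / a)"
  proof (rule moment_eqI)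
    fix k
    have eq: "[:1, -1:] * monom (1::real) k = monom 1 k + smult (-1) (monom 1 (Suc k))"
      by (simp add: monom_Suc)
    have "a * pochhammer (a + 1) k = pochhammer a k * (a + k)"
      by (metis pochhammer_Suc pochhammer_rec)
    then have "pochhammer (a + 1) k = pochhammer a k * (a + k) / a"
      using assms by (simp add: field_simps)
    then show "moment a b ([:1, -1:] * monom 1 k) = moment (a + 1) b (1 * monom 1 k) * ((a - b) / a)"
      unfolding eq moment_add moment_smult moment_monom using assms pochhammer_pos[of a k]
      by (simp add: moment_monom pochhammer_Suc divide_simps) (simp add: algebra_simps)
  qed
  then show ?thesis by simp
qed

text \<open>The hypergeometric polynomial 2F1(-n, a + n - 1; b; x), a multiple of the Jacobi
  polynomial with parameters (a - b - 1, b - 1) at 2x - 1. Normalization at 0 instead of 1 makes the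
  value at the angle 0 trivial, as \<open>mult_s_odd\<close> requires.\<close>

definition sjacobi :: "real \<Rightarrow> real \<Rightarrow> nat \<Rightarrow> real poly" where
  "sjacobi a b n = (\<Sum>k\<le>n. monom ((-1)^k * of_nat (n choose k) * (pochhammer (a + n - 1) k / pochhammer b k)) k)"

lemma coeff_sjacobi:
  "coeff (sjacobi a b n) k = (if k \<le> n then (-1)^k * of_nat (n choose k) * (pochhammer (a + n - 1) k / pochhammer b k) else 0)"
  by (simp add: sjacobi_def coeff_sum)

lemma poly_sjacobi_0 [simp]: "poly (sjacobi a b n) 0 = 1"
  by (simp add: poly_0_coeff_0 coeff_sjacobi)

context
  fixes a b :: real
  assumes a: "a > b" and b: "b > 0"
begin

lemma degree_sjacobi [simp]: "degree (sjacobi a b n) = n"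
proof (rule antisym)
  show "degree (sjacobi a b n) \<le> n" by (rule degree_le) (simp add: coeff_sjacobi)
  have "n = 0 \<or> pochhammer (a + n - 1) n > 0" using a b by (cases n) (auto intro!: pochhammer_pos)
  then have "coeff (sjacobi a b n) n \<noteq> 0"
    using a b pochhammer_pos[of b n] by (auto simp: coeff_sjacobi)
  then show "n \<le> degree (sjacobi a b n)" by (rule le_degree)
qed

lemma poly_sjacobi_1: "poly (sjacobi a b n) 1 = (-1)^n * pochhammer (a - b) n / pochhammer b n"
proof -
  have "poly (sjacobi a b n) 1 = pochhammer (b - (a + n - 1)) n / pochhammer b n"
    using Chu_Vandermonde_pochhammer[OF b, of n "a + n - 1"]
    by (simp add: sjacobi_def poly_sum poly_monom)
  also have "b - (a + n - 1) = - (a - b + n - 1)" by simp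
  also have "pochhammer \<dots> n = (-1)^n * pochhammer (a - b) n"
    unfolding pochhammer_minus by simp
  finally show ?thesis .
qed

lemma poly_sjacobi_1_nonzero: "poly (sjacobi a b n) 1 \<noteq> 0"
  using a b pochhammer_pos[of "a - b" n] pochhammer_pos[of b n] by (simp add: poly_sjacobi_1)

lemma moment_sjacobi_monom:
  "moment a b (sjacobi a b n * monom 1 j) = (\<Sum>k\<le>n. (-1)^k * of_nat (n choose k) *
     (pochhammer (a + n - 1) k / pochhammer b k * (pochhammer b (k + j) / pochhammer a (k + j))))"
  by (simp add: sjacobi_def sum_distrib_right mult_monom moment_sum moment_monom mult.assoc)

definition shifted_pochhammer :: "real \<Rightarrow> nat \<Rightarrow> real poly" where
  "shifted_pochhammer x j = (\<Prod>i<j. [:x + real i, 1:])"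

lemma poly_shifted_pochhammer: "poly (shifted_pochhammer x j) y = pochhammer (x + y) j"
  by (simp add: shifted_pochhammer_def poly_prod pochhammer_prod add_ac atLeast0LessThan)

lemma degree_shifted_pochhammer: "degree (shifted_pochhammer x j) \<le> j"
  unfolding shifted_pochhammer_def using degree_prod_sum_le[of "{..<j}" "\<lambda>i. [:x + real i, 1:]"] by simp

text \<open>For j < n the Pochhammer quotient under the alternating sum is a polynomial in k of
  degree at most n - 1: the b-part contributes j factors, the a-part n - 1 - j. The n-th difference
  kills it.\<close>

lemma moment_sjacobi_lower_monom:
  assumes "j < n"
  shows "moment a b (sjacobi a b n * monom 1 j) = 0"
proof -
  let ?p = "smult (1 / pochhammer a (n - 1)) (shifted_pochhammer b j * shifted_pochhammer (a + j) (n - 1 - j))"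
  have *: "pochhammer (a + n - 1) k / pochhammer b k * (pochhammer b (k + j) / pochhammer a (k + j)) =
      poly ?p k" for k
  proof -
    have 1: "pochhammer b (k + j) = pochhammer b k * pochhammer (b + k) j"
      using pochhammer_product'[of b k j] by simp
    have "pochhammer a (n - 1 + k) = pochhammer a (n - 1) * pochhammer (a + (n - 1)) k"
      using pochhammer_product'[of a "n - 1" k] assms by simp
    moreover have "a + real (n - 1) = a + n - 1" using assms by simp
    moreover have "pochhammer a (k + j + (n - 1 - j)) = pochhammer a (k + j) * pochhammer (a + (k + j)) (n - 1 - j)"
      using pochhammer_product'[of a "k + j" "n - 1 - j"] by simp
    moreover have "k + j + (n - 1 - j) = n - 1 + k" using assms by simp
    ultimately have 2: "pochhammer a (n - 1) * pochhammer (a + n - 1) k =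
        pochhammer a (k + j) * pochhammer (a + j + k) (n - 1 - j)"
      by (simp only: of_nat_add add_ac)
    have pos: "pochhammer a (n - 1) > 0" "pochhammer a (k + j) > 0" "pochhammer b k > 0"
      using a b by (auto intro: pochhammer_pos)
    have "pochhammer (a + n - 1) k / pochhammer a (k + j) = pochhammer (a + j + k) (n - 1 - j) / pochhammer a (n - 1)"
      using 2 pos by (simp add: field_simps)
    then show ?thesis
      using pos by (simp add: 1 poly_shifted_pochhammer) (simp add: field_simps)
  qed
  have "degree ?p \<le> degree (shifted_pochhammer b j) + degree (shifted_pochhammer (a + j) (n - 1 - j))"
    using degree_mult_le degree_smult_le order_trans by blast
  also have "\<dots> \<le> j + (n - 1 - j)"
    by (intro add_mono degree_shifted_pochhammer)
  finally have "degree ?p < n" using assms by simp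
  then show ?thesis
    unfolding moment_sjacobi_monom * by (rule alternating_sum_poly_eq_0)
qed

lemma moment_sjacobi_orthogonal:
  assumes "degree q < n"
  shows "moment a b (sjacobi a b n * q) = 0"
  using moment_eqI[of q a b "sjacobi a b n" a b 0 0] moment_sjacobi_lower_monom assms by simp

text \<open>For j = n a single factor a + n - 1 + k stays in the denominator, so the sum is
  evaluated by \<open>alternating_sum_poly_over_linear\<close>. The case n = 0 is separate because n
  - 1 occurs.\<close>

lemma moment_sjacobi_top:
  "moment a b (sjacobi a b n * monom 1 n) =
    (-1)^n * pochhammer (a - b) n * fact n / (pochhammer a n * pochhammer (a + n) n)"
proof (cases n)
  case 0
  then show ?thesis using moment_monom[of a b 1 0] by (simp add: sjacobi_def)
next
  case (Suc n')
  let ?p = "smult (1 / pochhammer a (n - 1)) (shifted_pochhammer b n)"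
  have pos: "pochhammer a i > 0" "pochhammer b i > 0" for i
    using a b by (auto intro: pochhammer_pos)
  have an: "a + n - 1 > 0" using a b Suc by simp
  have n1: "real (n - 1) = n - 1" using Suc by simp
  have *: "pochhammer (a + n - 1) k / pochhammer b k * (pochhammer b (k + n) / pochhammer a (k + n)) =
      poly ?p k / (a + n - 1 + k)" for k
  proof -
    have 1: "pochhammer b (k + n) = pochhammer b k * pochhammer (b + k) n"
      using pochhammer_product'[of b k n] by simp
    have 2: "pochhammer a (k + n) = pochhammer a (n - 1) * pochhammer (a + n - 1) k * (a + n - 1 + k)"
      using pochhammer_product'[of a "n - 1" "Suc k"] Suc
      by (simp add: n1 pochhammer_Suc add_ac)
    have "pochhammer (a + n - 1) k > 0" using an by (rule pochhammer_pos)
    then show ?thesis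
      using pos[of "n - 1"] pos[of k] an by (simp add: 1 2 poly_shifted_pochhammer)
  qed
  have "moment a b (sjacobi a b n * monom 1 n) = poly ?p (- (a + n - 1)) * fact n / pochhammer (a + n - 1) (Suc n)"
    unfolding moment_sjacobi_monom *
    by (rule alternating_sum_poly_over_linear[OF an])
      (use degree_shifted_pochhammer degree_smult_le order_trans in blast)
  also have "poly ?p (- (a + n - 1)) = pochhammer (- (a - b + n - 1)) n / pochhammer a (n - 1)"
    by (simp add: poly_shifted_pochhammer algebra_simps)
  also have "pochhammer (- (a - b + n - 1)) n = (-1)^n * pochhammer (a - b) n"
    unfolding pochhammer_minus by simp
  also have "pochhammer (a + n - 1) (Suc n) = (a + n - 1) * pochhammer (a + n) n"
    by (simp add: pochhammer_rec)
  also have "(-1)^n * pochhammer (a - b) n / pochhammer a (n - 1) * fact n / ((a + n - 1) * pochhammer (a + n) n) =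
      (-1)^n * pochhammer (a - b) n * fact n / (pochhammer a (n - 1) * (a + n - 1) * pochhammer (a + n) n)"
    by simp
  also have "pochhammer a (n - 1) * (a + n - 1) = pochhammer a n"
    using Suc by (simp add: pochhammer_Suc)
  finally show ?thesis .
qed

lemma moment_sjacobi_square:
  "moment a b (sjacobi a b n * sjacobi a b n) = coeff (sjacobi a b n) n * moment a b (sjacobi a b n * monom 1 n)"
proof -
  have "sjacobi a b n = smult (coeff (sjacobi a b n) n) (monom 1 n) + (\<Sum>i<n. smult (coeff (sjacobi a b n) i) (monom 1 i))"
    using poly_as_sum_smult_monom[of "sjacobi a b n"] by (simp add: lessThan_Suc_atMost[symmetric])
  then have "moment a b (sjacobi a b n * sjacobi a b n) = moment a b (sjacobi a b n *
      (smult (coeff (sjacobi a b n) n) (monom 1 n) + (\<Sum>i<n. smult (coeff (sjacobi a b n) i) (monom 1 i))))"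
    by simp
  also have "\<dots> = coeff (sjacobi a b n) n * moment a b (sjacobi a b n * monom 1 n)"
    by (simp add: distrib_left moment_add moment_smult sum_distrib_left moment_sum moment_sjacobi_lower_monom)
  finally show ?thesis .
qed

end

lemma expand_in_graded_basis:
  fixes B :: "nat \<Rightarrow> real poly"
  assumes "\<And>i. i < n \<Longrightarrow> degree (B i) = i" "\<And>i. i < n \<Longrightarrow> B i \<noteq> 0"
    and "\<And>k. k \<ge> n \<Longrightarrow> coeff q k = 0"
  shows "\<exists>c. q = (\<Sum>i<n. smult (c i) (B i))"
  using assms
proof (induction n arbitrary: q)
  case 0
  then show ?case by (simp add: poly_eq_iff)
next
  case (Suc n)
  define d where "d = coeff q n / coeff (B n) n"
  have Bn: "coeff (B n) n \<noteq> 0" using Suc.prems(1)[of n] Suc.prems(2)[of n] by (metis leading_coeff_0_iff lessI)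
  have "coeff (q - smult d (B n)) k = 0" if "k \<ge> n" for k
  proof (cases "k = n")
    case True
    then show ?thesis using Bn by (simp add: d_def)
  next
    case False
    then show ?thesis using that Suc.prems(1)[of n] Suc.prems(3)[of k] by (simp add: coeff_eq_0)
  qed
  from Suc.IH[OF _ _ this] Suc.prems(1,2) obtain c where c: "q - smult d (B n) = (\<Sum>i<n. smult (c i) (B i))"
    by auto
  have "q = (\<Sum>i<Suc n. smult ((c(n := d)) i) (B i))"
    using c by (simp add: diff_eq_eq)
  then show ?case by blast
qed

lemma coeff_ge_degree_bound: "degree q < n \<Longrightarrow> k \<ge> n \<Longrightarrow> coeff q k = 0"
  by (simp add: coeff_eq_0)

lemma lagrange_indicator:
  fixes A :: "real set"
  assumes "finite A" "\<alpha> \<in> A"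
  shows "\<exists>q. degree q < card A \<and> (\<forall>\<beta>\<in>A. poly q \<beta> = (if \<beta> = \<alpha> then 1 else 0))"
proof (intro exI conjI ballI)
  let ?q = "\<Prod>\<gamma>\<in>A - {\<alpha>}. smult (1 / (\<alpha> - \<gamma>)) [:-\<gamma>, 1:]"
  have "degree ?q \<le> (\<Sum>\<gamma>\<in>A - {\<alpha>}. degree (smult (1 / (\<alpha> - \<gamma>)) [:-\<gamma>, 1:]))"
    using degree_prod_sum_le[of "A - {\<alpha>}" "\<lambda>\<gamma>. smult (1 / (\<alpha> - \<gamma>)) [:-\<gamma>, 1:]"] assms(1) by (simp add: o_def)
  also have "\<dots> \<le> (\<Sum>\<gamma>\<in>A - {\<alpha>}. 1)"
    by (rule sum_mono) simp
  also have "\<dots> < card A"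
    using assms card_gt_0_iff[of A] by auto
  finally show "degree ?q < card A" .
  fix \<beta> assume "\<beta> \<in> A"
  show "poly ?q \<beta> = (if \<beta> = \<alpha> then 1 else 0)"
  proof (cases "\<beta> = \<alpha>")
    case True
    then show ?thesis by (auto simp: poly_prod divide_simps intro!: prod.neutral)
  next
    case False
    with \<open>\<beta> \<in> A\<close> assms(1) show ?thesis by (auto simp: poly_prod intro!: prod_zero bexI[of _ \<beta>])
  qed
qed

definition sjacobi_norm :: "real \<Rightarrow> real \<Rightarrow> nat \<Rightarrow> real" where
  "sjacobi_norm a b i = moment a b (sjacobi a b i * sjacobi a b i)"

text \<open>For a = N and b = m this is the dimension of the i-th harmonic space of the projective
  space, as the constant diagonal value of its reproducing kernel \<open>zonal_poly\<close>.\<close>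

definition harm_dim :: "real \<Rightarrow> real \<Rightarrow> nat \<Rightarrow> real" where
  "harm_dim a b i = (poly (sjacobi a b i) 1)\<^sup>2 / sjacobi_norm a b i"

definition zonal_poly :: "real \<Rightarrow> real \<Rightarrow> nat \<Rightarrow> real poly" where
  "zonal_poly a b i = smult (poly (sjacobi a b i) 1 / sjacobi_norm a b i) (sjacobi a b i)"

lemma moment_one [simp]: "moment a b 1 = 1" and sjacobi_0 [simp]: "sjacobi a b 0 = 1"
  by (simp_all add: moment_def sjacobi_def)

lemma sjacobi_norm_pos:
  assumes "a > b" "b > 0"
  shows "sjacobi_norm a b i > 0"
proof -
  have "i = 0 \<or> pochhammer (a + i - 1) i > 0" using assms by (cases i) (auto intro!: pochhammer_pos)
  then have "pochhammer (a + i - 1) i > 0" by auto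
  moreover have "pochhammer (a - b) i > 0" "pochhammer a i > 0" "pochhammer (a + i) i > 0" "pochhammer b i > 0"
    using assms by (auto intro!: pochhammer_pos)
  ultimately show ?thesis
    unfolding sjacobi_norm_def moment_sjacobi_square[OF assms] moment_sjacobi_top[OF assms] coeff_sjacobi
    by (cases "even i") simp_all
qed

text \<open>Stated at \<open>Suc i\<close> because the formula for index n contains
  (a)_(n-1).\<close>

lemma harm_dim_eq:
  assumes "a > b" "b > 0"
  shows "harm_dim a b (Suc i) = pochhammer (a - b) (Suc i) * pochhammer a i * (a + 2 * i + 1) / (pochhammer b (Suc i) * fact (Suc i))"
proof -
  define n where "n = Suc i"
  have pos: "pochhammer (a - b) n > 0" "pochhammer a n > 0" "pochhammer (a + n) n > 0" "pochhammer b n > 0"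
     "pochhammer (a + i) n > 0" "pochhammer a i > 0"
    using assms by (auto intro!: pochhammer_pos)
  have sg: "(-1 :: real)^n * (-1)^n = 1" by (simp flip: power_mult_distrib)
  have 1: "pochhammer (a + n - 1) n = pochhammer (a + i) n" by (simp add: n_def)
  have 2: "pochhammer a n = pochhammer a i * (a + i)" by (simp add: n_def pochhammer_Suc)
  have 3: "(a + i) * pochhammer (a + n) n = pochhammer (a + i) n * (a + 2 * i + 1)"
  proof -
    have "(a + i) * pochhammer (a + i + 1) n = pochhammer (a + i) n * (a + i + n)"
      by (metis pochhammer_Suc pochhammer_rec)
    then show ?thesis by (simp add: n_def algebra_simps)
  qed
  have "sjacobi_norm a b n = pochhammer (a - b) n * fact n * pochhammer (a + i) n / (pochhammer b n * (pochhammer a n * pochhammer (a + n) n))"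
    unfolding sjacobi_norm_def moment_sjacobi_square[OF assms] moment_sjacobi_top[OF assms] coeff_sjacobi 1
    using sg by (simp add: mult_ac)
  also have "pochhammer a n * pochhammer (a + n) n = pochhammer a i * (pochhammer (a + i) n * (a + 2 * i + 1))"
    unfolding 2 using 3 by simp
  finally have "sjacobi_norm a b n = pochhammer (a - b) n * fact n / (pochhammer b n * pochhammer a i * (a + 2 * i + 1))"
    using pos by simp
  moreover have "(poly (sjacobi a b n) 1)\<^sup>2 = (pochhammer (a - b) n / pochhammer b n)\<^sup>2"
    unfolding poly_sjacobi_1[OF assms] by (simp add: power_mult_distrib power_divide power2_eq_square sg)
  ultimately show ?thesis
    using pos assms unfolding harm_dim_def by (simp add: power2_eq_square flip: n_def)
qed

lemma harm_dim_0 [simp]: "harm_dim a b 0 = 1"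
  by (simp add: harm_dim_def sjacobi_norm_def)

lemma zonal_poly_eval_1: "poly (zonal_poly a b i) 1 = harm_dim a b i"
  by (simp add: zonal_poly_def harm_dim_def power2_eq_square)

lemma harm_dim_pos: "a > b \<Longrightarrow> b > 0 \<Longrightarrow> harm_dim a b i > 0"
  unfolding harm_dim_def using sjacobi_norm_pos poly_sjacobi_1_nonzero by simp

text \<open>For k >= 1 the k-th term is (-1)^k (a)_(k-1) (a + 2k - 1) / k!, and these telescope. The
  sum yields the value of the complementary idempotent at the angle 0.\<close>

lemma zonal_poly_eval_0_sum:
  assumes "a > b" "b > 0"
  shows "(\<Sum>i<Suc k. poly (zonal_poly a b i) 0) = (-1)^k * pochhammer a k / fact k"
proof (induction k)
  case 0
  then show ?case by (simp add: zonal_poly_def sjacobi_norm_def)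
next
  case (Suc k)
  have pos: "pochhammer (a - b) (Suc k) > 0" "pochhammer b (Suc k) > 0" 
    using assms by (auto intro!: pochhammer_pos)
  have "poly (zonal_poly a b (Suc k)) 0 = harm_dim a b (Suc k) / poly (sjacobi a b (Suc k)) 1"
    using poly_sjacobi_1_nonzero[OF assms] by (simp add: zonal_poly_def harm_dim_def power2_eq_square)
  also have "\<dots> = (-1)^Suc k * pochhammer a k * (a + 2 * k + 1) / fact (Suc k)"
    unfolding harm_dim_eq[OF assms] poly_sjacobi_1[OF assms] using pos
    by (cases "even k") (simp_all add: divide_simps del: fact_Suc)
  finally have *: "poly (zonal_poly a b (Suc k)) 0 = (-1)^Suc k * pochhammer a k * (a + 2 * k + 1) / fact (Suc k)" .
  show ?case
    unfolding sum.lessThan_Suc[of _ "Suc k"] Suc.IH * 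
    by (simp add: pochhammer_Suc divide_simps) (simp add: algebra_simps)
qed

lemma degree_zonal_poly: "a > b \<Longrightarrow> b > 0 \<Longrightarrow> degree (zonal_poly a b i) = i"
  unfolding zonal_poly_def using sjacobi_norm_pos[of b a i] poly_sjacobi_1_nonzero[of b a i] by simp

lemma zonal_poly_nonzero: "a > b \<Longrightarrow> b > 0 \<Longrightarrow> zonal_poly a b i \<noteq> 0"
  using zonal_poly_eval_1[of a b i] harm_dim_pos[of b a i] by fastforce

section \<open>The Bose--Mesner algebra of a tight design\<close>

text \<open>What the matrix argument takes from the geometry: the moments of the angles up to t and
  a convolution rule whose result \<open>g i j\<close> obeys the degree bound.\<close>

locale tight_scheme =
  fixes X :: "'p set" and ang :: "'p \<Rightarrow> 'p \<Rightarrow> real" and a b :: real and g :: "nat \<Rightarrow> nat \<Rightarrow> real poly"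
    and A :: "real set" and t s e :: nat
  assumes ab: "a > b" and b: "b > 0"
    and finX: "finite X" and X_nonempty: "X \<noteq> {}"
    and ang_sym: "x \<in> X \<Longrightarrow> y \<in> X \<Longrightarrow> ang x y = ang y x"
    and ang_self: "x \<in> X \<Longrightarrow> ang x x = 1"
    and ang_less: "x \<in> X \<Longrightarrow> y \<in> X \<Longrightarrow> x \<noteq> y \<Longrightarrow> ang x y < 1"
    and moments: "x \<in> X \<Longrightarrow> k \<le> t \<Longrightarrow>
      (\<Sum>z\<in>X. ang x z ^ k) = real (card X) * (pochhammer b k / pochhammer a k)"
    and degree_g: "degree (g i j) \<le> min i j"
    and convolution: "x \<in> X \<Longrightarrow> y \<in> X \<Longrightarrow> i + j \<le> t \<Longrightarrow>
      (\<Sum>z\<in>X. ang x z ^ i * ang z y ^ j) = poly (g i j) (ang x y)"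
    and A_def: "A = {ang x y |x y. x \<in> X \<and> y \<in> X \<and> x \<noteq> y}"
    and s_def: "s = card A" and e_def: "e = card (A - {0})"
    and tight: "t = s + e" and t_pos: "t \<ge> 1"
begin

abbreviation n :: real where "n \<equiv> real (card X)"

lemma n_pos: "n > 0"
  using finX X_nonempty by (simp add: card_gt_0_iff)

lemma finite_A: "finite A"
proof (rule finite_subset)
  show "A \<subseteq> (\<lambda>(x, y). ang x y) ` (X \<times> X)" by (auto simp: A_def)
qed (use finX in simp)

lemma one_notin_A: "1 \<notin> A"
  using ang_less by (force simp: A_def)

lemma s_e: "e \<le> s" "s \<le> e + 1" "s \<ge> 1" "2 * s \<le> t + 1" "0 \<in> A \<longleftrightarrow> s = e + 1"
proof -
  show 1: "e \<le> s" unfolding s_def e_def using finite_A by (intro card_mono) auto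
  show 2: "s \<le> e + 1" and "0 \<in> A \<longleftrightarrow> s = e + 1"
    using finite_A card_gt_0_iff[of A] unfolding s_def e_def card_Diff_singleton_if by auto
  show "s \<ge> 1" "2 * s \<le> t + 1" using 1 2 tight t_pos by linarith+
qed

section \<open>Matrices indexed by the design, and zonal kernels among them\<close>

definition mm :: "('p \<Rightarrow> 'p \<Rightarrow> real) \<Rightarrow> ('p \<Rightarrow> 'p \<Rightarrow> real) \<Rightarrow> 'p \<Rightarrow> 'p \<Rightarrow> real" where
  "mm f h x y = (\<Sum>z\<in>X. f x z * h z y)"

lemma mm_assoc: "mm (mm f h) k = mm f (mm h k)"
proof (intro ext)
  fix x y
  have "mm (mm f h) k x y = (\<Sum>z\<in>X. \<Sum>w\<in>X. f x w * h w z * k z y)"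
    by (simp add: mm_def sum_distrib_right)
  also have "\<dots> = (\<Sum>w\<in>X. \<Sum>z\<in>X. f x w * h w z * k z y)" by (rule sum.swap)
  finally show "mm (mm f h) k x y = mm f (mm h k) x y"
    by (simp add: mm_def sum_distrib_left mult.assoc)
qed

lemma mm_sum_left: "mm (\<lambda>x y. \<Sum>i\<in>I. c i * f i x y) h = (\<lambda>x y. \<Sum>i\<in>I. c i * mm (f i) h x y)"
proof (intro ext)
  fix x y
  have "mm (\<lambda>x y. \<Sum>i\<in>I. c i * f i x y) h x y = (\<Sum>z\<in>X. \<Sum>i\<in>I. c i * f i x z * h z y)"
    by (simp add: mm_def sum_distrib_right)
  also have "\<dots> = (\<Sum>i\<in>I. \<Sum>z\<in>X. c i * f i x z * h z y)" by (rule sum.swap)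
  finally show "mm (\<lambda>x y. \<Sum>i\<in>I. c i * f i x y) h x y = (\<Sum>i\<in>I. c i * mm (f i) h x y)"
    by (simp add: mm_def sum_distrib_left mult.assoc)
qed

lemma mm_sum_right: "mm h (\<lambda>x y. \<Sum>i\<in>I. c i * f i x y) = (\<lambda>x y. \<Sum>i\<in>I. c i * mm h (f i) x y)"
proof (intro ext)
  fix x y
  have "mm h (\<lambda>x y. \<Sum>i\<in>I. c i * f i x y) x y = (\<Sum>z\<in>X. \<Sum>i\<in>I. c i * (h x z * f i z y))"
    by (simp add: mm_def sum_distrib_left mult_ac)
  also have "\<dots> = (\<Sum>i\<in>I. \<Sum>z\<in>X. c i * (h x z * f i z y))" by (rule sum.swap)
  finally show "mm h (\<lambda>x y. \<Sum>i\<in>I. c i * f i x y) x y = (\<Sum>i\<in>I. c i * mm h (f i) x y)"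
    by (simp add: mm_def sum_distrib_left mult.assoc)
qed

lemma mm_scale_left: "mm (\<lambda>x y. c * f x y) h = (\<lambda>x y. c * mm f h x y)"
  by (intro ext) (simp add: mm_def sum_distrib_left mult.assoc)

lemma mm_scale_right: "mm h (\<lambda>x y. c * f x y) = (\<lambda>x y. c * mm h f x y)"
  by (intro ext) (simp add: mm_def sum_distrib_left mult_ac)

lemma mm_diff_left: "mm (\<lambda>x y. f x y - f' x y) h = (\<lambda>x y. mm f h x y - mm f' h x y)"
  by (intro ext) (simp add: mm_def sum_subtractf left_diff_distrib)

lemma mm_diff_right: "mm h (\<lambda>x y. f x y - f' x y) = (\<lambda>x y. mm h f x y - mm h f' x y)"
  by (intro ext) (simp add: mm_def sum_subtractf right_diff_distrib)

lemma mm_zero [simp]: "mm (\<lambda>_ _. 0) h = (\<lambda>_ _. 0)" "mm h (\<lambda>_ _. 0) = (\<lambda>_ _. 0)"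
  by (auto simp: mm_def fun_eq_iff)

definition ker :: "real poly \<Rightarrow> 'p \<Rightarrow> 'p \<Rightarrow> real" where
  "ker p x y = (if x \<in> X \<and> y \<in> X then poly p (ang x y) else 0)"

definition \<delta> :: "'p \<Rightarrow> 'p \<Rightarrow> real" where
  "\<delta> x y = (if x \<in> X \<and> x = y then 1 else 0)"

definition D :: "real \<Rightarrow> 'p \<Rightarrow> 'p \<Rightarrow> real" where
  "D \<alpha> x y = (if x \<in> X \<and> y \<in> X \<and> ang x y = \<alpha> then 1 else 0)"

lemma ker_sym: "ker p x y = ker p y x"
  by (simp add: ker_def ang_sym)

lemma ker_smult: "ker (smult c p) = (\<lambda>x y. c * ker p x y)"
  by (intro ext) (simp add: ker_def)

lemma ker_diff: "ker (p - q) = (\<lambda>x y. ker p x y - ker q x y)"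
  by (intro ext) (simp add: ker_def)

lemma ker_sum: "ker (\<Sum>i\<in>I. smult (c i) (p i)) = (\<lambda>x y. \<Sum>i\<in>I. c i * ker (p i) x y)"
  by (auto simp: ker_def poly_sum fun_eq_iff intro!: sum.neutral)

lemma ker_0 [simp]: "ker 0 = (\<lambda>_ _. 0)"
  by (intro ext) (simp add: ker_def)

lemma ker_self: "x \<in> X \<Longrightarrow> ker p x x = poly p 1"
  by (simp add: ker_def ang_self)

lemma sum_ker:
  assumes "x \<in> X" "degree p \<le> t"
  shows "(\<Sum>z\<in>X. ker p x z) = n * moment a b p"
proof -
  have "(\<Sum>z\<in>X. ker p x z) = (\<Sum>z\<in>X. \<Sum>k\<le>degree p. coeff p k * ang x z ^ k)"
    using assms by (simp add: ker_def poly_altdef)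
  also have "\<dots> = (\<Sum>k\<le>degree p. coeff p k * (\<Sum>z\<in>X. ang x z ^ k))"
    unfolding sum_distrib_left by (rule sum.swap)
  also have "\<dots> = n * moment a b p"
    using assms by (simp add: moments moment_def sum_distrib_left mult_ac)
  finally show ?thesis .
qed

lemma mm_ker_ex:
  assumes "degree p + degree q \<le> t"
  shows "\<exists>r. degree r \<le> min (degree p) (degree q) \<and> mm (ker p) (ker q) = ker r"
proof (intro exI conjI ext)
  let ?r = "\<Sum>i\<le>degree p. \<Sum>j\<le>degree q. smult (coeff p i * coeff q j) (g i j)"
  show "degree ?r \<le> min (degree p) (degree q)"
  proof (intro degree_sum_le finite_atMost order_trans[OF degree_smult_le])
    fix i j assume "i \<in> {..degree p}" "j \<in> {..degree q}"
    then show "degree (g i j) \<le> min (degree p) (degree q)" using degree_g[of i j] by auto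
  qed
  fix x y
  show "mm (ker p) (ker q) x y = ker ?r x y"
  proof (cases "x \<in> X \<and> y \<in> X")
    case True
    have "mm (ker p) (ker q) x y =
        (\<Sum>z\<in>X. \<Sum>i\<le>degree p. \<Sum>j\<le>degree q. coeff p i * coeff q j * (ang x z ^ i * ang z y ^ j))"
      using True by (simp add: mm_def ker_def poly_altdef sum_product mult_ac)
    also have "\<dots> = (\<Sum>i\<le>degree p. \<Sum>j\<le>degree q. \<Sum>z\<in>X. coeff p i * coeff q j * (ang x z ^ i * ang z y ^ j))"
      by (subst sum.swap, rule sum.cong[OF refl], rule sum.swap)
    also have "\<dots> = (\<Sum>i\<le>degree p. \<Sum>j\<le>degree q. coeff p i * coeff q j * poly (g i j) (ang x y))"
      using True assms by (simp add: convolution flip: sum_distrib_left)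
    finally show ?thesis using True by (simp add: ker_def poly_sum)
  qed (auto simp: mm_def ker_def)
qed

lemma mm_ker_commute:
  assumes "degree p + degree q \<le> t"
  shows "mm (ker p) (ker q) = mm (ker q) (ker p)"
proof (intro ext)
  fix x y
  obtain r where r: "mm (ker p) (ker q) = ker r" using mm_ker_ex[OF assms] by blast
  have "mm (ker q) (ker p) x y = mm (ker p) (ker q) y x"
    unfolding mm_def
  proof (intro sum.cong refl)
    fix z
    show "ker q x z * ker p z y = ker p y z * ker q z x"
      using ker_sym[of q x z] ker_sym[of p z y] by simp
  qed
  then show "mm (ker p) (ker q) x y = mm (ker q) (ker p) x y"
    using ker_sym[of r x y] by (simp add: r)
qed

lemma mm_ker_diag:
  assumes "degree p + degree q \<le> t" "x \<in> X"
  shows "mm (ker p) (ker q) x x = n * moment a b (p * q)"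
proof -
  have "mm (ker p) (ker q) x x = (\<Sum>z\<in>X. ker (p * q) x z)"
    unfolding mm_def by (rule sum.cong[OF refl]) (simp add: ker_sym[of q _ x], simp add: ker_def)
  then show ?thesis using assms degree_mult_le[of p q] by (simp add: sum_ker)
qed

text \<open>A kernel is a real symmetric matrix, so the diagonal of its square contains the squared
  lengths of its rows.\<close>

lemma ker_eq_0I:
  assumes "\<And>x. x \<in> X \<Longrightarrow> mm (ker r) (ker r) x x = 0"
  shows "ker r = (\<lambda>_ _. 0)"
proof (intro ext)
  fix x y
  show "ker r x y = 0"
  proof (cases "x \<in> X \<and> y \<in> X")
    case True
    have "(\<Sum>z\<in>X. ker r x z * ker r x z) = 0"
      using assms[of x] True by (simp add: mm_def ker_sym[of r _ x])
    with True finX show ?thesis by (subst (asm) sum_nonneg_eq_0_iff) auto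
  qed (auto simp: ker_def)
qed

text \<open>Let p be the Jacobi kernel and R = p q. Then R R = p (q R), and q R is a kernel of
  degree at most deg q < i, so orthogonality makes the diagonal of R R vanish and R = 0. Convolution
  takes minima of degrees, which keeps every product within the bound t.\<close>

lemma mm_sjacobi_lower:
  assumes "degree q < i" "i + degree q \<le> t"
  shows "mm (ker (sjacobi a b i)) (ker q) = (\<lambda>_ _. 0)"
proof -
  let ?p = "sjacobi a b i"
  have dp: "degree ?p = i" by (rule degree_sjacobi[OF ab b])
  obtain r where r: "degree r \<le> degree q" "mm (ker ?p) (ker q) = ker r"
    using mm_ker_ex[of ?p q] assms dp by auto
  have "degree q + degree r \<le> t" using assms r by linarith
  then obtain r' where r': "degree r' \<le> min (degree q) (degree r)" "mm (ker q) (ker r) = ker r'"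
    using mm_ker_ex by blast
  have "ker r = (\<lambda>_ _. 0)"
  proof (rule ker_eq_0I)
    fix x assume x: "x \<in> X"
    have "mm (ker r) (ker r) = mm (ker ?p) (ker r')"
      by (simp add: mm_assoc r'(2) flip: r(2)) (simp add: r(2) r'(2))
    then have "mm (ker r) (ker r) x x = n * moment a b (?p * r')"
      using mm_ker_diag[of ?p r' x] x assms r' dp by simp
    also have "moment a b (?p * r') = 0"
      by (rule moment_sjacobi_orthogonal[OF ab b]) (use assms r' in simp)
    finally show "mm (ker r) (ker r) x x = 0" by simp
  qed
  with r(2) show ?thesis by simp
qed

text \<open>Write p p = \<kappa> p + f with deg f < i. The kernel of f is orthogonal to p, hence to
  p p, hence to itself, and so it vanishes. The diagonal then gives \<kappa>.\<close>

lemma mm_sjacobi_self: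
  assumes "2 * i \<le> t"
  shows "mm (ker (sjacobi a b i)) (ker (sjacobi a b i)) = (\<lambda>x y. n * sjacobi_norm a b i / poly (sjacobi a b i) 1 * ker (sjacobi a b i) x y)"
proof -
  let ?p = "sjacobi a b i"
  have dp: "degree ?p = i" by (rule degree_sjacobi[OF ab b])
  have p1: "poly ?p 1 \<noteq> 0" by (rule poly_sjacobi_1_nonzero[OF ab b])
  obtain r where r: "degree r \<le> i" "mm (ker ?p) (ker ?p) = ker r"
    using mm_ker_ex[of ?p ?p] assms dp by auto
  have lc: "coeff ?p i \<noteq> 0" using dp p1 by (metis leading_coeff_0_iff poly_0)
  define \<kappa> where "\<kappa> = coeff r i / coeff ?p i"
  define f where "f = r - smult \<kappa> ?p"
  have f: "f = 0 \<or> degree f < i"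
  proof -
    have "coeff f k = 0" if "k \<ge> i" for k
      using that r(1) dp lc by (cases "k = i") (auto simp: f_def \<kappa>_def coeff_eq_0)
    then show ?thesis using leading_coeff_0_iff[of f] by (metis not_le)
  qed
  have "ker f = (\<lambda>_ _. 0)"
  proof (cases "f = 0")
    case False
    with f have df: "degree f < i" by simp
    then have pf: "mm (ker ?p) (ker f) = (\<lambda>_ _. 0)"
      using assms by (intro mm_sjacobi_lower) auto
    then have fp: "mm (ker f) (ker ?p) = (\<lambda>_ _. 0)"
      using mm_ker_commute[of f ?p] df assms dp by simp
    have "mm (ker f) (ker r) = (\<lambda>_ _. 0)"
      unfolding r(2)[symmetric] mm_assoc[symmetric] fp by simp
    then have "mm (ker f) (ker f) = (\<lambda>_ _. 0)"
      by (subst (2) f_def) (simp add: ker_diff ker_smult mm_diff_right mm_scale_right fp)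
    then show ?thesis by (intro ker_eq_0I) simp
  qed simp
  then have rk: "ker r = (\<lambda>x y. \<kappa> * ker ?p x y)"
    unfolding f_def ker_diff ker_smult by (metis (no_types, lifting) eq_iff_diff_eq_0)
  obtain x where x: "x \<in> X" using X_nonempty by blast
  have "n * sjacobi_norm a b i = \<kappa> * poly ?p 1"
    using mm_ker_diag[of ?p ?p x] x assms dp by (simp add: r(2) rk ker_self sjacobi_norm_def)
  then have "\<kappa> = n * sjacobi_norm a b i / poly ?p 1" using p1 by (simp add: field_simps)
  with r(2) rk show ?thesis by simp
qed

lemma mm_zonal_poly:
  assumes "i + j \<le> t"
  shows "mm (ker (zonal_poly a b i)) (ker (zonal_poly a b j)) = (\<lambda>x y. if i = j then n * ker (zonal_poly a b i) x y else 0)"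
proof -
  have dp: "degree (sjacobi a b i) = i" for i by (rule degree_sjacobi[OF ab b])
  consider "i = j" | "i < j" | "j < i" by linarith
  then show ?thesis
  proof cases
    case 1
    then show ?thesis
      using mm_sjacobi_self[of i] assms poly_sjacobi_1_nonzero[OF ab b, of i] sjacobi_norm_pos[OF ab b, of i]
      unfolding zonal_poly_def ker_smult mm_scale_left mm_scale_right by (simp add: mult_ac)
  next
    case 2
    then show ?thesis
      using mm_sjacobi_lower[of "sjacobi a b i" j] mm_ker_commute[of "sjacobi a b i" "sjacobi a b j"] assms
      unfolding zonal_poly_def ker_smult mm_scale_left mm_scale_right by (simp add: dp)
  next
    case 3
    then show ?thesis
      using mm_sjacobi_lower[of "sjacobi a b j" i] assms
      unfolding zonal_poly_def ker_smult mm_scale_left mm_scale_right by (simp add: dp)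
  qed
qed

text \<open>The value at angle \<open>\<alpha>\<close> of the \<open>i\<close>-th primitive idempotent of the Bose--Mesner algebra.\<close>

definition \<phi> :: "nat \<Rightarrow> real \<Rightarrow> real" where
  "\<phi> i \<alpha> = (if i < s then poly (zonal_poly a b i) \<alpha> / n else (if \<alpha> = 1 then 1 else 0) - (\<Sum>i<s. poly (zonal_poly a b i) \<alpha> / n))"

definition E :: "nat \<Rightarrow> 'p \<Rightarrow> 'p \<Rightarrow> real" where
  "E i x y = (if x \<in> X \<and> y \<in> X then \<phi> i (ang x y) else 0)"

lemma ang_eq_1_iff: "x \<in> X \<Longrightarrow> y \<in> X \<Longrightarrow> ang x y = 1 \<longleftrightarrow> x = y"
  using ang_less ang_self by force

lemma E_less: "i < s \<Longrightarrow> E i = (\<lambda>x y. (1 / n) * ker (zonal_poly a b i) x y)"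
  by (intro ext) (simp add: E_def \<phi>_def ker_def)

lemma E_s: "E s = (\<lambda>x y. \<delta> x y - (\<Sum>i<s. 1 * E i x y))"
  by (intro ext) (auto simp: E_def \<phi>_def \<delta>_def ang_eq_1_iff)

lemma sum_E: "(\<Sum>i\<le>s. E i x y) = \<delta> x y"
  using E_s by (simp add: lessThan_Suc_atMost[symmetric])

lemma mm_\<delta>: "mm \<delta> (E i) = E i" "mm (E i) \<delta> = E i"
proof -
  show "mm \<delta> (E i) = E i"
    by (intro ext) (simp add: mm_def \<delta>_def E_def sum.If_cases if_distrib[of "\<lambda>c. c * _"] finX cong: if_cong)
  show "mm (E i) \<delta> = E i"
    by (intro ext) (simp add: mm_def \<delta>_def E_def if_distrib[of "\<lambda>c. _ * c"] finX cong: if_cong)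
qed

text \<open>For i, j < s the bound 2 s <= t + 1 gives i + j <= 2 s - 2 < t, within reach of the
  convolution rule.\<close>

lemma mm_E_less:
  assumes "i < s" "j < s"
  shows "mm (E i) (E j) = (\<lambda>x y. if i = j then E i x y else 0)"
  unfolding E_less[OF assms(1)] E_less[OF assms(2)] mm_scale_left mm_scale_right
  using assms mm_zonal_poly[of i j] s_e(4) n_pos by (auto simp: fun_eq_iff)

lemma mm_E:
  assumes "i \<le> s" "j \<le> s"
  shows "mm (E i) (E j) = (\<lambda>x y. if i = j then E i x y else 0)"
proof -
  have left: "mm (E s) (E j) = (\<lambda>_ _. 0)" if "j < s" for j
    using that by (subst E_s) (simp add: mm_diff_left mm_\<delta> mm_sum_left[where c = "\<lambda>_. 1", simplified] mm_E_less)
  have right: "mm (E j) (E s) = (\<lambda>_ _. 0)" if "j < s" for j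
    using that by (subst E_s) (simp add: mm_diff_right mm_\<delta> mm_sum_right[where c = "\<lambda>_. 1", simplified] mm_E_less)
  have "mm (E s) (E s) = E s"
    by (subst (2) E_s) (simp add: mm_diff_right mm_\<delta> mm_sum_right[where c = "\<lambda>_. 1", simplified] left)
  then show ?thesis
    using assms left right mm_E_less by (cases "i = s"; cases "j = s") auto
qed

lemma ker_expand:
  assumes "degree q < s"
  shows "\<exists>c. ker q = (\<lambda>x y. \<Sum>i<s. c i * E i x y)"
proof -
  obtain c where "q = (\<Sum>i<s. smult (c i) (zonal_poly a b i))"
    using expand_in_graded_basis[of s "zonal_poly a b" q] degree_zonal_poly[OF ab b] zonal_poly_nonzero[OF ab b] coeff_ge_degree_bound[OF assms] by blast
  then have "ker q = (\<lambda>x y. \<Sum>i<s. c i * ker (zonal_poly a b i) x y)" by (simp only: ker_sum)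
  also have "\<dots> = (\<lambda>x y. \<Sum>i<s. (c i * n) * E i x y)"
    using n_pos by (intro ext sum.cong refl) (simp add: E_less)
  finally show ?thesis by (rule exI[of _ "\<lambda>i. c i * n"])
qed

text \<open>A polynomial of degree below s interpolates the indicator of \<alpha> on the s angles.
  Its value on the diagonal is corrected by a multiple of \<delta>, the sum of all
  idempotents.\<close>

lemma D_expand:
  assumes "\<alpha> \<in> insert 1 A"
  shows "\<exists>\<theta>. D \<alpha> = (\<lambda>x y. \<Sum>i\<le>s. \<theta> i * E i x y)"
proof (cases "\<alpha> = 1")
  case True
  have "D 1 = \<delta>" by (intro ext) (auto simp: D_def \<delta>_def ang_eq_1_iff)
  with True show ?thesis by (intro exI[of _ "\<lambda>_. 1"]) (simp add: sum_E)
next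
  case False
  with assms have \<alpha>: "\<alpha> \<in> A" by simp
  obtain q where q: "degree q < s" "\<And>\<beta>. \<beta> \<in> A \<Longrightarrow> poly q \<beta> = (if \<beta> = \<alpha> then 1 else 0)"
    using lagrange_indicator[OF finite_A \<alpha>] unfolding s_def by blast
  obtain c where c: "ker q = (\<lambda>x y. \<Sum>i<s. c i * E i x y)" using ker_expand[OF q(1)] by blast
  have "D \<alpha> x y = ker q x y - poly q 1 * \<delta> x y" for x y
  proof (cases "x \<in> X \<and> y \<in> X \<and> x \<noteq> y")
    case True
    then have "ang x y \<in> A" by (auto simp: A_def)
    then show ?thesis using True q(2) by (simp add: D_def ker_def \<delta>_def)
  qed (use \<alpha> one_notin_A in \<open>auto simp: D_def ker_def \<delta>_def ang_self\<close>)
  also have "ker q x y - poly q 1 * \<delta> x y = (\<Sum>i\<le>s. ((if i < s then c i else 0) - poly q 1) * E i x y)" for x y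
  proof -
    have "(\<Sum>i\<le>s. ((if i < s then c i else 0) - poly q 1) * E i x y) =
        (\<Sum>i\<le>s. (if i < s then c i else 0) * E i x y) - poly q 1 * (\<Sum>i\<le>s. E i x y)"
      by (simp add: left_diff_distrib sum_subtractf sum_distrib_left)
    moreover have "(\<Sum>i\<le>s. (if i < s then c i else 0) * E i x y) = ker q x y"
      by (simp add: c lessThan_Suc_atMost[symmetric])
    ultimately show ?thesis by (simp only: sum_E)
  qed
  finally show ?thesis by (intro exI[of _ "\<lambda>i. (if i < s then c i else 0) - poly q 1"] ext)
qed

text \<open>The eigenvalue of \<open>D \<alpha>\<close> on \<open>E i\<close>. It is a choice of
  coefficients, since \<open>E s\<close> is known to be nonzero only after
  \<open>mult_nonzero\<close>.\<close>

definition \<theta> :: "real \<Rightarrow> nat \<Rightarrow> real" where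
  "\<theta> \<alpha> = (SOME \<theta>. D \<alpha> = (\<lambda>x y. \<Sum>i\<le>s. \<theta> i * E i x y))"

lemma D_eq: "\<alpha> \<in> insert 1 A \<Longrightarrow> D \<alpha> = (\<lambda>x y. \<Sum>i\<le>s. \<theta> \<alpha> i * E i x y)"
  unfolding \<theta>_def by (rule someI_ex[OF D_expand])

lemma mm_combination_E:
  assumes "j \<le> s"
  shows "mm (\<lambda>x y. \<Sum>i\<le>s. c i * E i x y) (E j) = (\<lambda>x y. c j * E j x y)"
  unfolding mm_sum_left
proof (intro ext)
  fix x y
  have "(\<Sum>i\<le>s. c i * mm (E i) (E j) x y) = (\<Sum>i\<le>s. if i = j then c j * E j x y else 0)"
    using assms by (intro sum.cong) (auto simp: mm_E)
  then show "(\<Sum>i\<le>s. c i * mm (E i) (E j) x y) = c j * E j x y" using assms by simp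
qed

lemma mm_combinations:
  "mm (\<lambda>x y. \<Sum>i\<le>s. c i * E i x y) (\<lambda>x y. \<Sum>i\<le>s. d i * E i x y) = (\<lambda>x y. \<Sum>i\<le>s. (c i * d i) * E i x y)"
  unfolding mm_sum_right by (intro ext sum.cong) (simp_all add: mm_combination_E mult_ac)

lemma E_0: "x \<in> X \<Longrightarrow> y \<in> X \<Longrightarrow> E 0 x y = 1 / n"
  using s_e(3) by (simp add: E_def \<phi>_def zonal_poly_def sjacobi_norm_def)

text \<open>\<open>E 0\<close> is the all-one matrix divided by n, so its eigenvalue is the common
  row sum of \<open>D \<alpha>\<close>, the valency.\<close>

abbreviation k :: "real \<Rightarrow> real" where "k \<alpha> \<equiv> \<theta> \<alpha> 0"

lemma sum_D:
  assumes "\<alpha> \<in> insert 1 A" "x \<in> X"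
  shows "(\<Sum>z\<in>X. D \<alpha> x z) = k \<alpha>"
proof -
  have "mm (D \<alpha>) (E 0) x x = k \<alpha> * (1 / n)"
    using mm_combination_E[of 0 "\<theta> \<alpha>"] assms D_eq[of \<alpha>] by (simp add: E_0)
  moreover have "mm (D \<alpha>) (E 0) x x = (\<Sum>z\<in>X. D \<alpha> x z) * (1 / n)"
    using assms by (simp add: mm_def E_0 sum_divide_distrib)
  ultimately show ?thesis using n_pos by simp
qed

lemma k_card: "\<alpha> \<in> insert 1 A \<Longrightarrow> x \<in> X \<Longrightarrow> k \<alpha> = real (card {z \<in> X. ang x z = \<alpha>})"
  using sum_D[of \<alpha> x] finX by (simp add: D_def sum.If_cases Int_def)

lemma k_pos:
  assumes "\<alpha> \<in> insert 1 A"
  shows "k \<alpha> > 0"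
proof -
  obtain x y where xy: "x \<in> X" "y \<in> X" "ang x y = \<alpha>"
    using assms X_nonempty ang_self by (auto simp: A_def)
  then have "{z \<in> X. ang x z = \<alpha>} \<noteq> {}" by blast
  then show ?thesis using k_card[OF assms xy(1)] finX by (simp add: card_gt_0_iff)
qed

text \<open>Two evaluations of the diagonal of \<open>D \<alpha>\<close> times \<open>E i\<close>;
  this is the relation between the two eigenmatrices of an association scheme.\<close>

lemma k_\<phi>:
  assumes "\<alpha> \<in> insert 1 A" "i \<le> s"
  shows "k \<alpha> * \<phi> i \<alpha> = \<theta> \<alpha> i * \<phi> i 1"
proof -
  obtain x where x: "x \<in> X" using X_nonempty by blast
  have "mm (D \<alpha>) (E i) x x = \<theta> \<alpha> i * \<phi> i 1"
    using mm_combination_E[OF assms(2), of "\<theta> \<alpha>"] D_eq[OF assms(1)] x by (simp add: E_def ang_self)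
  moreover have "mm (D \<alpha>) (E i) x x = (\<Sum>z\<in>X. D \<alpha> x z * \<phi> i \<alpha>)"
    unfolding mm_def using x by (intro sum.cong) (auto simp: D_def E_def ang_sym)
  ultimately show ?thesis using sum_D[OF assms(1) x] by (simp flip: sum_distrib_right)
qed

lemma sum_over_angles:
  assumes "x \<in> X"
  shows "(\<Sum>z\<in>X. f (ang x z)) = (\<Sum>\<alpha>\<in>insert 1 A. k \<alpha> * f \<alpha>)"
proof -
  have "(\<Sum>\<alpha>\<in>insert 1 A. k \<alpha> * f \<alpha>) = (\<Sum>\<alpha>\<in>insert 1 A. \<Sum>z\<in>X. D \<alpha> x z * f \<alpha>)"
    using assms by (intro sum.cong) (auto simp: sum_D simp flip: sum_distrib_right)
  also have "\<dots> = (\<Sum>z\<in>X. \<Sum>\<alpha>\<in>insert 1 A. D \<alpha> x z * f \<alpha>)" by (rule sum.swap)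
  also have "\<dots> = (\<Sum>z\<in>X. f (ang x z))"
  proof (intro sum.cong refl)
    fix z assume z: "z \<in> X"
    have "ang x z \<in> insert 1 A" using assms z ang_self by (cases "x = z") (auto simp: A_def)
    moreover have "(\<Sum>\<alpha>\<in>insert 1 A. D \<alpha> x z * f \<alpha>) = (\<Sum>\<alpha>\<in>insert 1 A. if \<alpha> = ang x z then f (ang x z) else 0)"
      using assms z by (intro sum.cong) (auto simp: D_def)
    ultimately show "(\<Sum>\<alpha>\<in>insert 1 A. D \<alpha> x z * f \<alpha>) = f (ang x z)" using finite_A by simp
  qed
  finally show ?thesis by simp
qed

lemma \<phi>_square_sum:
  assumes "i \<le> s"
  shows "(\<Sum>\<alpha>\<in>insert 1 A. k \<alpha> * (\<phi> i \<alpha>)\<^sup>2) = \<phi> i 1"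
proof -
  obtain x where x: "x \<in> X" using X_nonempty by blast
  have "(\<Sum>\<alpha>\<in>insert 1 A. k \<alpha> * (\<phi> i \<alpha>)\<^sup>2) = mm (E i) (E i) x x"
    unfolding sum_over_angles[OF x, symmetric] mm_def
    using x by (intro sum.cong) (auto simp: E_def ang_sym power2_eq_square)
  also have "\<dots> = \<phi> i 1" using assms x by (simp add: mm_E E_def ang_self)
  finally show ?thesis .
qed

definition h :: "nat \<Rightarrow> real" where
  "h i = (\<Sum>\<alpha>\<in>insert 1 A. (\<theta> \<alpha> i)\<^sup>2 / (n * k \<alpha>))"

text \<open>The matrix \<open>\<Sum> D\<^sub>\<alpha>\<^sup>2 / (n k\<^sub>\<alpha>)\<close> is rational, while its eigenvalues are the reciprocals of the
  multiplicities; it replaces a Galois argument.\<close>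

definition H :: "'p \<Rightarrow> 'p \<Rightarrow> real" where
  "H x y = (\<Sum>\<alpha>\<in>insert 1 A. mm (D \<alpha>) (D \<alpha>) x y / (n * k \<alpha>))"

lemma H_eq: "H = (\<lambda>x y. \<Sum>i\<le>s. h i * E i x y)"
proof (intro ext)
  fix x y
  have "H x y = (\<Sum>\<alpha>\<in>insert 1 A. \<Sum>i\<le>s. (\<theta> \<alpha> i)\<^sup>2 / (n * k \<alpha>) * E i x y)"
    unfolding H_def
    by (intro sum.cong refl) (simp add: D_eq mm_combinations power2_eq_square sum_divide_distrib)
  also have "\<dots> = (\<Sum>i\<le>s. \<Sum>\<alpha>\<in>insert 1 A. (\<theta> \<alpha> i)\<^sup>2 / (n * k \<alpha>) * E i x y)" by (rule sum.swap)
  finally show "H x y = (\<Sum>i\<le>s. h i * E i x y)" unfolding h_def sum_distrib_right .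
qed

definition mult :: "nat \<Rightarrow> real" where "mult i = n * \<phi> i 1"

text \<open>By \<open>k_\<phi>\<close> the left side becomes the diagonal of the square of
  \<open>E i\<close>, divided by n. In this quadratic form it also holds if \<open>E i\<close>
  vanishes.\<close>

lemma h_quadratic:
  assumes "i \<le> s"
  shows "(\<phi> i 1)\<^sup>2 * h i = \<phi> i 1 / n"
proof -
  have "(\<phi> i 1)\<^sup>2 * h i = (\<Sum>\<alpha>\<in>insert 1 A. k \<alpha> * (\<phi> i \<alpha>)\<^sup>2) / n"
    unfolding h_def sum_distrib_left sum_divide_distrib
  proof (intro sum.cong refl)
    fix \<alpha> assume \<alpha>: "\<alpha> \<in> insert 1 A"
    have "(\<phi> i 1)\<^sup>2 * (\<theta> \<alpha> i)\<^sup>2 = (k \<alpha> * \<phi> i \<alpha>)\<^sup>2"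
      unfolding k_\<phi>[OF \<alpha> assms] by (simp add: power_mult_distrib mult.commute)
    then have "(\<phi> i 1)\<^sup>2 * ((\<theta> \<alpha> i)\<^sup>2 / (n * k \<alpha>)) = (k \<alpha> * \<phi> i \<alpha>)\<^sup>2 / (n * k \<alpha>)"
      by simp
    also have "\<dots> = k \<alpha> * (\<phi> i \<alpha>)\<^sup>2 / n"
      using k_pos[OF \<alpha>] by (simp add: power2_eq_square)
    finally show "(\<phi> i 1)\<^sup>2 * ((\<theta> \<alpha> i)\<^sup>2 / (n * k \<alpha>)) = k \<alpha> * (\<phi> i \<alpha>)\<^sup>2 / n" .
  qed
  then show ?thesis using \<phi>_square_sum[OF assms] by simp
qed

text \<open>A row of \<open>D \<alpha>\<close> has squared length \<open>k \<alpha>\<close>, so each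
  of the s + 1 relations contributes 1/n to a diagonal entry.\<close>

lemma trace_H: "(\<Sum>i\<le>s. h i * mult i) = s + 1"
proof -
  obtain x where x: "x \<in> X" using X_nonempty by blast
  have "mm (D \<alpha>) (D \<alpha>) x x = k \<alpha>" if "\<alpha> \<in> insert 1 A" for \<alpha>
    unfolding sum_D[OF that x, symmetric] mm_def
    using x by (intro sum.cong) (auto simp: D_def ang_sym)
  then have "H x x = (\<Sum>\<alpha>\<in>insert 1 A. 1 / n)"
    unfolding H_def by (intro sum.cong) (use k_pos in force)+
  also have "\<dots> = (s + 1) / n"
    using finite_A one_notin_A by (simp add: s_def)
  finally have "n * H x x = s + 1" using n_pos by simp
  then show ?thesis
    using x by (simp add: H_eq mult_def E_def ang_self sum_distrib_left mult_ac)
qed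

text \<open>By \<open>h_quadratic\<close> each product \<open>h i * mult i\<close> is 0 or 1. The s
  + 1 products add up to s + 1, so none of them is 0.\<close>

lemma mult_nonzero: "i \<le> s \<Longrightarrow> mult i \<noteq> 0" and h_eq: "i \<le> s \<Longrightarrow> h i = 1 / mult i"
proof -
  have *: "h i * mult i = 1 \<or> h i * mult i = 0 \<and> mult i = 0" if "i \<le> s" for i
  proof (cases "\<phi> i 1 = 0")
    case False
    then show ?thesis using h_quadratic[OF that] n_pos
      by (simp add: mult_def power2_eq_square field_simps)
  qed (simp add: mult_def)
  have "(\<Sum>i\<le>s. 1 - h i * mult i) = 0"
    using trace_H by (simp add: sum_subtractf)
  then have **: "1 - h i * mult i = 0" if "i \<le> s" for i
    using that * by (subst (asm) sum_nonneg_eq_0_iff) force+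
  show "mult i \<noteq> 0" if "i \<le> s" using **[OF that] by auto
  then show "h i = 1 / mult i" if "i \<le> s" using **[OF that] that by (simp add: field_simps)
qed

section \<open>Multiplicities, in particular that of the complementary idempotent\<close>

lemma mult_less: "i < s \<Longrightarrow> mult i = harm_dim a b i"
  using n_pos by (simp add: mult_def \<phi>_def zonal_poly_eval_1)

lemma mult_s: "mult s = n - (\<Sum>i<s. harm_dim a b i)"
  using n_pos by (simp add: mult_def \<phi>_def zonal_poly_eval_1 right_diff_distrib flip: sum_divide_distrib)

text \<open>A kernel is a combination of the \<open>D \<alpha>\<close>, hence of the
  \<open>E i\<close>. Annihilating the nonzero \<open>E i\<close> forces the i-th coefficient to be
  0.\<close>

lemma ker_eq_scaled_E_s:
  assumes "\<And>i. i < s \<Longrightarrow> mm (ker p) (E i) = (\<lambda>_ _. 0)"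
  shows "\<exists>c. ker p = (\<lambda>x y. c * E s x y)"
proof -
  define w where "w i = (\<Sum>\<alpha>\<in>insert 1 A. poly p \<alpha> * \<theta> \<alpha> i)" for i
  have kp: "ker p = (\<lambda>x y. \<Sum>i\<le>s. w i * E i x y)"
  proof (intro ext)
    fix x y
    have "ker p x y = (\<Sum>\<alpha>\<in>insert 1 A. poly p \<alpha> * D \<alpha> x y)"
    proof (cases "x \<in> X \<and> y \<in> X")
      case True
      have "ang x y \<in> insert 1 A" using True ang_self by (cases "x = y") (auto simp: A_def)
      moreover have "(\<Sum>\<alpha>\<in>insert 1 A. poly p \<alpha> * D \<alpha> x y) = (\<Sum>\<alpha>\<in>insert 1 A. if \<alpha> = ang x y then poly p (ang x y) else 0)"
        using True by (intro sum.cong) (auto simp: D_def)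
      ultimately show ?thesis using True finite_A by (simp add: ker_def)
    qed (auto simp: ker_def D_def)
    also have "\<dots> = (\<Sum>\<alpha>\<in>insert 1 A. \<Sum>i\<le>s. poly p \<alpha> * \<theta> \<alpha> i * E i x y)"
      by (intro sum.cong refl) (simp add: D_eq sum_distrib_left mult.assoc)
    also have "\<dots> = (\<Sum>i\<le>s. \<Sum>\<alpha>\<in>insert 1 A. poly p \<alpha> * \<theta> \<alpha> i * E i x y)" by (rule sum.swap)
    finally show "ker p x y = (\<Sum>i\<le>s. w i * E i x y)" unfolding w_def sum_distrib_right .
  qed
  obtain x where x: "x \<in> X" using X_nonempty by blast
  have w0: "w i = 0" if "i < s" for i
  proof -
    have "(\<lambda>x y. w i * E i x y) = (\<lambda>_ _. 0)"
      using mm_combination_E[of i w] assms[OF that] that by (simp add: kp)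
    then have "w i * E i x x = 0" by meson
    then show ?thesis using x mult_nonzero[of i] that by (auto simp: E_def ang_self mult_def)
  qed
  have "ker p = (\<lambda>x y. w s * E s x y)"
    unfolding kp by (simp add: w0 lessThan_Suc_atMost[symmetric])
  then show ?thesis by blast
qed

text \<open>Here t = 2 s, so the s-th zonal kernel is orthogonal to the earlier ones and still
  satisfies its own idempotent relation; hence it is n times \<open>E s\<close>.\<close>

lemma mult_s_even:
  assumes "e = s"
  shows "mult s = harm_dim a b s"
proof -
  have t: "t = 2 * s" using tight assms by simp
  have "mm (ker (zonal_poly a b s)) (E i) = (\<lambda>_ _. 0)" if "i < s" for i
    unfolding E_less[OF that] mm_scale_right using that mm_zonal_poly[of s i] t by simp
  then obtain c where c: "ker (zonal_poly a b s) = (\<lambda>x y. c * E s x y)" using ker_eq_scaled_E_s by blast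
  obtain x where x: "x \<in> X" using X_nonempty by blast
  have d: "harm_dim a b s = c * \<phi> s 1"
    using fun_cong[OF fun_cong[OF c, of x], of x] x by (simp add: ker_self zonal_poly_eval_1 E_def ang_self)
  then have nz: "c \<noteq> 0" "\<phi> s 1 \<noteq> 0" using harm_dim_pos[OF ab b, of s] by auto
  have "mm (ker (zonal_poly a b s)) (ker (zonal_poly a b s)) x x = n * ker (zonal_poly a b s) x x"
    using mm_zonal_poly[of s s] t by simp
  then have "c * (c * \<phi> s 1) = n * (c * \<phi> s 1)"
    unfolding c mm_scale_left mm_scale_right using x by (simp add: mm_E E_def ang_self)
  then have "c = n" using nz by simp
  with d show ?thesis by (simp add: mult_def)
qed

text \<open>Here t = 2 s - 1: orthogonality to the earlier kernels survives, but the idempotent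
  relation that would fix the scale does not. The scale is read off at a pair with angle 0, where
  the Jacobi polynomial is 1 and \<open>E s\<close> is known as a complement.\<close>

lemma mult_s_odd:
  assumes "s = e + 1"
  shows "mult s = pochhammer a e * pochhammer (a - b) s / (fact e * pochhammer b s)"
proof -
  let ?p = "sjacobi a b s"
  have t: "t + 1 = 2 * s" using tight assms by simp
  have "mm (ker ?p) (E i) = (\<lambda>_ _. 0)" if "i < s" for i
    unfolding E_less[OF that] mm_scale_right
    using that mm_sjacobi_lower[of "zonal_poly a b i" s] t by (simp add: degree_zonal_poly[OF ab b])
  then obtain c where c: "ker ?p = (\<lambda>x y. c * E s x y)" using ker_eq_scaled_E_s by blast
  have "0 \<in> A" using assms s_e(5) by simp
  then obtain x y where xy: "x \<in> X" "y \<in> X" "ang x y = 0" by (auto simp: A_def)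
  have "poly ?p 1 = c * \<phi> s 1"
    using fun_cong[OF fun_cong[OF c, of x], of x] xy by (simp add: ker_self E_def ang_self)
  moreover have 1: "1 = c * \<phi> s 0"
    using fun_cong[OF fun_cong[OF c, of x], of y] xy by (simp add: ker_def E_def)
  ultimately have "poly ?p 1 * \<phi> s 0 = \<phi> s 1" by (metis mult.commute mult.left_commute mult_1)
  moreover have "\<phi> s 0 = - ((-1) ^ e * pochhammer a e / fact e) / n"
  proof -
    have "\<phi> s 0 = - (\<Sum>i<s. poly (zonal_poly a b i) 0) / n"
      by (simp add: \<phi>_def sum_divide_distrib sum_negf)
    moreover have "(\<Sum>i<s. poly (zonal_poly a b i) 0) = (-1) ^ e * pochhammer a e / fact e"
      using zonal_poly_eval_0_sum[OF ab b, of e] by (simp only: assms Suc_eq_plus1)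
    ultimately show ?thesis by (simp only:)
  qed
  ultimately have "mult s = - poly ?p 1 * ((-1) ^ e * pochhammer a e / fact e)"
    using n_pos by (simp add: mult_def flip: \<open>poly ?p 1 * \<phi> s 0 = \<phi> s 1\<close>)
  then show ?thesis
    unfolding poly_sjacobi_1[OF ab b] using assms by (cases "even e") (simp_all add: mult_ac)
qed

section \<open>Rationality by spectral projection\<close>

lemma Rats_pochhammer: "x \<in> \<rat> \<Longrightarrow> pochhammer x i \<in> \<rat>" for x :: real
  by (induction i) (auto simp: pochhammer_Suc)

lemma Rats_fact: "(fact i :: real) \<in> \<rat>"
  by (metis Rats_of_nat of_nat_fact)

lemma harm_dim_Rats: "a \<in> \<rat> \<Longrightarrow> b \<in> \<rat> \<Longrightarrow> harm_dim a b i \<in> \<rat>"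
  by (cases i) (auto simp: harm_dim_eq[OF ab b] simp del: fact_Suc of_nat_Suc pochhammer_Suc
      intro!: Rats_divide Rats_mult Rats_add Rats_pochhammer Rats_fact)

lemma mult_Rats: "a \<in> \<rat> \<Longrightarrow> b \<in> \<rat> \<Longrightarrow> i \<le> s \<Longrightarrow> mult i \<in> \<rat>"
  by (cases "i = s") (auto simp: mult_less mult_s harm_dim_Rats intro!: Rats_diff Rats_sum)

lemma mm_Rats: "(\<And>x y. f x y \<in> \<rat>) \<Longrightarrow> (\<And>x y. f' x y \<in> \<rat>) \<Longrightarrow> mm f f' x y \<in> \<rat>"
  by (auto simp: mm_def intro!: Rats_sum)

lemma H_Rats: "H x y \<in> \<rat>"
  unfolding H_def
proof (intro Rats_sum Rats_divide mm_Rats Rats_mult)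
  obtain x where x: "x \<in> X" using X_nonempty by blast
  fix \<alpha> assume "\<alpha> \<in> insert 1 A"
  then show "k \<alpha> \<in> \<rat>" using k_card[of \<alpha> x] x by simp
qed (auto simp: D_def)

text \<open>The product of the matrices H - h j over all j other than 1 is c times
  \<open>E 1\<close>; distinctness of the multiplicities is what makes c nonzero. The induction
  admits any set of factors.\<close>

lemma E_1_Rats:
  assumes "a \<in> \<rat>" "b \<in> \<rat>" "1 < s" and distinct: "\<And>i. i \<le> s \<Longrightarrow> i \<noteq> 1 \<Longrightarrow> mult i \<noteq> mult 1"
  shows "E 1 x y \<in> \<rat>"
proof -
  have hR: "h i \<in> \<rat>" if "i \<le> s" for i
    using that mult_Rats assms by (simp add: h_eq)
  have R: "(\<Sum>i\<le>s. (\<Prod>j\<in>J. h i - h j) * E i x y) \<in> \<rat>" if "finite J" "J \<subseteq> {..s}" for J x y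
    using that
  proof (induction J arbitrary: x y rule: finite_induct)
    case empty
    then show ?case by (simp add: sum_E \<delta>_def)
  next
    case (insert l J)
    let ?f = "\<lambda>x y. \<Sum>i\<le>s. (\<Prod>j\<in>J. h i - h j) * E i x y"
    have "mm H ?f x y - h l * ?f x y = (\<Sum>i\<le>s. (\<Prod>j\<in>insert l J. h i - h j) * E i x y)"
      unfolding H_eq mm_combinations
      using insert.hyps by (simp add: sum_distrib_left algebra_simps flip: sum_subtractf)
    moreover have "mm H ?f x y - h l * ?f x y \<in> \<rat>"
      using insert by (intro Rats_diff Rats_mult mm_Rats H_Rats hR) auto
    ultimately show ?case by simp
  qed
  let ?J = "{..s} - {1}"
  define c where "c = (\<Prod>j\<in>?J. h 1 - h j)"
  have "(\<Sum>i\<le>s. (\<Prod>j\<in>?J. h i - h j) * E i x y) = (\<Sum>i\<le>s. if i = 1 then c * E 1 x y else 0)"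
    by (intro sum.cong refl) (auto simp: c_def intro!: prod_zero)
  also have "\<dots> = c * E 1 x y" using assms(3) by simp
  finally have "c * E 1 x y \<in> \<rat>" using R[of ?J x y] by auto
  moreover have "c \<in> \<rat>" unfolding c_def using assms(3) by (intro Rats_prod Rats_diff hR) auto
  moreover have "c \<noteq> 0"
    unfolding c_def using distinct mult_nonzero assms(3) by (auto simp: h_eq divide_simps)
  ultimately have "c * E 1 x y / c \<in> \<rat>" by (intro Rats_divide)
  with \<open>c \<noteq> 0\<close> show ?thesis by simp
qed

theorem angles_rational:
  assumes "a \<in> \<rat>" "b \<in> \<rat>" "1 < s" "\<And>i. i \<le> s \<Longrightarrow> i \<noteq> 1 \<Longrightarrow> mult i \<noteq> mult 1"
  shows "A \<subseteq> \<rat>"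
proof
  fix \<alpha> assume "\<alpha> \<in> A"
  then obtain x y where xy: "x \<in> X" "y \<in> X" "ang x y = \<alpha>" by (auto simp: A_def)
  define c where "c = poly (sjacobi a b 1) 1 / sjacobi_norm a b 1"
  have p: "poly (sjacobi a b 1) z = 1 - a / b * z" for z
    by (simp add: sjacobi_def poly_monom)
  have c: "c * (1 - a / b) = harm_dim a b 1"
    using zonal_poly_eval_1[of a b 1] unfolding zonal_poly_def poly_smult c_def[symmetric] by (simp only: p mult_1_right)
  have ne: "1 - a / b \<noteq> 0" "c \<noteq> 0" using ab b harm_dim_pos[OF ab b, of 1] c by auto
  have "c * (1 - a / b) / (1 - a / b) \<in> \<rat>"
    unfolding c using assms by (intro Rats_divide Rats_diff harm_dim_Rats) auto
  then have cR: "c \<in> \<rat>"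
    by (simp only: nonzero_mult_div_cancel_right[OF ne(1)])
  have "E 1 x y = c * (1 - a / b * \<alpha>) / n"
    unfolding E_def \<phi>_def zonal_poly_def poly_smult c_def p using xy assms(3) by simp
  then have "\<alpha> = b / a * (1 - E 1 x y * n / c)"
    using ne ab b n_pos by (simp add: field_simps)
  also have "\<dots> \<in> \<rat>"
    using assms cR E_1_Rats[OF assms] by (intro Rats_mult Rats_divide Rats_diff) auto
  finally show "\<alpha> \<in> \<rat>" .
qed

text \<open>Let f have the nonzero angles as simple roots, let w be x if 0 is an angle and 1
  otherwise, and let deg q < e. Then (1 - x) w f q vanishes at 1 and at every angle, and its degree
  is at most 1 + (s - e) + e + (e - 1) = t; so its moment is 0. Thus f is orthogonal to lower
  degrees for the weight multiplied by (1 - x) w, which accounts for the shifted parameters.\<close>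

lemma angle_polynomial:
  assumes "\<alpha> \<in> A - {0}"
  shows "poly (sjacobi (a + 1 + (s - e)) (b + (s - e)) e) \<alpha> = 0"
proof -
  define a' b' where "a' = a + 1 + real (s - e)" and "b' = b + real (s - e)"
  have ab': "a' > b'" "b' > 0" using ab b by (auto simp: a'_def b'_def)
  define f where "f = (\<Prod>\<alpha>\<in>A - {0}. [:- \<alpha>, 1:])"
  have df: "degree f = e"
    unfolding f_def e_def by (subst degree_prod_eq_sum_degree) auto
  have f0: "f \<noteq> 0" unfolding f_def using finite_A by simp
  have orth: "moment a' b' (f * q) = 0" if "degree q < e" for q
  proof -
    define w :: "real poly" where "w = (if s = e then 1 else [:0, 1:])"
    define P where "P = [:1, -1:] * (w * (f * q))"
    have "degree P \<le> 1 + (degree w + (degree f + degree q))"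
      unfolding P_def by (intro order_trans[OF degree_mult_le] add_mono degree_mult_le order_refl) auto
    also have "\<dots> \<le> t" using that tight s_e df by (auto simp: w_def)
    finally have dP: "degree P \<le> t" .
    obtain x where x: "x \<in> X" using X_nonempty by blast
    have "ker P x z = 0" if z: "z \<in> X" for z
    proof (cases "x = z")
      case True
      then show ?thesis using x by (simp add: ker_self P_def)
    next
      case False
      then have "ang x z \<in> A" using x z by (auto simp: A_def)
      then have "poly f (ang x z) = 0 \<or> poly w (ang x z) = 0"
        using finite_A s_e unfolding f_def w_def poly_prod by (cases "ang x z = 0") auto
      then show ?thesis by (auto simp: ker_def P_def)
    qed
    then have "n * moment a b P = 0" using sum_ker[OF x dP] by simp
    then have "moment a b P = 0" using n_pos by simp
    then have "moment (a + 1) b (w * (f * q)) = 0"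
      unfolding P_def using ab b by (subst (asm) moment_mult_one_minus_X) auto
    moreover have "s = e \<or> s = Suc e" using s_e by linarith
    ultimately show ?thesis
      using ab b unfolding w_def a'_def b'_def
      by (auto simp: moment_mult_X add_ac simp del: mult_pCons_left)
  qed
  have "\<exists>c. f = (\<Sum>i<Suc e. smult (c i) (sjacobi a' b' i))"
  proof (rule expand_in_graded_basis)
    show "degree (sjacobi a' b' i) = i" for i by (rule degree_sjacobi[OF ab'])
    show "sjacobi a' b' i \<noteq> 0" for i using poly_sjacobi_1_nonzero[OF ab', of i] by auto
    show "coeff f i = 0" if "Suc e \<le> i" for i using that df by (simp add: coeff_eq_0)
  qed
  then obtain c where c: "f = (\<Sum>i<Suc e. smult (c i) (sjacobi a' b' i))" by blast
  have "c j = 0" if j: "j < e" for j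
  proof -
    have "moment a' b' (f * sjacobi a' b' j) = (\<Sum>i<Suc e. c i * moment a' b' (sjacobi a' b' i * sjacobi a' b' j))"
      by (subst c) (simp only: sum_distrib_right moment_sum mult_smult_left moment_smult)
    also have "\<dots> = (\<Sum>i<Suc e. if i = j then c j * sjacobi_norm a' b' j else 0)"
    proof (intro sum.cong refl)
      fix i
      consider "i = j" | "i < j" | "j < i" by linarith
      then show "c i * moment a' b' (sjacobi a' b' i * sjacobi a' b' j) = (if i = j then c j * sjacobi_norm a' b' j else 0)"
      proof cases
        case 2
        then show ?thesis
          using moment_sjacobi_orthogonal[OF ab', of "sjacobi a' b' i" j] degree_sjacobi[OF ab'] by (simp add: mult.commute)
      next
        case 3
        then show ?thesis
          using moment_sjacobi_orthogonal[OF ab', of "sjacobi a' b' j" i] degree_sjacobi[OF ab'] by simp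
      qed (simp add: sjacobi_norm_def)
    qed
    also have "\<dots> = c j * sjacobi_norm a' b' j" using j by simp
    finally show ?thesis
      using orth[of "sjacobi a' b' j"] degree_sjacobi[OF ab'] j sjacobi_norm_pos[OF ab', of j] by simp
  qed
  then have fe: "f = smult (c e) (sjacobi a' b' e)" by (subst c) simp
  have "poly f \<alpha> = 0" unfolding f_def poly_prod using assms finite_A by auto
  with fe f0 show ?thesis unfolding a'_def b'_def by auto
qed

end

section \<open>Projective designs\<close>

lemma Beta_shift:
  fixes x y :: real
  assumes "x > 0" "y > 0"
  shows "Beta (x + k) y = Beta x y * (pochhammer x k / pochhammer (x + y) k)"
proof (induction k)
  case (Suc k)
  have "(x + k + y) * Beta (x + k + 1) y = (x + k) * Beta (x + k) y"
    using assms by (intro Beta_plus1_left) (auto elim!: nonpos_Ints_cases)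
  moreover have "x + k + y > 0" using assms by simp
  ultimately have "Beta (x + Suc k) y = (x + k) / (x + k + y) * Beta (x + k) y"
    by (simp add: field_simps)
  then show ?case by (simp add: Suc.IH pochhammer_Suc mult_ac add_ac)
qed simp

lemma has_integral_moment:
  assumes ab: "a > b" and b: "b > 0"
  shows "((\<lambda>x. poly p x * (x powr (b - 1) * (1 - x) powr (a - b - 1))) has_integral (Beta b (a - b) * moment a b p)) {0..1}"
proof -
  have 1: "((\<lambda>x. x ^ k * (x powr (b - 1) * (1 - x) powr (a - b - 1))) has_integral
      Beta b (a - b) * (pochhammer b k / pochhammer a k)) {0..1}" for k
  proof -
    have "((\<lambda>x. x powr (b + k - 1) * (1 - x) powr (a - b - 1)) has_integral Beta (b + k) (a - b)) {0..1}"
      using ab b by (intro has_integral_Beta_real) auto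
    moreover have "Beta (b + k) (a - b) = Beta b (a - b) * (pochhammer b k / pochhammer a k)"
      using Beta_shift[of b "a - b" k] ab b by simp
    ultimately show ?thesis
    proof (rule_tac has_integral_spike_finite[of "{0}"])
      fix x :: real assume "x \<in> {0..1} - {0}"
      then show "x ^ k * (x powr (b - 1) * (1 - x) powr (a - b - 1)) = x powr (b + k - 1) * (1 - x) powr (a - b - 1)"
        by (simp add: powr_diff powr_add powr_realpow)
    qed auto
  qed
  have "((\<lambda>x. \<Sum>k\<le>degree p. coeff p k * (x ^ k * (x powr (b - 1) * (1 - x) powr (a - b - 1)))) has_integral
      (\<Sum>k\<le>degree p. coeff p k * (Beta b (a - b) * (pochhammer b k / pochhammer a k)))) {0..1}"
    by (intro has_integral_sum has_integral_mult_right 1) auto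
  then show ?thesis
    by (simp add: poly_altdef moment_def sum_distrib_left sum_distrib_right mult_ac)
qed

lemma has_integral_moment_affine:
  assumes \<alpha>: "\<alpha> > -1" and \<beta>: "\<beta> > -1" and moment: "moment (\<alpha> + \<beta> + 2) (\<beta> + 1) p = 0"
  shows "((\<lambda>\<tau>. poly p ((1 + \<tau>) / 2) * ((1 - \<tau>) powr \<alpha> * (1 + \<tau>) powr \<beta>)) has_integral 0) {-1..1}"
proof -
  have "((\<lambda>x. poly p x * (x powr \<beta> * (1 - x) powr \<alpha>)) has_integral 0) (cbox 0 1)"
    using has_integral_moment[of "\<beta> + 1" "\<alpha> + \<beta> + 2" p] assms by (simp add: add_ac)
  from has_integral_affinity[OF this, of "1/2" "1/2"]
  have "((\<lambda>x. poly p ((x + 1) / 2) * (((x + 1) / 2) powr \<beta> * (1 - (x + 1) / 2) powr \<alpha>)) has_integral 0)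
      ((\<lambda>x. 2 * x - 1) ` {0..1})"
    by (simp add: add_divide_distrib)
  also have "(\<lambda>x. 2 * x - 1) ` {0..1} = {-1..1 :: real}"
    using image_affinity_atLeastAtMost_diff[of 2 1 0 1] by simp
  finally have "((\<lambda>x. 2 powr (\<alpha> + \<beta>) * (poly p ((x + 1) / 2) * (((x + 1) / 2) powr \<beta> * (1 - (x + 1) / 2) powr \<alpha>)))
      has_integral 2 powr (\<alpha> + \<beta>) * 0) {-1..1}"
    by (rule has_integral_mult_right)
  then have "((\<lambda>x. 2 powr (\<alpha> + \<beta>) * (poly p ((x + 1) / 2) * (((x + 1) / 2) powr \<beta> * (1 - (x + 1) / 2) powr \<alpha>)))
      has_integral 0) {-1..1}" by simp
  then show ?thesis
  proof (rule has_integral_eq[rotated])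
    fix x :: real assume x: "x \<in> {-1..1}"
    have "((x + 1) / 2) powr \<beta> = (1 + x) powr \<beta> / 2 powr \<beta>"
      using x by (simp add: powr_divide add.commute)
    moreover have "1 - (x + 1) / 2 = (1 - x) / 2" by (simp add: field_simps)
    moreover have "((1 - x) / 2) powr \<alpha> = (1 - x) powr \<alpha> / 2 powr \<alpha>"
      using x by (simp add: powr_divide)
    ultimately show "2 powr (\<alpha> + \<beta>) * (poly p ((x + 1) / 2) * (((x + 1) / 2) powr \<beta> * (1 - (x + 1) / 2) powr \<alpha>)) =
        poly p ((1 + x) / 2) * ((1 - x) powr \<alpha> * (1 + x) powr \<beta>)"
      by (simp only: powr_add) (simp add: add.commute)
  qed
qed

text \<open>By uniqueness of the Jacobi polynomial it suffices to check the defining integrals,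
  which are moments after the substitution x = (1 + \<tau>) / 2.\<close>

lemma jacobi_poly_eq_sjacobi:
  assumes \<alpha>: "\<alpha> > -1" and \<beta>: "\<beta> > -1"
  shows "\<exists>c. c \<noteq> 0 \<and> (\<forall>\<xi>. poly (jacobi_poly \<alpha> \<beta> i) (2 * \<xi> - 1) = c * poly (sjacobi (\<alpha> + \<beta> + 2) (\<beta> + 1) i) \<xi>)"
proof -
  define a b where "a = \<alpha> + \<beta> + 2" and "b = \<beta> + 1"
  have ab: "a > b" "b > 0" using assms by (auto simp: a_def b_def)
  define c where "c = pochhammer (\<alpha> + 1) i / fact i / poly (sjacobi a b i) 1"
  have p1: "poly (sjacobi a b i) 1 \<noteq> 0" by (rule poly_sjacobi_1_nonzero[OF ab])
  have c: "c \<noteq> 0" using p1 pochhammer_pos[of "\<alpha> + 1" i] \<alpha> by (simp add: c_def)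
  let ?P = "smult c (pcompose (sjacobi a b i) [:1/2, 1/2:])"
  have eval: "poly ?P \<tau> = c * poly (sjacobi a b i) ((1 + \<tau>) / 2)" for \<tau>
    by (simp add: poly_pcompose add_divide_distrib)
  have "is_jacobi_poly \<alpha> \<beta> i ?P"
    unfolding is_jacobi_poly_def
  proof (intro conjI allI impI)
    show "degree ?P = i" using c by (simp add: degree_pcompose degree_sjacobi[OF ab])
    show "poly ?P 1 = pochhammer (\<alpha> + 1) i / fact i" using p1 unfolding eval by (simp add: c_def)
    fix q :: "real poly" assume q: "degree q < i"
    define r where "r = smult c (sjacobi a b i * pcompose q [:-1, 2:])"
    have "moment a b (sjacobi a b i * pcompose q [:-1, 2:]) = 0"
      by (rule moment_sjacobi_orthogonal[OF ab]) (use q in \<open>simp add: degree_pcompose\<close>)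
    then have "moment a b r = 0" by (simp add: r_def moment_smult)
    then have "((\<lambda>\<tau>. poly r ((1 + \<tau>) / 2) * ((1 - \<tau>) powr \<alpha> * (1 + \<tau>) powr \<beta>)) has_integral 0) {-1..1}"
      using has_integral_moment_affine[OF assms] by (simp add: a_def b_def)
    moreover have "poly r ((1 + \<tau>) / 2) = poly ?P \<tau> * poly q \<tau>" for \<tau>
    proof -
      have arg: "poly [:-1, 2:] ((1 + \<tau>) / 2) = \<tau>" by (simp add: field_simps)
      show ?thesis
        unfolding eval by (simp only: r_def poly_smult poly_mult poly_pcompose arg mult.assoc)
    qed
    ultimately show "((\<lambda>\<tau>. poly ?P \<tau> * poly q \<tau> * ((1 - \<tau>) powr \<alpha> * (1 + \<tau>) powr \<beta>)) has_integral 0) {-1..1}"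
      by simp
  qed
  then have "jacobi_poly \<alpha> \<beta> i = ?P"
    using ex1_is_jacobi_poly[OF assms] is_jacobi_poly_jacobi_poly[OF assms] by blast
  then have "poly (jacobi_poly \<alpha> \<beta> i) (2 * \<xi> - 1) = c * poly (sjacobi a b i) \<xi>" for \<xi>
    using eval[of "2 * \<xi> - 1"] by simp
  with c show ?thesis unfolding a_def b_def by blast
qed

text \<open>In the Jacobi expansion of x^k, both the sum over X and the moment functional retain
  just the constant component.\<close>

lemma moments_from_sjacobi:
  assumes ab: "a > b" and b: "b > 0" and "finite X" and "k \<le> t"
    and zero: "\<And>i. 1 \<le> i \<Longrightarrow> i \<le> t \<Longrightarrow> (\<Sum>x\<in>X. poly (sjacobi a b i) (f x)) = 0"
  shows "(\<Sum>x\<in>X. f x ^ k) = real (card X) * (pochhammer b k / pochhammer a k)"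
proof -
  have "\<exists>c. monom 1 k = (\<Sum>i<Suc k. smult (c i) (sjacobi a b i))"
  proof (rule expand_in_graded_basis)
    show "degree (sjacobi a b i) = i" for i by (rule degree_sjacobi[OF ab b])
    show "sjacobi a b i \<noteq> 0" for i using poly_sjacobi_1_nonzero[OF ab b, of i] by auto
  qed simp
  then obtain c where c: "monom 1 k = (\<Sum>i<Suc k. smult (c i) (sjacobi a b i))" by blast
  have "(\<Sum>x\<in>X. f x ^ k) = (\<Sum>x\<in>X. poly (monom 1 k) (f x))" by (simp add: poly_monom)
  also have "\<dots> = (\<Sum>x\<in>X. \<Sum>i<Suc k. c i * poly (sjacobi a b i) (f x))"
    unfolding c by (simp only: poly_sum poly_smult)
  also have "\<dots> = (\<Sum>i<Suc k. c i * (\<Sum>x\<in>X. poly (sjacobi a b i) (f x)))"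
    unfolding sum_distrib_left by (rule sum.swap)
  also have "\<dots> = (\<Sum>i<Suc k. if i = 0 then c 0 * real (card X) else 0)"
    using zero \<open>k \<le> t\<close> by (intro sum.cong) auto
  finally have 1: "(\<Sum>x\<in>X. f x ^ k) = c 0 * real (card X)" by simp
  have "pochhammer b k / pochhammer a k = moment a b (monom 1 k)" by (simp add: moment_monom)
  also have "\<dots> = (\<Sum>i<Suc k. c i * moment a b (sjacobi a b i * 1))"
    unfolding c by (simp only: moment_sum moment_smult mult_1_right)
  also have "\<dots> = (\<Sum>i<Suc k. if i = 0 then c 0 else 0)"
  proof (intro sum.cong refl)
    fix i
    show "c i * moment a b (sjacobi a b i * 1) = (if i = 0 then c 0 else 0)"
      using moment_sjacobi_orthogonal[OF ab b, of 1 i] by (cases "i = 0") auto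
  qed
  finally have "pochhammer b k / pochhammer a k = c 0" by simp
  with 1 show ?thesis by simp
qed

lemma unit_rep: "rep_proj_space x \<bullet> rep_proj_space x = 1"
  using Quotient3_rep_reflp[OF Quotient3_proj_space, of x] by (simp add: proj_rel_def unit_vec_iff)

lemma angle_rep: "angle x y = (norm (herm (rep_proj_space x) (rep_proj_space y)))\<^sup>2"
  by (metis (no_types, lifting) Quotient3_proj_space Quotient3_abs_rep Quotient3_rep_reflp angle.abs_eq)

lemma angle_commute: "angle x y = angle y x"
  by (simp add: angle_rep norm_herm_commute)

lemma angle_self: "angle x x = 1"
  by (simp add: angle_rep herm_self unit_rep)

lemma angle_nonneg: "angle x y \<ge> 0"
  by (simp add: angle_rep)

text \<open>The equality case of Cauchy-Schwarz: for unit vectors a and b with c = a^* b, the vector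
  b - a c has squared length 1 - |c|^2. If this is not positive, it is 0 and b is a unit multiple of
  a.\<close>

lemma angle_less_1:
  assumes "x \<noteq> y"
  shows "angle x y < 1"
proof (rule ccontr)
  let ?a = "rep_proj_space x" and ?b = "rep_proj_space y"
  let ?c = "herm ?a ?b" and ?v = "?b - rscale ?a (herm ?a ?b)"
  assume "\<not> angle x y < 1"
  then have ge: "?c \<bullet> ?c \<ge> 1" by (simp add: angle_rep power2_norm_eq_inner)
  have "?v \<bullet> ?v = ?b \<bullet> ?b - 2 * (rscale ?a ?c \<bullet> ?b) + rscale ?a ?c \<bullet> rscale ?a ?c"
    by (simp add: inner_diff_left inner_diff_right inner_commute)
  also have "\<dots> = 1 - ?c \<bullet> ?c"
    by (simp only: inner_rscale_self) (simp add: inner_rscale unit_rep)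
  finally have v: "?v \<bullet> ?v = 1 - ?c \<bullet> ?c" .
  with ge have eq: "?v \<bullet> ?v = 0" using inner_ge_zero[of ?v] by linarith
  then have "?b = rscale ?a ?c" by simp
  moreover have "norm ?c = 1" using v eq by (simp add: norm_eq_1)
  ultimately have "proj_rel ?a ?b"
    unfolding proj_rel_def by (auto simp: unit_vec_iff unit_rep)
  then have "x = y"
    using Quotient3_rel_rep[OF Quotient3_proj_space] by blast
  with assms show False by simp
qed

lemma tight_scheme_of_tight_design:
  fixes X :: "('a :: conj_div_algebra, 'n :: finite) proj_space set"
  assumes td: "tight_design t X" and n: "CARD('n) = n + 1" "n \<ge> 1"
  defines "b \<equiv> real DIM('a) / 2"
  defines "a \<equiv> b * real (n + 1)"
  shows "tight_scheme X angle a b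
    (\<lambda>i j. smult (real (card X) * (pochhammer b (i + j) / pochhammer a (i + j))) (conv_poly DIM('a) i j))
    (angle_set X) t (card (angle_set X)) (card (angle_set X - {0}))"
proof -
  have b: "b > 0" by (simp add: b_def)
  have ab: "a > b" using b n by (simp add: a_def)
  have a2: "real DIM('a ^ 'n) / 2 = a" by (simp add: a_def b_def n field_simps)
  have pd: "t \<ge> 1" "finite X" "X \<noteq> {}"
    "\<And>y i. y \<in> X \<Longrightarrow> i \<in> {1..t} \<Longrightarrow> (\<Sum>x\<in>X. proj_jacobi TYPE(('a, 'n) proj_space) i (angle x y)) = 0"
    and t: "t = card (angle_set X) + card (angle_set X - {0})"
    using td by (auto simp: tight_design_def projective_design_def)
  have jac: "(\<Sum>x\<in>X. poly (sjacobi a b i) (angle x y)) = 0" if "y \<in> X" "1 \<le> i" "i \<le> t" for y i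
  proof -
    obtain c where c: "c \<noteq> 0" "\<And>\<xi>. poly (jacobi_poly (a - b - 1) (b - 1) i) (2 * \<xi> - 1) = c * poly (sjacobi a b i) \<xi>"
      using jacobi_poly_eq_sjacobi[of "a - b - 1" "b - 1" i] ab b by auto
    have "proj_jacobi TYPE(('a, 'n) proj_space) i \<xi> = c * poly (sjacobi a b i) \<xi>" for \<xi>
      using c(2)[of \<xi>] unfolding proj_jacobi_def half_dim_def Let_def n a_def b_def by simp
    then have "c * (\<Sum>x\<in>X. poly (sjacobi a b i) (angle x y)) = 0"
      using pd(4)[of y i] that by (simp add: sum_distrib_left)
    with c(1) show ?thesis by simp
  qed
  have mo: "(\<Sum>x\<in>X. angle x y ^ k) = real (card X) * (pochhammer b k / pochhammer a k)" if "y \<in> X" "k \<le> t" for y k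
    using that jac by (intro moments_from_sjacobi[OF ab b pd(2) that(2)]) auto
  show ?thesis
  proof
    show "angle x y < 1" if "x \<noteq> y" for x y :: "('a, 'n) proj_space" using that by (rule angle_less_1)
    show "(\<Sum>z\<in>X. angle x z ^ k) = real (card X) * (pochhammer b k / pochhammer a k)" if "x \<in> X" "k \<le> t" for x k
      using mo[OF that] by (simp add: angle_commute)
    show "degree (smult (real (card X) * (pochhammer b (i + j) / pochhammer a (i + j))) (conv_poly DIM('a) i j)) \<le> min i j" for i j
      using degree_conv_poly degree_smult_le order_trans by blast
    fix x y i j assume xy: "x \<in> X" "y \<in> X" "i + j \<le> t"
    have "(\<Sum>z\<in>X. ((norm (herm (rep_proj_space z) (rep_proj_space x)))\<^sup>2) ^ i * ((norm (herm (rep_proj_space z) (rep_proj_space y)))\<^sup>2) ^ j) =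
      real (card X) * (pochhammer (real DIM('a) / 2) (i + j) / pochhammer (real DIM('a ^ 'n) / 2) (i + j)) *
      poly (conv_poly DIM('a) i j) ((norm (herm (rep_proj_space x) (rep_proj_space y)))\<^sup>2)"
    proof (rule projective_convolution[OF pd(2) unit_rep _ xy(1,2)])
      fix y assume "y \<in> X"
      then show "(\<Sum>x\<in>X. norm (herm (rep_proj_space x) (rep_proj_space y)) ^ (2 * (i + j))) =
         real (card X) * (pochhammer (real DIM('a) / 2) (i + j) / pochhammer (real DIM('a ^ 'n) / 2) (i + j))"
        using mo[of y "i + j"] xy(3) unfolding a2 b_def[symmetric] angle_rep power_mult by simp
    qed
    then show "(\<Sum>z\<in>X. angle x z ^ i * angle z y ^ j) =
        poly (smult (real (card X) * (pochhammer b (i + j) / pochhammer a (i + j))) (conv_poly DIM('a) i j)) (angle x y)"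
      unfolding a2 b_def[symmetric] angle_rep[symmetric] by (simp add: angle_commute[of x])
  qed (use ab b pd t in \<open>auto simp: angle_self angle_commute angle_set_def\<close>)
qed

section \<open>Multiplicities and exceptional cases\<close>

text \<open>Multiplication by (-1)^e makes this integer polynomial monic.\<close>

lemma algebraic_int_alternating:
  fixes x :: real and C :: "nat \<Rightarrow> nat"
  assumes "C e = 1" and "(\<Sum>k\<le>e. (-1)^k * real (C k) * x ^ k) = 0"
  shows "algebraic_int x"
proof
  let ?q = "\<Sum>k\<le>e. monom ((-1)^k * real (C k)) k"
  let ?p = "smult ((-1)^e) ?q"
  have cq: "coeff ?q i = (if i \<le> e then (-1)^i * real (C i) else 0)" for i
    by (simp add: coeff_sum)
  have dq: "degree ?q = e"
    by (rule antisym, rule degree_le, simp only: cq, simp, rule le_degree, simp only: cq, simp add: assms)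
  show "lead_coeff ?p = 1"
    using dq cq[of e] assms(1) by (simp flip: power_mult_distrib)
  show "\<forall>i. coeff ?p i \<in> \<int>" unfolding coeff_smult cq by auto
  show "poly ?p x = 0" using assms(2) by (simp add: poly_sum poly_monom)
qed

lemma pochhammer_Suc_fact: "pochhammer (real e + 1) k = fact (e + k) / fact e"
  using pochhammer_product'[of "1 :: real" e k] pochhammer_pos[of "1 :: real" e] by (simp add: pochhammer_fact add.commute)

text \<open>At \<xi> = cos^2 \<psi> this is (-1)^e sin((2e + 1) \<psi>) / sin \<psi>, whose roots
  are the angles of 2e + 1 equally spaced lines in the plane.\<close>

lemma poly_sjacobi_real_even:
  "poly (sjacobi 2 (1/2) e) \<xi> = (\<Sum>k\<le>e. (-1)^k * real ((e + k) choose (2 * k)) * (4 * \<xi>) ^ k)"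
  unfolding sjacobi_def poly_sum poly_monom
proof (intro sum.cong refl)
  fix k assume k: "k \<in> {..e}"
  have 1: "pochhammer (2 + real e - 1) k = fact (e + k) / fact e"
    using pochhammer_Suc_fact[of e k] by (simp add: add.commute)
  have 2: "pochhammer (1/2 :: real) k = fact (2 * k) / (4 ^ k * fact k)"
    using fact_double[of k, where 'a = real] by (simp add: power_mult)
  have 3: "real (e choose k) = fact e / (fact k * fact (e - k))"
    using k by (simp add: binomial_fact)
  have "e + k - 2 * k = e - k" by simp
  then have 4: "real ((e + k) choose (2 * k)) = fact (e + k) / (fact (2 * k) * fact (e - k))"
    using k binomial_fact[of "2 * k" "e + k", where 'a = real] by simp
  show "(-1)^k * real (e choose k) * (pochhammer (2 + real e - 1) k / pochhammer (1/2) k) * \<xi> ^ k =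
      (-1)^k * real ((e + k) choose (2 * k)) * (4 * \<xi>) ^ k"
    unfolding 1 2 3 4 by (simp add: power_mult_distrib mult_ac)
qed

text \<open>At \<xi> = cos^2 \<psi> this is (-1)^e sin((2e + 2) \<psi>) / sin(2 \<psi>), belonging
  to 2e + 2 equally spaced lines. The factor e + 1 makes the leading coefficient 1 up to
  sign.\<close>

lemma poly_sjacobi_real_odd:
  "(real e + 1) * poly (sjacobi 3 (3/2) e) \<xi> = (\<Sum>k\<le>e. (-1)^k * real ((e + k + 1) choose (2 * k + 1)) * (4 * \<xi>) ^ k)"
  unfolding sjacobi_def poly_sum poly_monom sum_distrib_left
proof (intro sum.cong refl)
  fix k assume k: "k \<in> {..e}"
  have 1: "pochhammer (3 + real e - 1) k = fact (e + k + 1) / ((real e + 1) * fact e)"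
    using pochhammer_Suc_fact[of "e + 1" k] by (simp add: add.commute)
  have "pochhammer (1/2 :: real) (k + 1) = fact (2 * (k + 1)) / (4 ^ (k + 1) * fact (k + 1))"
    using fact_double[of "k + 1", where 'a = real] by (simp add: power_mult)
  moreover have "fact (2 * (k + 1)) = (2 * (real k + 1)) * (fact (2 * k + 1) :: real)"
    by (simp add: algebra_simps)
  moreover have "fact (k + 1) = (real k + 1) * (fact k :: real)" by simp
  moreover have "pochhammer (1/2 :: real) (k + 1) = 1/2 * pochhammer (3/2) k"
    by (simp add: pochhammer_rec)
  ultimately have "1/2 * pochhammer (3/2 :: real) k =
      2 * (real k + 1) * fact (2 * k + 1) / (4 ^ (k + 1) * ((real k + 1) * fact k))"
    by (simp only:)
  also have "\<dots> = 1/2 * (fact (2 * k + 1) / (4 ^ k * fact k))"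
  proof -
    have "2 * r * F / (4 ^ (k + 1) * (r * f)) = 1/2 * (F / (4 ^ k * f))" if "r \<noteq> 0" "f \<noteq> 0" for r F f :: real
      using that by (simp add: field_simps)
    moreover have "real k + 1 \<noteq> 0" "fact k \<noteq> (0 :: real)" by (linarith, simp)
    ultimately show ?thesis by blast
  qed
  finally have 2: "pochhammer (3/2 :: real) k = fact (2 * k + 1) / (4 ^ k * fact k)"
    by simp
  have 3: "real (e choose k) = fact e / (fact k * fact (e - k))"
    using k by (simp add: binomial_fact)
  have "e + k + 1 - (2 * k + 1) = e - k" by simp
  then have 4: "real ((e + k + 1) choose (2 * k + 1)) = fact (e + k + 1) / (fact (2 * k + 1) * fact (e - k))"
    using k binomial_fact[of "2 * k + 1" "e + k + 1", where 'a = real] by simp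
  have "real e + 1 \<noteq> 0" by linarith
  then show "(real e + 1) * ((-1)^k * real (e choose k) * (pochhammer (3 + real e - 1) k / pochhammer (3/2) k) * \<xi> ^ k) =
      (-1)^k * real ((e + k + 1) choose (2 * k + 1)) * (4 * \<xi>) ^ k"
    unfolding 1 2 3 4 by (simp add: power_mult_distrib mult_ac del: fact_Suc)
qed

text \<open>The ratio of consecutive dimensions is the quotient controlled by the last hypothesis
  times (a + 2i + 3) / (a + 2i + 1). The hypothesis is an equality for the real projective plane, so
  strictness is taken from the second factor.\<close>

lemma harm_dim_strict_increasing:
  assumes ab: "a > b" and b: "b > 0" and a1: "a > 1"
    and ineq: "\<And>i :: nat. (a - b + real i + 1) * (a + real i) \<ge> (b + real i + 1) * (real i + 2)"
  shows "harm_dim a b (Suc i) < harm_dim a b (Suc (Suc i))"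
proof -
  define U where "U = pochhammer (a - b) (Suc i) * pochhammer a i / (pochhammer b (Suc i) * fact (Suc i))"
  have U: "U > 0" unfolding U_def using ab b by (intro divide_pos_pos mult_pos_pos pochhammer_pos) auto
  have 1: "harm_dim a b (Suc i) = U * (a + 2 * i + 1)"
    unfolding harm_dim_eq[OF ab b] U_def by simp
  have "fact (Suc (Suc i)) = (fact (Suc i) * (real i + 2) :: real)" by (simp add: mult.commute)
  then have 2: "harm_dim a b (Suc (Suc i)) = U * ((a - b + i + 1) * (a + i) * (a + 2 * i + 3) / ((b + i + 1) * (i + 2)))"
    unfolding harm_dim_eq[OF ab b] U_def pochhammer_Suc[of _ "Suc i"] pochhammer_Suc[of a i]
    by (simp add: add_ac mult_ac del: fact_Suc)
  have pos: "(b + i + 1) * (i + 2) > 0" using b by (intro mult_pos_pos) auto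
  have "(a + 2 * i + 1) * ((b + i + 1) * (i + 2)) < (a + 2 * i + 3) * ((b + i + 1) * (i + 2))"
    using pos by (intro mult_strict_right_mono) auto
  also have "\<dots> \<le> (a + 2 * i + 3) * ((a - b + i + 1) * (a + i))"
    using ineq[of i] a1 by (intro mult_left_mono) (simp_all add: add.commute)
  finally have "a + 2 * i + 1 < (a - b + i + 1) * (a + i) * (a + 2 * i + 3) / ((b + i + 1) * (i + 2))"
    using pos by (simp add: pos_less_divide_eq mult_ac)
  from mult_strict_left_mono[OF this U] show ?thesis unfolding 1 2 .
qed

definition odd_mult :: "real \<Rightarrow> real \<Rightarrow> nat \<Rightarrow> real" where
  "odd_mult a b e = pochhammer a e * pochhammer (a - b) (Suc e) / (fact e * pochhammer b (Suc e))"

lemma odd_mult_strict_increasing: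
  assumes ab: "a > b" and b: "b > 0" and a1: "a > 1" and bb: "a - b \<ge> b"
  shows "odd_mult a b e < odd_mult a b (Suc e)"
proof -
  have U: "odd_mult a b e > 0"
    unfolding odd_mult_def using ab b by (intro divide_pos_pos mult_pos_pos pochhammer_pos) auto
  have 2: "odd_mult a b (Suc e) = odd_mult a b e * ((a + e) * (a - b + e + 1) / ((e + 1) * (b + e + 1)))"
    unfolding odd_mult_def pochhammer_Suc[of _ "Suc e"] pochhammer_Suc[of a e]
    by (simp add: add_ac mult_ac)
  have pos: "(e + 1) * (b + e + 1) > 0" using b by (intro mult_pos_pos) auto
  have "(e + 1) * (b + e + 1) < (a + e) * (b + e + 1)"
    using a1 b by (intro mult_strict_right_mono) auto
  also have "\<dots> \<le> (a + e) * (a - b + e + 1)"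
    using a1 bb by (intro mult_left_mono) auto
  finally have "1 < (a + e) * (a - b + e + 1) / ((e + 1) * (b + e + 1))"
    using pos by simp
  from mult_strict_left_mono[OF this U] show ?thesis unfolding 2 by simp
qed

context tight_scheme
begin

lemma A_less_1: "\<alpha> \<in> A \<Longrightarrow> \<alpha> < 1"
  using ang_less by (auto simp: A_def)

lemma angles_rational_small:
  assumes "a \<in> \<rat>" "b \<in> \<rat>" "e \<le> 1"
  shows "A \<subseteq> \<rat>"
proof
  fix \<alpha> assume \<alpha>: "\<alpha> \<in> A"
  show "\<alpha> \<in> \<rat>"
  proof (cases "\<alpha> = 0")
    case False
    with \<alpha> finite_A have "e > 0" by (auto simp: e_def card_gt_0_iff)
    with assms have e: "e = 1" by simp
    define a' b' where "a' = a + 1 + real (s - e)" and "b' = b + real (s - e)"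
    have ab': "a' > 0" "b' > 0" using ab b by (auto simp: a'_def b'_def)
    have "poly (sjacobi a' b' 1) \<alpha> = 0"
      using angle_polynomial[of \<alpha>] \<alpha> False unfolding a'_def b'_def e by simp
    then have "\<alpha> = b' / a'"
      using ab' by (simp add: sjacobi_def poly_monom field_simps)
    also have "\<dots> \<in> \<rat>" using assms by (auto simp: a'_def b'_def intro!: Rats_divide Rats_add)
    finally show ?thesis .
  qed simp
qed

lemma angles_rational_generic:
  assumes n: "n0 \<ge> 1" and a_def: "a = b * (real n0 + 1)" and b_cases: "b \<in> {1/2, 1, 2}"
    and exc: "\<not> (b = 1/2 \<and> n0 = 1)" "\<not> (b = 1 \<and> n0 = 1 \<and> t = 5)"
  shows "A \<subseteq> \<rat>"
proof -
  have "{1/2, 1, 2} \<subseteq> (\<rat> :: real set)" by auto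
  then have "b \<in> \<rat>" using b_cases by (rule subsetD)
  then have R: "a \<in> \<rat>" "b \<in> \<rat>" unfolding a_def by simp_all
  show ?thesis
  proof (cases "e \<le> 1")
    case True
    with R show ?thesis by (rule angles_rational_small)
  next
    case False
    then have s2: "s > 1" "e \<ge> 2" using s_e by auto
    have n1: "real n0 \<ge> 1" using n by simp
    have a1: "a > 1"
    proof (cases "n0 = 1")
      case True
      then show ?thesis using exc(1) b_cases by (auto simp: a_def)
    next
      case False
      have "1 < 1/2 * (2 + 1 :: real)" by simp
      also have "\<dots> \<le> b * (real n0 + 1)" using False n b_cases by (intro mult_mono) auto
      finally show ?thesis by (simp add: a_def)
    qed
    have bb: "a - b \<ge> b" using n b unfolding a_def by (simp add: algebra_simps)
    \<comment> \<open>Below a = 2 the real projective plane is the only remaining case, and there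
      both sides agree.\<close>
    have ineq: "(a - b + real i + 1) * (a + real i) \<ge> (b + real i + 1) * (real i + 2)" for i
    proof (cases "a \<ge> 2")
      case True
      then show ?thesis using bb b by (intro mult_mono) auto
    next
      case False
      then have b2: "b = 1/2" using b_cases n1 unfolding a_def by auto
      have "n0 = 2" using False exc(1) n unfolding a_def b2 by auto
      then have a2: "a = 3/2" unfolding a_def b2 by simp
      show ?thesis unfolding a2 b2 by (simp add: algebra_simps)
    qed
    have inc: "harm_dim a b (Suc i) < harm_dim a b (Suc (Suc i))" for i
      by (rule harm_dim_strict_increasing[OF ab b a1 ineq])
    have j1: "harm_dim a b 1 = real n0 * (a + 1)"
    proof -
      have "a - b = b * real n0" by (simp add: a_def algebra_simps)
      then show ?thesis using harm_dim_eq[OF ab b, of 0] b by simp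
    qed
    have j0: "harm_dim a b 1 > 1"
    proof -
      have "1 * 1 < real n0 * (a + 1)" using n1 a1 by (intro mult_le_less_imp_less) auto
      then show ?thesis unfolding j1 by simp
    qed
    have jne: "harm_dim a b i \<noteq> harm_dim a b 1" if "i \<noteq> 1" for i
    proof (cases i)
      case 0
      then show ?thesis using j0 by simp
    next
      case (Suc i')
      then have "harm_dim a b (Suc 0) < harm_dim a b (Suc i')"
        using that lift_Suc_mono_less[of "\<lambda>i. harm_dim a b (Suc i)" 0 i'] inc by simp
      with Suc show ?thesis by simp
    qed
    have "mult i \<noteq> mult 1" if i: "i \<le> s" "i \<noteq> 1" for i
    proof (cases "i < s")
      case True
      then show ?thesis using jne[OF i(2)] s2 by (simp add: mult_less)
    next
      case False
      with i have i_s: "i = s" by simp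
      show ?thesis
      proof (cases "e = s")
        case True
        then show ?thesis using mult_s_even jne[OF i(2)] s2 i_s by (simp add: mult_less)
      next
        case False
        then have se: "s = e + 1" using s_e by linarith
        then have ms: "mult s = odd_mult a b e" using mult_s_odd[OF se] by (simp add: odd_mult_def)
        have inc': "odd_mult a b e < odd_mult a b (Suc e)" for e
          by (rule odd_mult_strict_increasing[OF ab b a1 bb])
        \<comment> \<open>The case e = 2 decides, because \<open>odd_mult\<close> increases with e:
          its value is \<open>harm_dim a b 1\<close> times an explicit ratio.\<close>
        have o2: "odd_mult a b 2 = real n0 * (a + 1) * (a * (b * n0 + 1) * (b * n0 + 2) / (2 * (b + 1) * (b + 2)))"
        proof -
          have "a - b = b * real n0" by (simp add: a_def algebra_simps)
          then show ?thesis using b by (simp add: odd_mult_def eval_nat_numeral pochhammer_Suc mult_ac)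
            (simp add: algebra_simps)
        qed
        \<comment> \<open>The ratio is at least 1, with equality just for b = n0 = 1. This is the
          coincidence of ranks for 5-designs on the complex projective line.\<close>
        have ratio: "a * (b * n0 + 1) * (b * n0 + 2) \<ge> 2 * (b + 1) * (b + 2) \<and>
          (a * (b * n0 + 1) * (b * n0 + 2) = 2 * (b + 1) * (b + 2) \<longrightarrow> b = 1 \<and> n0 = 1)"
        proof (cases "n0 = 1")
          case True
          then show ?thesis using b_cases exc(1) by (auto simp: a_def)
        next
          case False
          then have n2: "real n0 \<ge> 2" using n by simp
          have bh: "b \<ge> 1/2" using b_cases by auto
          then have "b * 3 * 2 \<le> b * 3 * (b * 2 + 1)" by (intro mult_left_mono) auto
          then have "b + 2 < b * 3 * (b * 2 + 1)" using bh by linarith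
          then have "2 * (b + 1) * (b + 2) < 2 * (b + 1) * (b * 3 * (b * 2 + 1))"
            using b by (intro mult_strict_left_mono) auto
          also have "\<dots> = (b * 3) * (b * 2 + 1) * (b * 2 + 2)" by (simp add: algebra_simps)
          also have "\<dots> \<le> a * (b * n0 + 1) * (b * n0 + 2)"
            unfolding a_def using n2 b by (intro mult_mono add_mono mult_left_mono) auto
          finally show ?thesis by simp
        qed
        have pos: "2 * (b + 1) * (b + 2) > 0" using b by simp
        have n0a: "real n0 * (a + 1) > 0" using n1 a1 by simp
        have "mult s > harm_dim a b 1"
        proof (cases "b = 1 \<and> n0 = 1")
          case True
          then have "e \<noteq> 2" using exc(2) tight se by auto
          then have "odd_mult a b 2 < odd_mult a b e"
            using s2(2) lift_Suc_mono_less[of "odd_mult a b" 2 e] inc' by simp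
          moreover have "odd_mult a b 2 = harm_dim a b 1" unfolding o2 j1 using True by (simp add: a_def)
          ultimately show ?thesis by (simp add: ms)
        next
          case False
          then have "a * (b * n0 + 1) * (b * n0 + 2) / (2 * (b + 1) * (b + 2)) > 1"
            unfolding less_divide_eq_1_pos[OF pos] using ratio by (metis order_le_less)
          from mult_strict_left_mono[OF this n0a] have "odd_mult a b 2 > harm_dim a b 1"
            unfolding o2 j1 by (simp only: mult_1_right)
          moreover have "odd_mult a b 2 \<le> odd_mult a b e"
            using s2(2) lift_Suc_mono_le[of "odd_mult a b" 2 e] inc' by (simp add: less_imp_le)
          ultimately show ?thesis by (simp add: ms)
        qed
        then show ?thesis using s2 i_s by (simp add: mult_less)
      qed
    qed
    then show ?thesis by (intro angles_rational[OF R s2(1)]) auto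
  qed
qed

text \<open>t = 5 forces e = 2 and s = 3, and the angle polynomial is 1 - 5 x + 5 x^2. So 10
  \<alpha> - 5 is a root of y^2 - 5, which has no integer root.\<close>

lemma angles_CP1_irrational:
  assumes "a = 2" "b = 1" "t = 5"
  shows "\<not> A \<subseteq> \<rat>"
proof
  assume R: "A \<subseteq> \<rat>"
  have e: "e = 2" "s - e = 1" using assms(3) tight s_e(1,2) by presburger+
  then have "card (A - {0}) \<noteq> 0" by (simp flip: e_def)
  then have "A - {0} \<noteq> {}" by (metis card.empty)
  then obtain \<alpha> where \<alpha>: "\<alpha> \<in> A - {0}" by blast
  have "poly (sjacobi 4 2 2) \<alpha> = 0"
    using angle_polynomial[OF \<alpha>] unfolding e(2) unfolding e(1) assms by simp
  then have "1 - 5 * \<alpha> + 5 * \<alpha>\<^sup>2 = 0"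
    by (simp add: sjacobi_def poly_monom eval_nat_numeral pochhammer_Suc field_simps)
  then have sq: "(10 * \<alpha> - 5)\<^sup>2 = 5" by (simp add: power2_eq_square algebra_simps)
  have "algebraic_int (10 * \<alpha> - 5)"
  proof
    show "lead_coeff [:-5, 0, 1 :: real:] = 1" by simp
    show "\<forall>i. coeff [:-5, 0, 1 :: real:] i \<in> \<int>" by (auto simp: coeff_pCons split: nat.splits)
    show "poly [:-5, 0, 1:] (10 * \<alpha> - 5) = 0" using sq by (simp add: power2_eq_square algebra_simps)
  qed
  moreover have "10 * \<alpha> - 5 \<in> \<rat>" using R \<alpha> by (intro Rats_diff Rats_mult) auto
  ultimately have "10 * \<alpha> - 5 \<in> \<int>" by (rule rational_algebraic_int_is_int)
  then obtain m :: int where "10 * \<alpha> - 5 = of_int m" by (elim Ints_cases)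
  with sq have "real_of_int (m\<^sup>2) = of_int 5" by simp
  then have m: "m\<^sup>2 = 5" by (simp only: of_int_eq_iff)
  then have "\<bar>m\<bar>\<^sup>2 = 5" by simp
  moreover have "\<bar>m\<bar> \<le> 2 \<or> \<bar>m\<bar> \<ge> 3" by linarith
  moreover have "\<bar>m\<bar>\<^sup>2 \<le> 4" if "\<bar>m\<bar> \<le> 2" using power_mono[OF that, of 2] by simp
  moreover have "\<bar>m\<bar>\<^sup>2 \<ge> 9" if "\<bar>m\<bar> \<ge> 3" using power_mono[OF that, of 2] by simp
  ultimately show False by auto
qed

text \<open>If the angles are rational, each 4 \<alpha> with \<alpha> nonzero is an integer strictly
  between 0 and 4, so e <= 3. For e = 3 all of 1/4, 1/2, 3/4 would be roots, but 1/4 is not; for e =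
  s = 2 none of them is. For e = 2 and s = 3 the roots are 1/4 and 3/4, which is t = 5.\<close>

lemma angles_RP1:
  assumes a: "a = 1" "b = 1/2" and nonneg: "\<And>\<alpha>. \<alpha> \<in> A \<Longrightarrow> \<alpha> \<ge> 0"
  shows "A \<subseteq> \<rat> \<longleftrightarrow> t \<in> {1, 2, 3, 5}"
proof (cases "e \<le> 1")
  case True
  have "a \<in> \<rat>" "b \<in> \<rat>" unfolding a by simp_all
  then have "A \<subseteq> \<rat>" using True by (rule angles_rational_small)
  moreover have "t \<in> {1, 2, 3, 5}" using True tight s_e by auto
  ultimately show ?thesis by simp
next
  case False
  consider "s = e" | "s = e + 1" using s_e by linarith
  then have root: "(s = e \<and> poly (sjacobi 2 (1/2) e) \<alpha> = 0) \<or> (s = e + 1 \<and> poly (sjacobi 3 (3/2) e) \<alpha> = 0)" if "\<alpha> \<in> A - {0}" for \<alpha>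
    using angle_polynomial[OF that] by cases (simp_all add: a)
  have alg: "algebraic_int (4 * \<alpha>)" if \<alpha>: "\<alpha> \<in> A - {0}" for \<alpha>
    using root[OF \<alpha>]
  proof (elim disjE conjE)
    assume "poly (sjacobi 2 (1/2) e) \<alpha> = 0"
    then show ?thesis
      unfolding poly_sjacobi_real_even by (intro algebraic_int_alternating[of "\<lambda>k. (e + k) choose (2 * k)"]) (simp_all flip: mult_2)
  next
    assume "poly (sjacobi 3 (3/2) e) \<alpha> = 0"
    then have "(real e + 1) * poly (sjacobi 3 (3/2) e) \<alpha> = 0" by simp
    then show ?thesis
      unfolding poly_sjacobi_real_odd by (intro algebraic_int_alternating[of "\<lambda>k. (e + k + 1) choose (2 * k + 1)"]) (simp_all flip: mult_2)
  qed
  have card: "card (A - {0}) = e" by (simp add: e_def)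
  show ?thesis
  proof (cases "s = e + 1 \<and> e = 2")
    case True
    have "\<alpha> \<in> \<rat>" if "\<alpha> \<in> A" for \<alpha>
    proof (cases "\<alpha> = 0")
      case False
      with that have "poly (sjacobi 3 (3/2) 2) \<alpha> = 0" using root[of \<alpha>] True by auto
      then have "(4 * \<alpha> - 1) * (4 * \<alpha> - 3) = 0"
        by (simp add: sjacobi_def poly_monom eval_nat_numeral pochhammer_Suc field_simps)
      then have "\<alpha> \<in> {1/4, 3/4}" by auto
      moreover have "{1/4, 3/4} \<subseteq> (\<rat> :: real set)" by auto
      ultimately show ?thesis by (rule rev_subsetD)
    qed simp
    moreover have "t = 5" using True tight by simp
    ultimately show ?thesis by auto
  next
    case not5: False
    have t: "t \<notin> {1, 2, 3, 5}" using not5 False tight s_e(1,2) by simp presburger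
    have "\<not> A \<subseteq> \<rat>"
    proof
      assume R: "A \<subseteq> \<rat>"
      have sub: "A - {0} \<subseteq> {1/4, 1/2, 3/4}"
      proof
        fix \<alpha> assume \<alpha>: "\<alpha> \<in> A - {0}"
        have "4 * \<alpha> \<in> \<int>"
          by (rule rational_algebraic_int_is_int[OF alg[OF \<alpha>]]) (use R \<alpha> in auto)
        then obtain m :: int where m: "4 * \<alpha> = of_int m" by (elim Ints_cases)
        have "\<alpha> > 0" "\<alpha> < 1" using nonneg[of \<alpha>] A_less_1[of \<alpha>] \<alpha> by auto
        then have "real_of_int m > 0" "real_of_int m < 4" using m by linarith+
        then have "m = 1 \<or> m = 2 \<or> m = 3" by linarith
        then show "\<alpha> \<in> {1/4, 1/2, 3/4}" using m by auto
      qed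
      then have "e \<le> card {1/4, 1/2, 3/4 :: real}" unfolding card[symmetric] by (intro card_mono) auto
      then have e: "e = 2 \<or> e = 3" using False by auto
      then show False
      proof
        assume e: "e = 2"
        then have se: "s = e" using not5 s_e by auto
        have "A - {0} \<noteq> {}" using card e by (metis card.empty zero_neq_numeral)
        then obtain \<alpha> where \<alpha>: "\<alpha> \<in> A - {0}" by blast
        then have "poly (sjacobi 2 (1/2) 2) \<alpha> = 0" using root[OF \<alpha>] e se by auto
        moreover have "\<alpha> = 1/4 \<or> \<alpha> = 1/2 \<or> \<alpha> = 3/4" using sub \<alpha> by auto
        moreover have "poly (sjacobi 2 (1/2) 2) (1/4) \<noteq> 0" "poly (sjacobi 2 (1/2) 2) (1/2) \<noteq> 0"
          "poly (sjacobi 2 (1/2) 2) (3/4) \<noteq> 0"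
          by (simp_all add: sjacobi_def poly_monom eval_nat_numeral pochhammer_Suc)
        ultimately show False by metis
      next
        assume e: "e = 3"
        then have "A - {0} = {1/4, 1/2, 3/4}" using sub card by (intro card_subset_eq) auto
        then have "1/4 \<in> A - {0}" by blast
        from root[OF this] show False
          unfolding e by (auto simp: sjacobi_def poly_monom eval_nat_numeral pochhammer_Suc)
      qed
    qed
    with t show ?thesis by simp
  qed
qed

end

theorem theorem4p2:
  fixes n t :: nat
  assumes "n \<ge> 1" and "CARD('n :: finite) = n + 1"
  shows
    "(\<forall>X :: (real, 'n) proj_space set.
        tight_design t X \<longrightarrow> (angle_set X \<subseteq> \<rat> \<longleftrightarrow> \<not> (n = 1 \<and> t \<notin> {1, 2, 3, 5}))) \<and>
     (\<forall>X :: (complex, 'n) proj_space set.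
        tight_design t X \<longrightarrow> (angle_set X \<subseteq> \<rat> \<longleftrightarrow> \<not> (n = 1 \<and> t = 5))) \<and>
     (\<forall>X :: (quat, 'n) proj_space set.
        tight_design t X \<longrightarrow> angle_set X \<subseteq> \<rat>)"
proof (intro conjI allI impI)
  fix X :: "(real, 'n) proj_space set"
  assume td: "tight_design t X"
  interpret tight_scheme X angle "1/2 * (real n + 1)" "1/2"
    "\<lambda>i j. smult (real (card X) * (pochhammer (1/2) (i + j) / pochhammer (1/2 * (real n + 1)) (i + j)))
      (conv_poly DIM(real) i j)"
    "angle_set X" t "card (angle_set X)" "card (angle_set X - {0})"
    using tight_scheme_of_tight_design[OF td assms(2,1)] by (simp add: add.commute)
  show "angle_set X \<subseteq> \<rat> \<longleftrightarrow> \<not> (n = 1 \<and> t \<notin> {1, 2, 3, 5})"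
  proof (cases "n = 1")
    case True
    then show ?thesis
      \<comment> \<open>The locale bounds angles from above; their nonnegativity, which confines 4
        \<alpha>, is supplied from the geometry.\<close>
      using angles_RP1 angle_nonneg by (auto simp: angle_set_def)
  next
    case False
    then show ?thesis using angles_rational_generic[OF assms(1)] by simp
  qed
next
  fix X :: "(complex, 'n) proj_space set"
  assume td: "tight_design t X"
  interpret tight_scheme X angle "1 * (real n + 1)" 1
    "\<lambda>i j. smult (real (card X) * (pochhammer 1 (i + j) / pochhammer (1 * (real n + 1)) (i + j)))
      (conv_poly DIM(complex) i j)"
    "angle_set X" t "card (angle_set X)" "card (angle_set X - {0})"
    using tight_scheme_of_tight_design[OF td assms(2,1)] by (simp add: add.commute)
  show "angle_set X \<subseteq> \<rat> \<longleftrightarrow> \<not> (n = 1 \<and> t = 5)"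
  proof (cases "n = 1 \<and> t = 5")
    case True
    then show ?thesis using angles_CP1_irrational by simp
  next
    case False
    then show ?thesis using angles_rational_generic[OF assms(1)] by auto
  qed
next
  fix X :: "(quat, 'n) proj_space set"
  assume td: "tight_design t X"
  interpret tight_scheme X angle "2 * (real n + 1)" 2
    "\<lambda>i j. smult (real (card X) * (pochhammer 2 (i + j) / pochhammer (2 * (real n + 1)) (i + j)))
      (conv_poly DIM(quat) i j)"
    "angle_set X" t "card (angle_set X)" "card (angle_set X - {0})"
    using tight_scheme_of_tight_design[OF td assms(2,1)] by (simp add: add.commute)
  show "angle_set X \<subseteq> \<rat>" using angles_rational_generic[OF assms(1)] by simp
qed

end
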